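(* Let $N\ge 3$, let $k$ be a positive integer with $k<N-2$, and let $f$ be a non-negative, continuous, radially symmetric function on $\{x\in\mathbb{R}^N:|x|\ge 1\}$ satisfying $f(x)\le K|x|^{-2-\sigma}$ for $|x|\ge1$, for some $\sigma,K>0$. For $\epsilon>0$ let $$V_{k,\epsilon}(x)=\begin{cases}\left(\frac{N-2}{2}\right)^2|x|^{-2}+\frac14|x|^{-2}\sum_{i=1}^kX_1^2(|x|)\cdots X_i^2(|x|),&|x|<1,\\ \epsilon f(x),&|x|>1,\end{cases}$$ and define $$\epsilon_{k,0}=\inf_{u\in\mathcal{H}^1(B^c)}\frac{\int_{B^c}|\nabla u|^2dx-\frac{N-2+k}{2}\int_{\partial B}u^2dS}{\int_{B^c}fu^2dx}.$$ Then $\epsilon_{k,0}>0$, and for any $\epsilon\in(0,\epsilon_{k,0})$ there is a constant $c>0$ such that $$\int_{\mathbb{R}^N}|\nabla u|^2dx-\int_{\mathbb{R}^N}V_{k,\epsilon}u^2dx\ \ge\ c\left(\int_{\mathbb{R}^N}|u|^{\frac{2N}{N-2}}(\tilde X_1\cdots\tilde X_{k+1})^{\frac{2N-2}{N-2}}dx\right)^{\frac{N-2}{N}}\qquad\text{for all }u\in C^\infty_c(\mathbb{R}^N).$$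
   Context: $B$ is the unit ball of $\mathbb{R}^N$ centered at $0$ and $B^c$ its complement. $\mathcal{H}^1(B^c)$ is the completion of the set of restrictions to $B^c$ of functions in $C^\infty_c(\mathbb{R}^N)$ under the norm $\left(\int_{B^c}|\nabla u|^2dx\right)^{1/2}+\left(\int_{B^c}\frac{|u|^2}{|x|^2}dx\right)^{1/2}$. The infimum defining $\epsilon_{k,0}$ is over those $u$ with $\int_{B^c}fu^2dx>0$ (with value $+\infty$ if there are none). $X_1(t)=(1-\log t)^{-1}$ and $X_{j+1}(t)=X_1(X_j(t))$, $j\ge1$, for $t\in(0,1)$; $\tilde X_j=\tilde X_j(|x|)$ equals $X_j(|x|)$ for $|x|<1$ and $1$ for $|x|>1$. *)

theory Defs
  imports "HOL-Analysis.Analysis"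
begin

subsection \<open>Test functions\<close>

definition gradient :: "(real^'n \<Rightarrow> real) \<Rightarrow> real^'n \<Rightarrow> real^'n" where
  "gradient u x = (\<chi> i. frechet_derivative u (at x) (axis i 1))"

fun C_class :: "nat \<Rightarrow> (real^'n \<Rightarrow> real) \<Rightarrow> bool" where
  "C_class 0 u \<longleftrightarrow> continuous_on UNIV u"
| "C_class (Suc m) u \<longleftrightarrow>
     u differentiable_on UNIV \<and> (\<forall>i. C_class m (\<lambda>x. gradient u x $ i))"

definition test_functions :: "(real^'n \<Rightarrow> real) set" where
  "test_functions = {u. (\<forall>m. C_class m u) \<and> compact (closure {x. u x \<noteq> 0})}"

subsection \<open>The exterior of the unit ball and its boundary\<close>

definition ext_ball :: "(real^'n) set" where
  "ext_ball = - ball 0 1"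

text \<open>Surface measure on the unit sphere as the cone measure: the area of a subset \<open>A\<close> of the
  sphere is \<open>N\<close> times the volume of \<open>{t *\<^sub>R x | t x. 0 < t \<and> t < 1 \<and> x \<in> A}\<close>.  It is extended to the
  Borel sets of the whole space; the centre, where \<open>sgn 0 = 0\<close>, is a null set.\<close>

definition sphere_measure :: "(real^'n) measure" where
  "sphere_measure =
     scale_measure (of_nat CARD('n)) (distr (restrict_space lborel (ball 0 1)) borel sgn)"

subsection \<open>The space \<open>H\<^sup>1\<close> of the exterior domain\<close>

text \<open>The completion is realised as the closure of the image of the test functions under
  \<open>\<phi> \<mapsto> (\<phi>, \<nabla>\<phi>)\<close> in the product of \<open>L\<^sup>2(|x|\<^sup>-\<^sup>2 dx)\<close> and \<open>L\<^sup>2(dx)\<close> over \<open>ext_ball\<close>, so an element is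
  a function together with its (generalised) gradient.  Only the values on \<open>ext_ball\<close> matter, up to
  null sets.  Distances are \<open>ennreal\<close>-valued, so that convergence also forces square integrability.\<close>

definition H1_converges ::
    "(nat \<Rightarrow> real^'n \<Rightarrow> real) \<Rightarrow> (real^'n \<Rightarrow> real) \<Rightarrow> (real^'n \<Rightarrow> real^'n) \<Rightarrow> bool" where
  "H1_converges \<phi> u G \<longleftrightarrow>
     ((\<lambda>n. \<integral>\<^sup>+x\<in>ext_ball. ennreal ((norm (gradient (\<phi> n) x - G x))\<^sup>2) \<partial>lborel) \<longlonglongrightarrow> 0) \<and>
     ((\<lambda>n. \<integral>\<^sup>+x\<in>ext_ball. ennreal ((\<phi> n x - u x)\<^sup>2 / (norm x)\<^sup>2) \<partial>lborel) \<longlonglongrightarrow> 0)"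

definition H1_ext :: "((real^'n \<Rightarrow> real) \<times> (real^'n \<Rightarrow> real^'n)) set" where
  "H1_ext = {(u, G).
     set_borel_measurable lborel ext_ball u \<and> set_borel_measurable lborel ext_ball G \<and>
     (\<exists>\<phi>. (\<forall>n. \<phi> n \<in> test_functions) \<and> H1_converges \<phi> u G)}"

text \<open>\<open>T\<close> is the trace on the unit sphere of the element \<open>(u, G)\<close>, i.e. the value of the continuous
  extension to the completion of the restriction map from test functions to \<open>L\<^sup>2\<close> of the sphere.
  By the trace theorem it exists for every element of \<open>H1_ext\<close> and is unique up to null sets.\<close>

definition H1_trace ::
    "(real^'n \<Rightarrow> real) \<Rightarrow> (real^'n \<Rightarrow> real^'n) \<Rightarrow> (real^'n \<Rightarrow> real) \<Rightarrow> bool" where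
  "H1_trace u G T \<longleftrightarrow> T \<in> borel_measurable borel \<and>
     (\<exists>\<phi>. (\<forall>n. \<phi> n \<in> test_functions) \<and> H1_converges \<phi> u G \<and>
        ((\<lambda>n. \<integral>\<^sup>+x. ennreal ((\<phi> n x - T x)\<^sup>2) \<partial>sphere_measure) \<longlonglongrightarrow> 0))"

text \<open>As an \<open>ereal\<close> infimum this is \<open>\<infinity>\<close> when no admissible function exists.\<close>

definition eps_k0 :: "nat \<Rightarrow> (real^'n \<Rightarrow> real) \<Rightarrow> ereal" where
  "eps_k0 k f =
     (INF (u, G, T) \<in> {(u, G, T). (u, G) \<in> H1_ext \<and> H1_trace u G T \<and>
                                  (LINT x:ext_ball|lborel. f x * (u x)\<^sup>2) > 0}.
        ereal (((LINT x:ext_ball|lborel. (norm (G x))\<^sup>2)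
                 - (real CARD('n) - 2 + real k) / 2 * (LINT x|sphere_measure. (T x)\<^sup>2))
               / (LINT x:ext_ball|lborel. f x * (u x)\<^sup>2)))"

subsection \<open>Iterated logarithms and the potential\<close>

definition X1 :: "real \<Rightarrow> real" where
  "X1 t = 1 / (1 - ln t)"

definition X :: "nat \<Rightarrow> real \<Rightarrow> real" where
  "X j = X1 ^^ j"

definition X_tilde :: "nat \<Rightarrow> real^'n \<Rightarrow> real" where
  "X_tilde j x = (if norm x < 1 then X j (norm x) else 1)"

text \<open>The values at the origin and on the unit sphere are irrelevant (null sets).\<close>

definition V :: "(real^'n \<Rightarrow> real) \<Rightarrow> nat \<Rightarrow> real \<Rightarrow> real^'n \<Rightarrow> real" where
  "V f k \<epsilon> x =
     (if norm x < 1
      then ((real CARD('n) - 2) / 2)\<^sup>2 / (norm x)\<^sup>2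
           + 1 / 4 / (norm x)\<^sup>2 * (\<Sum>i=1..k. \<Prod>j=1..i. (X j (norm x))\<^sup>2)
      else \<epsilon> * f x)"

end

theory Submission
  imports Defs
begin

text \<open>Write \<open>N\<close> for the dimension, \<open>p = 2N/(N-2)\<close> and \<open>W = X\<^sub>1\<cdots>X\<^sub>k\<^sub>+\<^sub>1\<close>, extended by \<open>1\<close> outside
  the ball.  In the ball the ground state \<open>\<phi> = r\<^sup>-\<^sup>(\<^sup>N\<^sup>-\<^sup>2\<^sup>)\<^sup>/\<^sup>2 (X\<^sub>1\<cdots>X\<^sub>k)\<^sup>-\<^sup>1\<^sup>/\<^sup>2\<close> turns the quadratic form
  into \<open>\<integral> \<phi>\<^sup>2|\<nabla>(u/\<phi>)|\<^sup>2\<close> minus the boundary term with the constant \<open>(N-2+k)/2\<close>, which is exactly the one in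
  the definition of \<open>\<epsilon>\<^sub>k\<^sub>,\<^sub>0\<close>.  As \<open>k < N-2\<close>, the exterior form controls \<open>\<integral>|\<nabla>u|\<^sup>2\<close> over the exterior,
  by integration along rays, and this survives the subtraction of the \<open>\<epsilon> f\<close> term.  So the whole form is
  bounded below by a multiple of \<open>D = \<integral>\<^sub>B \<phi>\<^sup>2|\<nabla>(u/\<phi>)|\<^sup>2 + \<integral>|\<nabla>u|\<^sup>2\<close> (second integral over the exterior).

  To bound the weighted \<open>L\<^sup>p\<close> norm by \<open>D\<close>, let \<open>E(s)\<close> be the integral of \<open>|\<nabla>u|\<^sup>2 + u\<^sup>2/|x|\<^sup>2\<close> over the
  annulus at scale \<open>s\<close>.  The Sobolev inequality with a cutoff bounds the integral of \<open>|u|\<^sup>p\<close> over a smaller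
  annulus by \<open>C E(s)\<^sup>p\<^sup>/\<^sup>2\<close>, and inequalities along rays give both \<open>W(s) E(s) \<le> C D\<close> and
  \<open>\<integral> W(s)\<^sup>2 E(s) ds/s \<le> C D\<close>.  Hence \<open>W\<^sup>1\<^sup>+\<^sup>p\<^sup>/\<^sup>2 E\<^sup>p\<^sup>/\<^sup>2 = (W E)\<^sup>p\<^sup>/\<^sup>2\<^sup>-\<^sup>1 W\<^sup>2 E\<close> is integrable with respect
  to \<open>ds/s\<close>.\<close>

subsection \<open>The inequalities of Loomis--Whitney and Gagliardo--Nirenberg--Sobolev\<close>

text \<open>The boundary constant \<open>(N-2+k)/2\<close> competes with the trace constant of the
  exterior Dirichlet integral, which is \<open>N-2\<close> with extremal \<open>|x|^(2-N)\<close>.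
  The gap between them is positive because \<open>k < N-2\<close>; it supplies the coercivity both
  for the positivity of \<open>eps_k0\<close> and for the final constant. The obstacle inside the
  ball is that the remainder \<open>\<phi>^2 |\<nabla>(u/\<phi>)|^2\<close> controls
  \<open>u^2/|x|^2\<close> only with the weight \<open>W^2\<close>, which vanishes at the origin, so
  the unweighted Sobolev inequality is not applied to the ball as a whole. On a single annulus the
  weight is constant up to a factor, since the iterated logarithms are doubling, and the local
  Sobolev constant does not depend on the scale. The boundary terms that the interior estimates
  leave at \<open>|x| = 1\<close> are paid for by the exterior gradient. The exponent of the weight
  is forced by the interpolation: \<open>1 + p/2 = (2N-2)/(N-2)\<close>. Almost everything is stated
  for \<open>ennreal\<close> integrals, so finiteness is settled only where differences have to be
  formed.\<close>

definition ennpow :: "ennreal \<Rightarrow> real \<Rightarrow> ennreal" where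
  "ennpow a t = (if a = top then top else ennreal (enn2real a powr t))"

lemma ennpow_ennreal: "0 \<le> a \<Longrightarrow> ennpow (ennreal a) t = ennreal (a powr t)"
  by (simp add: ennpow_def)

lemma measurable_ennpow [measurable (raw)]:
  "f \<in> borel_measurable M \<Longrightarrow> (\<lambda>x. ennpow (f x) t) \<in> borel_measurable M"
  unfolding ennpow_def by (intro measurable_If) auto

lemma ennpow_mono: "a \<le> b \<Longrightarrow> 0 \<le> t \<Longrightarrow> ennpow a t \<le> ennpow b t"
  unfolding ennpow_def
  by (auto simp: top_unique less_top intro!: ennreal_leI powr_mono2 enn2real_mono)

lemma ennpow_0: "ennpow 0 t = 0"
  by (simp add: ennpow_def)

text \<open>No side condition is needed: \<open>0 * top = 0\<close> in \<open>ennreal\<close>, and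
  \<open>ennpow 0 t = 0\<close> for every \<open>t\<close> because \<open>0 powr t = 0\<close>,
  while a nonzero finite factor has a nonzero power.\<close>

lemma ennpow_mult: "ennpow (a * b) t = ennpow a t * ennpow b t"
proof -
  consider "a = 0" | "b = 0" | "a \<noteq> 0" "b \<noteq> 0" "a = top \<or> b = top" | "a \<noteq> top" "b \<noteq> top"
    by blast
  then show ?thesis
  proof cases
    case 3
    then have "a * b = top" by (auto simp: ennreal_mult_eq_top_iff)
    moreover have "enn2real c powr t > 0" if "c \<noteq> 0" "c \<noteq> top" for c
      using that by (cases c) auto
    ultimately show ?thesis using 3
      by (auto simp: ennpow_def ennreal_mult_eq_top_iff)
  next
    case 4
    then show ?thesis
      by (simp add: ennpow_def ennreal_mult_eq_top_iff enn2real_mult powr_mult ennreal_mult)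
  qed (simp_all add: ennpow_0)
qed

lemma ennpow_eq_0_iff: "ennpow a t = 0 \<longleftrightarrow> a = 0"
  by (auto simp: ennpow_def ennreal_eq_0_iff enn2real_eq_0_iff)

lemma ennreal_arith_geom_mean:
  fixes f :: "'i \<Rightarrow> ennreal"
  assumes "finite I" "I \<noteq> {}"
  shows "(\<Prod>i\<in>I. ennpow (f i) (1 / card I)) \<le> (\<Sum>i\<in>I. f i) / card I"
proof (cases "\<exists>i\<in>I. f i = top")
  case True
  then have "(\<Sum>i\<in>I. f i) = top" using assms by auto
  then show ?thesis by (simp add: ennreal_top_divide)
next
  case False
  define g where "g i = enn2real (f i)" for i
  have fg: "f i = ennreal (g i)" "g i \<ge> 0" if "i \<in> I" for i
    using that False by (auto simp: g_def less_top)
  have c: "card I > 0" using assms by (simp add: card_gt_0_iff)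
  have "(\<Prod>i\<in>I. ennpow (f i) (1 / card I)) = ennreal (\<Prod>i\<in>I. g i powr (1 / card I))"
    by (simp add: fg ennpow_ennreal flip: prod_ennreal)
  also have "(\<Prod>i\<in>I. g i powr (1 / card I)) = (\<Prod>i\<in>I. g i) powr (1 / card I)"
    using fg by (simp add: prod_powr_distrib)
  also have "\<dots> \<le> (\<Sum>i\<in>I. g i) / card I"
  proof -
    have "(\<Prod>i\<in>I. g i) powr (1 / card I) \<le> (\<Sum>i\<in>I. g i / card I)"
      using arith_geom_mean[of I g] assms fg by auto
    then show ?thesis by (simp add: sum_divide_distrib)
  qed
  also have "ennreal \<dots> = (\<Sum>i\<in>I. f i) / card I"
    using c fg by (simp add: divide_ennreal[symmetric] sum_nonneg ennreal_of_nat_eq_real_of_nat flip: sum_ennreal)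
  finally show ?thesis by (simp add: ennreal_leI)
qed

text \<open>Each factor is divided by its integral \<open>c i\<close>; the arithmetic-geometric mean
  inequality then bounds the normalised product pointwise by an average whose integral is 1. If some
  \<open>c i\<close> vanishes, so does the product almost everywhere; if none vanishes and one is
  infinite, so is the right-hand side.\<close>

lemma Holder_prod_nn_integral:
  assumes I: "finite I" "I \<noteq> {}" and [measurable]: "\<And>i. i \<in> I \<Longrightarrow> f i \<in> borel_measurable M"
  shows "(\<integral>\<^sup>+x. (\<Prod>i\<in>I. ennpow (f i x) (1 / card I)) \<partial>M) \<le> (\<Prod>i\<in>I. ennpow (\<integral>\<^sup>+x. f i x \<partial>M) (1 / card I))"
proof -
  define c where "c i = (\<integral>\<^sup>+x. f i x \<partial>M)" for i
  have card: "card I > 0" using I by (simp add: card_gt_0_iff)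
  consider (zero) i where "i \<in> I" "c i = 0" | (top) i where "\<forall>i\<in>I. c i \<noteq> 0" "i \<in> I" "c i = top"
    | (fin) "\<forall>i\<in>I. c i \<noteq> 0 \<and> c i \<noteq> top" by blast
  then show ?thesis
  proof cases
    case zero
    then have "AE x in M. f i x = 0" using nn_integral_0_iff_AE[of "f i" M] by (auto simp: c_def)
    then have "AE x in M. (\<Prod>i\<in>I. ennpow (f i x) (1 / card I)) = 0"
      using zero I by (auto elim!: eventually_mono intro!: prod_zero bexI[of _ i] simp: ennpow_0)
    then have "(\<integral>\<^sup>+x. (\<Prod>i\<in>I. ennpow (f i x) (1 / card I)) \<partial>M) = 0"
      by (subst nn_integral_0_iff_AE) auto
    then show ?thesis by simp
  next
    case top
    then have "(\<Prod>i\<in>I. ennpow (c i) (1 / card I)) = top"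
      using I by (subst ennreal_prod_eq_top) (auto simp: ennpow_eq_0_iff, auto simp: ennpow_def)
    then show ?thesis by (simp add: c_def)
  next
    case fin
    have "(\<Prod>i\<in>I. ennpow (f i x) (1 / card I))
        \<le> (\<Prod>i\<in>I. ennpow (c i) (1 / card I)) * ((\<Sum>i\<in>I. f i x / c i) / card I)" for x
    proof -
      have "f i x = c i * (f i x / c i)" if "i \<in> I" for i
        using fin that by (simp add: ennreal_times_divide ennreal_mult_divide_eq mult.commute[of "c i"])
      then have "(\<Prod>i\<in>I. ennpow (f i x) (1 / card I)) =
          (\<Prod>i\<in>I. ennpow (c i) (1 / card I)) * (\<Prod>i\<in>I. ennpow (f i x / c i) (1 / card I))"
        unfolding prod.distrib[symmetric] ennpow_mult[symmetric]
        by (intro prod.cong refl arg_cong2[where f=ennpow])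
      then show ?thesis
        using ennreal_arith_geom_mean[OF I, of "\<lambda>i. f i x / c i"] by (simp add: mult_left_mono)
    qed
    then have "(\<integral>\<^sup>+x. (\<Prod>i\<in>I. ennpow (f i x) (1 / card I)) \<partial>M)
        \<le> (\<integral>\<^sup>+x. (\<Prod>i\<in>I. ennpow (c i) (1 / card I)) * ((\<Sum>i\<in>I. f i x / c i) / card I) \<partial>M)"
      by (intro nn_integral_mono)
    also have "\<dots> = (\<Prod>i\<in>I. ennpow (c i) (1 / card I)) * ((\<Sum>i\<in>I. c i / c i) / card I)"
      by (simp add: nn_integral_cmult nn_integral_divide nn_integral_sum c_def)
    also have "(\<Sum>i\<in>I. c i / c i) = card I"
      using fin by (simp add: less_top)
    also have "\<dots> / card I = 1"
      using card by (intro ennreal_divide_self) (auto simp: of_nat_less_top)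
    finally show ?thesis by (simp add: c_def)
  qed
qed

text \<open>The coordinates in \<open>J\<close> are integrated out and the others are read off from
  \<open>x\<close>. The result remains a function on the whole space, constant in the directions of
  \<open>J\<close>, so marginals over different sets of coordinates can be multiplied
  directly.\<close>

definition marginal :: "'a::euclidean_space set \<Rightarrow> ('a \<Rightarrow> ennreal) \<Rightarrow> 'a \<Rightarrow> ennreal" where
  "marginal J f x =
    (\<integral>\<^sup>+y. f (\<Sum>b\<in>Basis. (if b \<in> J then y b else x \<bullet> b) *\<^sub>R b) \<partial>Pi\<^sub>M J (\<lambda>_. lborel))"

lemma product_sigma_finite_lborel: "product_sigma_finite (\<lambda>_::'b. lborel :: real measure)"
  by unfold_locales

lemma sigma_finite_PiM_lborel:
  "finite J \<Longrightarrow> sigma_finite_measure (Pi\<^sub>M J (\<lambda>_. lborel :: real measure))"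
  using product_sigma_finite.sigma_finite[OF product_sigma_finite_lborel] .

lemma measurable_replace_coords:
  fixes J :: "'a::euclidean_space set" assumes "J \<subseteq> Basis"
  shows "(\<lambda>(x, y). (\<Sum>b\<in>Basis. (if b \<in> J then y b else x \<bullet> b) *\<^sub>R b))
     \<in> borel \<Otimes>\<^sub>M Pi\<^sub>M J (\<lambda>_. lborel) \<rightarrow>\<^sub>M (borel :: 'a measure)"
proof -
  have "(\<lambda>p. if b \<in> J then snd p b else fst p \<bullet> b)
     \<in> (borel :: 'a measure) \<Otimes>\<^sub>M Pi\<^sub>M J (\<lambda>_. lborel :: real measure) \<rightarrow>\<^sub>M borel" for b
    by (cases "b \<in> J") (simp_all, measurable)
  then show ?thesis
    unfolding case_prod_beta by (intro borel_measurable_sum borel_measurable_scaleR) auto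
qed

lemma measurable_replace_coords_snd:
  fixes J :: "'a::euclidean_space set" assumes "J \<subseteq> Basis" "f \<in> borel_measurable borel"
  shows "(\<lambda>y. f (\<Sum>b\<in>Basis. (if b \<in> J then y b else x \<bullet> b) *\<^sub>R b))
     \<in> borel_measurable (Pi\<^sub>M J (\<lambda>_. lborel))"
  using measurable_compose[OF measurable_compose_Pair1[OF _ measurable_replace_coords[OF assms(1)]] assms(2), of x]
  by simp

lemma measurable_marginal:
  fixes J :: "'a::euclidean_space set"
  assumes J: "J \<subseteq> Basis" and f: "f \<in> borel_measurable borel"
  shows "marginal J f \<in> borel_measurable borel"
proof -
  interpret sigma_finite_measure "Pi\<^sub>M J (\<lambda>_. lborel :: real measure)"
    using J by (intro sigma_finite_PiM_lborel) (rule finite_subset[OF _ finite_Basis])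
  show ?thesis
    unfolding marginal_def
    using measurable_compose[OF measurable_replace_coords[OF J] f]
    by (intro borel_measurable_nn_integral) (simp add: case_prod_beta)
qed

lemma marginal_empty: "marginal {} f x = f x"
  using product_sigma_finite.nn_integral_empty[OF product_sigma_finite_lborel, of "\<lambda>_. f x"]
  by (simp add: marginal_def euclidean_representation)

text \<open>Tonelli's theorem, one coordinate at a time:
  \<open>x + (t - x \<bullet> m) *\<^sub>R m\<close> is \<open>x\<close> with its
  \<open>m\<close>-th coordinate replaced by \<open>t\<close>.\<close>

lemma marginal_insert:
  fixes J :: "'a::euclidean_space set"
  assumes J: "J \<subseteq> Basis" and m: "m \<in> Basis" "m \<notin> J" and f: "f \<in> borel_measurable borel"
  shows "marginal (insert m J) f x = (\<integral>\<^sup>+t. marginal J f (x + (t - x \<bullet> m) *\<^sub>R m) \<partial>lborel)"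
proof -
  have "finite J" using J finite_Basis finite_subset by blast
  then have "marginal (insert m J) f x = (\<integral>\<^sup>+t. (\<integral>\<^sup>+y.
      f (\<Sum>b\<in>Basis. (if b \<in> insert m J then (y(m := t)) b else x \<bullet> b) *\<^sub>R b) \<partial>Pi\<^sub>M J (\<lambda>_. lborel)) \<partial>lborel)"
    unfolding marginal_def using J m f
    by (intro product_sigma_finite.product_nn_integral_insert_rev[OF product_sigma_finite_lborel]
        measurable_replace_coords_snd) auto
  moreover have "(\<Sum>b\<in>Basis. (if b \<in> insert m J then (y(m := t)) b else x \<bullet> b) *\<^sub>R b) =
     (\<Sum>b\<in>Basis. (if b \<in> J then y b else (x + (t - x \<bullet> m) *\<^sub>R m) \<bullet> b) *\<^sub>R b)" for y t
    using m by (intro sum.cong) (auto simp: inner_add_left inner_Basis)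
  ultimately show ?thesis by (simp only: marginal_def)
qed

lemma marginal_indep:
  fixes J :: "'a::euclidean_space set"
  assumes "m \<in> Basis" "m \<in> J"
  shows "marginal J f (x + s *\<^sub>R m) = marginal J f x"
proof -
  have "(\<Sum>b\<in>Basis. (if b \<in> J then y b else (x + s *\<^sub>R m) \<bullet> b) *\<^sub>R b) =
      (\<Sum>b\<in>Basis. (if b \<in> J then y b else x \<bullet> b) *\<^sub>R b)" for y
    using assms by (intro sum.cong) (auto simp: inner_simps inner_Basis)
  then show ?thesis by (simp add: marginal_def)
qed

lemma marginal_Basis:
  fixes f :: "'a::euclidean_space \<Rightarrow> ennreal"
  assumes f: "f \<in> borel_measurable borel"
  shows "marginal Basis f x = (\<integral>\<^sup>+x. f x \<partial>lborel)"
proof -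
  have "(\<integral>\<^sup>+x. f x \<partial>lborel) =
      (\<integral>\<^sup>+y. f (\<Sum>b\<in>Basis. y b *\<^sub>R b) \<partial>Pi\<^sub>M (Basis :: 'a set) (\<lambda>_. lborel))"
    by (subst lborel_eq, subst nn_integral_distr) (use f in measurable)
  also have "\<dots> = marginal Basis f x"
    unfolding marginal_def by (intro nn_integral_cong arg_cong[where f=f] sum.cong) auto
  finally show ?thesis by simp
qed

text \<open>The coordinates are integrated out one at a time.  When \<open>m\<close> is integrated, the factor belonging to
  \<open>m\<close> is constant along the line and the remaining \<open>N-1\<close> factors are treated by Hoelder's inequality.\<close>

lemma Loomis_Whitney_marginal:
  fixes F :: "'a::euclidean_space \<Rightarrow> 'a \<Rightarrow> ennreal"
  assumes F [measurable]: "\<And>b. b \<in> Basis \<Longrightarrow> F b \<in> borel_measurable borel"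
    and dim: "DIM('a) \<ge> 2" and J: "J \<subseteq> Basis"
  defines "t \<equiv> 1 / real (DIM('a) - 1)"
  shows "marginal J (\<lambda>x. \<Prod>b\<in>Basis. ennpow (marginal {b} (F b) x) t) x
    \<le> (\<Prod>b\<in>Basis. ennpow (marginal (insert b J) (F b) x) t)"
proof -
  have "finite J" using J finite_Basis finite_subset by blast
  then show ?thesis using J
  proof (induction J arbitrary: x rule: finite_induct)
    case empty
    then show ?case by (simp add: marginal_empty)
  next
    case (insert m J)
    then have m: "m \<in> Basis" "J \<subseteq> Basis" by auto
    let ?G = "\<lambda>x. \<Prod>b\<in>Basis. ennpow (marginal {b} (F b) x) t"
    let ?I = "Basis - {m}"
    let ?p = "\<lambda>s. x + (s - x \<bullet> m) *\<^sub>R m"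
    have cardI: "card ?I = DIM('a) - 1" "?I \<noteq> {}"
      using m dim card_mono[of "{m}" "Basis :: 'a set"] by (auto simp: card_Diff_singleton)
    have G: "?G \<in> borel_measurable borel"
      by (intro borel_measurable_prod_ennreal measurable_ennpow measurable_marginal F) auto
    have mJ: "marginal (insert b J) (F b) \<in> borel_measurable borel" if "b \<in> Basis" for b
      using that m F by (intro measurable_marginal) auto
    have [measurable]: "(\<lambda>s. marginal (insert b J) (F b) (?p s)) \<in> borel_measurable lborel" if "b \<in> Basis" for b
      by (rule measurable_compose[OF _ mJ[OF that]]) simp
    have "marginal (insert m J) ?G x = (\<integral>\<^sup>+s. marginal J ?G (?p s) \<partial>lborel)"
      using m insert.hyps G by (intro marginal_insert) auto
    also have "\<dots> \<le> (\<integral>\<^sup>+s. (\<Prod>b\<in>Basis. ennpow (marginal (insert b J) (F b) (?p s)) t) \<partial>lborel)"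
      using insert.IH m by (intro nn_integral_mono) auto
    also have "\<dots> = (\<integral>\<^sup>+s. ennpow (marginal (insert m J) (F m) x) t *
         (\<Prod>b\<in>?I. ennpow (marginal (insert b J) (F b) (?p s)) t) \<partial>lborel)"
      using m by (intro nn_integral_cong) (simp add: prod.remove[of _ m] marginal_indep)
    also have "\<dots> = ennpow (marginal (insert m J) (F m) x) t *
         (\<integral>\<^sup>+s. (\<Prod>b\<in>?I. ennpow (marginal (insert b J) (F b) (?p s)) t) \<partial>lborel)"
      by (intro nn_integral_cmult) measurable
    also have "\<dots> \<le> ennpow (marginal (insert m J) (F m) x) t *
         (\<Prod>b\<in>?I. ennpow (\<integral>\<^sup>+s. marginal (insert b J) (F b) (?p s) \<partial>lborel) t)"
      using Holder_prod_nn_integral[of ?I "\<lambda>b s. marginal (insert b J) (F b) (?p s)" lborel] cardI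
      by (intro mult_left_mono) (auto simp: t_def)
    also have "\<dots> = ennpow (marginal (insert m J) (F m) x) t *
         (\<Prod>b\<in>?I. ennpow (marginal (insert b (insert m J)) (F b) x) t)"
    proof -
      have "(\<integral>\<^sup>+s. marginal (insert b J) (F b) (?p s) \<partial>lborel) = marginal (insert b (insert m J)) (F b) x"
        if "b \<in> ?I" for b
        using that m insert.hyps
        by (subst insert_commute, subst marginal_insert) auto
      then show ?thesis
        by (intro arg_cong2[where f="(*)"] refl prod.cong arg_cong2[where f=ennpow])
    qed
    also have "\<dots> = (\<Prod>b\<in>Basis. ennpow (marginal (insert b (insert m J)) (F b) x) t)"
      using m by (simp add: prod.remove[of _ m])
    finally show ?case .
  qed
qed

lemma Loomis_Whitney:
  fixes F :: "'a::euclidean_space \<Rightarrow> 'a \<Rightarrow> ennreal"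
  assumes F [measurable]: "\<And>b. b \<in> Basis \<Longrightarrow> F b \<in> borel_measurable borel"
    and dim: "DIM('a) \<ge> 2"
  defines "t \<equiv> 1 / real (DIM('a) - 1)"
  shows "(\<integral>\<^sup>+x. (\<Prod>b\<in>Basis. ennpow (marginal {b} (F b) x) t) \<partial>lborel)
    \<le> (\<Prod>b\<in>Basis. ennpow (\<integral>\<^sup>+x. F b x \<partial>lborel) t)"
proof -
  have "(\<lambda>x. \<Prod>b\<in>Basis. ennpow (marginal {b} (F b) x) t) \<in> borel_measurable borel"
    by (intro borel_measurable_prod_ennreal measurable_ennpow measurable_marginal F) auto
  then show ?thesis
    using Loomis_Whitney_marginal[of F Basis 0] F dim
    by (simp add: marginal_Basis insert_absorb t_def cong: prod.cong)
qed

section \<open>From line integrals of the gradient to the Sobolev inequality\<close>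

lemma nn_integral_compact_support_finite:
  fixes g :: "'a::euclidean_space \<Rightarrow> real"
  assumes g: "continuous_on UNIV g" and R: "\<And>x. norm x > R \<Longrightarrow> g x = 0"
  shows "(\<integral>\<^sup>+x. ennreal (g x) \<partial>lborel) < \<infinity>"
proof -
  have "compact (g ` cball 0 R)"
    by (intro compact_continuous_image continuous_on_subset[OF g]) auto
  then obtain M where M: "\<And>x. x \<in> cball 0 R \<Longrightarrow> \<bar>g x\<bar> \<le> M"
    by (fastforce dest!: compact_imp_bounded simp: bounded_iff)
  have "(\<integral>\<^sup>+x. ennreal (g x) \<partial>lborel) \<le> (\<integral>\<^sup>+x. ennreal M * indicator (cball 0 R) x \<partial>(lborel :: 'a measure))"
  proof (intro nn_integral_mono)
    fix x :: 'a
    show "ennreal (g x) \<le> ennreal M * indicator (cball 0 R) x"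
      using M[of x] R[of x] by (cases "norm x \<le> R") (auto simp: dist_norm intro!: ennreal_leI)
  qed
  also have "\<dots> < \<infinity>"
    using emeasure_lborel_cball_finite[of "0::'a" R]
    by (subst nn_integral_cmult_indicator) (auto simp: ennreal_mult_less_top)
  finally show ?thesis .
qed

lemma has_derivative_zero_outside:
  fixes h :: "'a::euclidean_space \<Rightarrow> real"
  assumes h: "(h has_derivative (\<lambda>v. D \<bullet> v)) (at x)"
    and R: "\<And>x. norm x > R \<Longrightarrow> h x = 0" and x: "norm x > R"
  shows "D = 0"
proof -
  have "open {x :: 'a. norm x > R}"
    by (intro open_Collect_less continuous_intros)
  then have "((\<lambda>_. 0) has_derivative (\<lambda>v. D \<bullet> v)) (at x)"
    by (rule has_derivative_transform_within_open[OF h]) (use R x in auto)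
  then have "(\<lambda>v. D \<bullet> v) = (\<lambda>_. 0)"
    by (rule has_derivative_unique) simp
  then have "D \<bullet> D = 0" by metis
  then show ?thesis by simp
qed

text \<open>Fundamental theorem of calculus along the line through \<open>x\<close> in direction
  \<open>b\<close>, started at a point where \<open>h\<close> vanishes.\<close>

lemma abs_le_marginal:
  fixes h :: "'a::euclidean_space \<Rightarrow> real"
  assumes h: "\<And>x. (h has_derivative (\<lambda>v. Dh x \<bullet> v)) (at x)"
    and Dh: "continuous_on UNIV Dh"
    and R: "\<And>x. norm x > R \<Longrightarrow> h x = 0" and b: "b \<in> Basis"
  shows "ennreal \<bar>h x\<bar> \<le> marginal {b} (\<lambda>x. ennreal \<bar>Dh x \<bullet> b\<bar>) x"
proof -
  let ?c = "\<lambda>t. x + (t - x \<bullet> b) *\<^sub>R b"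
  let ?g = "\<lambda>t. Dh (?c t) \<bullet> b"
  have cont: "continuous_on UNIV ?g"
    by (intro continuous_intros continuous_on_compose2[OF Dh]) auto
  have der: "((\<lambda>t. h (?c t)) has_real_derivative ?g t) (at t)" for t
    unfolding has_field_derivative_def
    by (rule has_derivative_compose[OF _ h, THEN has_derivative_eq_rhs])
      (auto intro!: derivative_eq_intros simp: fun_eq_iff)
  \<comment> \<open>The second entry puts the starting point outside the support, as a coordinate is
    at most the norm in absolute value; the minimum keeps it to the left of
    \<open>x\<close>.\<close>
  define a where "a = min (x \<bullet> b) (- \<bar>R\<bar> - 1)"
  have "?c a \<bullet> b = a" using b by (simp add: inner_add_left inner_Basis)
  then have "\<bar>a\<bar> \<le> norm (?c a)" using Basis_le_norm[OF b, of "?c a"] by simp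
  then have ha: "h (?c a) = 0" by (intro R) (auto simp: a_def)
  have "(LBINT t. indicator {a..x \<bullet> b} t *\<^sub>R ?g t) = h (?c (x \<bullet> b)) - h (?c a)"
    by (intro integral_FTC_atLeastAtMost)
      (auto simp: a_def intro!: has_real_derivative_iff_has_vector_derivative[THEN iffD1]
        has_field_derivative_at_within[OF der] continuous_on_subset[OF cont])
  then have hx: "h x = (LBINT t. indicator {a..x \<bullet> b} t *\<^sub>R ?g t)" using ha by simp
  have "set_integrable lborel {a..x \<bullet> b} ?g"
    by (intro borel_integrable_atLeastAtMost' continuous_on_subset[OF cont]) auto
  then have "norm (h x) \<le> (\<integral>\<^sup>+t. norm (indicator {a..x \<bullet> b} t *\<^sub>R ?g t) \<partial>lborel)"
    unfolding hx set_integrable_def by (rule integral_norm_bound_ennreal)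
  also have "\<dots> \<le> (\<integral>\<^sup>+t. ennreal \<bar>?g t\<bar> \<partial>lborel)"
    by (intro nn_integral_mono ennreal_leI) (auto simp: indicator_def)
  also have "\<dots> = marginal {b} (\<lambda>x. ennreal \<bar>Dh x \<bullet> b\<bar>) x"
    using b borel_measurable_continuous_onI[OF Dh]
    by (subst marginal_insert) (auto simp: marginal_empty)
  finally show ?thesis by simp
qed

text \<open>\<open>|h|\<close> is bounded by one line integral for each of the \<open>N\<close>
  directions. The product of the \<open>N\<close> bounds, each to the power \<open>1/(N-1)\<close>,
  dominates \<open>|h|\<close> to the power \<open>N/(N-1)\<close> and has the shape of the
  left-hand side of \<open>Loomis_Whitney\<close>.\<close>

lemma Gagliardo_Nirenberg_1:
  fixes h :: "'a::euclidean_space \<Rightarrow> real"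
  assumes h: "\<And>x. (h has_derivative (\<lambda>v. Dh x \<bullet> v)) (at x)"
    and Dh: "continuous_on UNIV Dh"
    and R: "\<And>x. norm x > R \<Longrightarrow> h x = 0" and dim: "DIM('a) \<ge> 2"
  defines "t \<equiv> real DIM('a) / (real DIM('a) - 1)"
  shows "(\<integral>\<^sup>+x. ennreal (\<bar>h x\<bar> powr t) \<partial>lborel) \<le> ennpow (\<integral>\<^sup>+x. ennreal (norm (Dh x)) \<partial>lborel) t"
proof -
  let ?n = "DIM('a)"
  define s where "s = 1 / real (?n - 1)"
  have s: "s \<ge> 0" "t = s * ?n" using dim by (auto simp: s_def t_def of_nat_diff)
  have [measurable]: "Dh \<in> borel_measurable borel"
    by (rule borel_measurable_continuous_onI[OF Dh])
  have pow: "ennpow a t = (\<Prod>b\<in>(Basis :: 'a set). ennpow a s)" for a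
  proof (cases "a = top")
    case True
    then show ?thesis by (simp add: ennpow_def)
  next
    case False
    have "c powr t = (c powr s) ^ ?n" if "c \<ge> 0" for c
      using that dim by (cases "c = 0") (simp_all add: s(2) powr_powr[symmetric] powr_realpow)
    then show ?thesis
      using False by (simp add: ennpow_def ennreal_power)
  qed
  have "(\<integral>\<^sup>+x. ennreal (\<bar>h x\<bar> powr t) \<partial>lborel) = (\<integral>\<^sup>+x. (\<Prod>b\<in>(Basis :: 'a set). ennpow (ennreal \<bar>h x\<bar>) s) \<partial>lborel)"
    by (subst pow[symmetric]) (simp add: ennpow_ennreal)
  also have "\<dots> \<le> (\<integral>\<^sup>+x. (\<Prod>b\<in>Basis. ennpow (marginal {b} (\<lambda>x. ennreal \<bar>Dh x \<bullet> b\<bar>) x) s) \<partial>lborel)"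
    by (intro nn_integral_mono prod_mono_ennreal ennpow_mono abs_le_marginal[OF h Dh R] s) auto
  also have "\<dots> \<le> (\<Prod>b\<in>Basis. ennpow (\<integral>\<^sup>+x. ennreal \<bar>Dh x \<bullet> b\<bar> \<partial>lborel) s)"
    unfolding s_def using dim by (intro Loomis_Whitney) auto
  also have "\<dots> \<le> (\<Prod>b\<in>(Basis :: 'a set). ennpow (\<integral>\<^sup>+x. ennreal (norm (Dh x)) \<partial>lborel) s)"
    by (intro prod_mono_ennreal ennpow_mono nn_integral_mono ennreal_leI s) (auto simp: Basis_le_norm)
  finally show ?thesis by (simp only: pow)
qed

text \<open>Since \<open>q > 1\<close>, a power \<open>|h|^q\<close> is differentiable also at the
  zeros of \<open>h\<close>; the Sobolev inequality can therefore be derived from the case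
  \<open>p = 1\<close> without regularising \<open>|h|\<close>.\<close>

lemma has_real_derivative_abs_powr:
  fixes x q :: real assumes q: "q > 1"
  shows "((\<lambda>x. \<bar>x\<bar> powr q) has_real_derivative q * \<bar>x\<bar> powr (q - 1) * sgn x) (at x)"
proof -
  consider "x > 0" | "x < 0" | "x = 0" by linarith
  then show ?thesis
  proof cases
    case 1
    have "((\<lambda>x. x powr q) has_real_derivative q * \<bar>x\<bar> powr (q - 1) * sgn x) (at x)"
      using 1 by (auto intro!: derivative_eq_intros)
    then show ?thesis
      by (rule has_field_derivative_transform_within_open[where S="{0<..}"]) (use 1 in auto)
  next
    case 2
    have "((\<lambda>x. (- x) powr q) has_real_derivative q * \<bar>x\<bar> powr (q - 1) * sgn x) (at x)"
      using 2 by (auto intro!: derivative_eq_intros)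
    then show ?thesis
      by (rule has_field_derivative_transform_within_open[where S="{..<0}"]) (use 2 in auto)
  next
    case 3
    have "((\<lambda>h. \<bar>h\<bar> powr (q - 1)) \<longlongrightarrow> 0) (at (0::real))"
    proof -
      have "((\<lambda>h::real. \<bar>h\<bar> powr (q - 1)) \<longlongrightarrow> \<bar>0\<bar> powr (q - 1)) (at 0)"
        using q by (intro tendsto_intros) auto
      then show ?thesis by simp
    qed
    then have "((\<lambda>h. \<bar>\<bar>h\<bar> powr q / h\<bar>) \<longlongrightarrow> 0) (at (0::real))"
      by (rule Lim_transform_eventually) (auto simp: eventually_at_filter powr_diff abs_mult)
    then have "((\<lambda>h. \<bar>h\<bar> powr q / h) \<longlongrightarrow> 0) (at (0::real))"
      by (rule tendsto_rabs_zero_cancel)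
    then show ?thesis using 3 by (simp add: DERIV_def)
  qed
qed

lemma continuous_on_abs_powr_sgn:
  fixes r :: real assumes r: "r > 0"
  shows "continuous_on UNIV (\<lambda>x::real. \<bar>x\<bar> powr r * sgn x)"
proof -
  have "isCont (\<lambda>x::real. \<bar>x\<bar> powr r * sgn x) x" for x
  proof (cases "x = 0")
    case True
    have "((\<lambda>h::real. \<bar>h\<bar> powr r) \<longlongrightarrow> \<bar>0\<bar> powr r) (at 0)"
      using r by (intro tendsto_intros) auto
    then have "((\<lambda>h::real. \<bar>h\<bar> powr r) \<longlongrightarrow> 0) (at 0)" by simp
    then have "((\<lambda>h::real. \<bar>\<bar>h\<bar> powr r * sgn h\<bar>) \<longlongrightarrow> 0) (at 0)"
      by (rule Lim_transform_eventually) (simp add: eventually_at_filter abs_mult abs_sgn_eq)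
    then show ?thesis using True by (simp add: isCont_def tendsto_rabs_zero_iff)
  next
    case False
    then have "isCont sgn x"
      unfolding isCont_def by (intro tendsto_sgn tendsto_ident_at)
    then show ?thesis using False r by (intro continuous_intros) auto
  qed
  then show ?thesis by (simp add: continuous_at_imp_continuous_on)
qed

lemma Cauchy_Schwarz_nn_integral:
  assumes [measurable]: "f \<in> borel_measurable M" "g \<in> borel_measurable M"
  shows "(\<integral>\<^sup>+x. ennpow (f x) (1/2) * ennpow (g x) (1/2) \<partial>M) \<le>
    ennpow (\<integral>\<^sup>+x. f x \<partial>M) (1/2) * ennpow (\<integral>\<^sup>+x. g x \<partial>M) (1/2)"
proof -
  have [measurable]: "(if b then f else g) \<in> borel_measurable M" for b
    by (cases b) auto
  show ?thesis
    using Holder_prod_nn_integral[of UNIV "\<lambda>b. if b then f else g" M]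
    by (simp add: UNIV_bool mult.commute)
qed

lemma Sobolev_inequality:
  fixes h :: "'a::euclidean_space \<Rightarrow> real"
  assumes h: "\<And>x. (h has_derivative (\<lambda>v. Dh x \<bullet> v)) (at x)"
    and Dh: "continuous_on UNIV Dh"
    and R: "\<And>x. norm x > R \<Longrightarrow> h x = 0" and dim: "DIM('a) \<ge> 3"
    and e: "(\<integral>\<^sup>+x. ennreal ((norm (Dh x))\<^sup>2) \<partial>lborel) \<le> ennreal e" "e \<ge> 0"
  defines "p \<equiv> 2 * real DIM('a) / (real DIM('a) - 2)"
    and "q \<equiv> 2 * (real DIM('a) - 1) / (real DIM('a) - 2)"
  shows "(\<integral>\<^sup>+x. ennreal (\<bar>h x\<bar> powr p) \<partial>lborel) \<le> ennreal ((q\<^sup>2 * e) powr (p / 2))"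
proof -
  define n where "n = real DIM('a)"
  have n: "n \<ge> 3" using dim by (simp add: n_def)
  have q: "q > 1" using n by (simp add: q_def n_def field_simps)
  have p: "p > 0" "2 * (q - 1) = p" "q * (n / (n - 1)) = p" "(q - 1) = p / 2"
    using n by (simp_all add: p_def q_def divide_simps flip: n_def)
  have h_cont: "continuous_on UNIV h"
    using h by (meson has_derivative_continuous_on has_derivative_at_withinI)
  have [measurable]: "h \<in> borel_measurable borel" "Dh \<in> borel_measurable borel"
    using h_cont Dh by (auto intro: borel_measurable_continuous_onI)
  have "(\<integral>\<^sup>+x. ennreal (\<bar>h x\<bar> powr p) \<partial>lborel) < \<infinity>"
    by (rule nn_integral_compact_support_finite[where R=R])
      (use p R in \<open>auto intro!: continuous_intros h_cont continuous_on_powr'\<close>)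
  \<comment> \<open>Finiteness matters: the estimate below has a power of \<open>s\<close> on both
    sides, and the one on the right is divided out.\<close>
  then obtain s where s: "(\<integral>\<^sup>+x. ennreal (\<bar>h x\<bar> powr p) \<partial>lborel) = ennreal s" "s \<ge> 0"
    by (cases "\<integral>\<^sup>+x. ennreal (\<bar>h x\<bar> powr p) \<partial>lborel") auto
  \<comment> \<open>The case \<open>p = 1\<close> is applied to \<open>|h|\<^sup>q\<close>; as \<open>2(q-1) = p\<close>, Cauchy--Schwarz closes the estimate.\<close>
  define Dg where "Dg x = (q * (\<bar>h x\<bar> powr (q - 1) * sgn (h x))) *\<^sub>R Dh x" for x
  have "((\<lambda>x. \<bar>h x\<bar> powr q) has_derivative (\<lambda>v. Dg x \<bullet> v)) (at x)" for x
    by (rule has_derivative_compose[OF h has_real_derivative_abs_powr[OF q, unfolded has_field_derivative_def],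
          THEN has_derivative_eq_rhs]) (simp add: Dg_def mult_ac)
  moreover have "continuous_on UNIV Dg"
    unfolding Dg_def using q
    by (intro continuous_intros Dh continuous_on_compose2[OF continuous_on_abs_powr_sgn h_cont]) auto
  moreover have "\<bar>h x\<bar> powr q = 0" if "norm x > R" for x using R[OF that] by simp
  ultimately have "(\<integral>\<^sup>+x. ennreal (\<bar>\<bar>h x\<bar> powr q\<bar> powr (n / (n - 1))) \<partial>lborel)
      \<le> ennpow (\<integral>\<^sup>+x. ennreal (norm (Dg x)) \<partial>lborel) (n / (n - 1))"
    unfolding n_def using dim by (intro Gagliardo_Nirenberg_1) auto
  then have "ennreal s \<le> ennpow (\<integral>\<^sup>+x. ennreal (norm (Dg x)) \<partial>lborel) (n / (n - 1))"
    by (simp only: powr_powr p s abs_of_nonneg[OF powr_ge_zero])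
  also have "\<dots> \<le> ennpow (ennreal (q * (s powr (1/2) * e powr (1/2)))) (n / (n - 1))"
  proof (intro ennpow_mono)
    have "(\<integral>\<^sup>+x. ennreal (norm (Dg x)) \<partial>lborel)
       \<le> (\<integral>\<^sup>+x. ennreal q * (ennpow (ennreal (\<bar>h x\<bar> powr p)) (1/2) * ennpow (ennreal ((norm (Dh x))\<^sup>2)) (1/2)) \<partial>lborel)"
      using q by (intro nn_integral_mono)
        (auto simp: Dg_def ennpow_ennreal powr_powr p abs_mult abs_sgn_eq powr_half_sqrt mult_ac
          intro!: ennreal_leI simp flip: ennreal_mult)
    also have "\<dots> = ennreal q * (\<integral>\<^sup>+x. ennpow (ennreal (\<bar>h x\<bar> powr p)) (1/2) * ennpow (ennreal ((norm (Dh x))\<^sup>2)) (1/2) \<partial>lborel)"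
      by (intro nn_integral_cmult) measurable
    also have "\<dots> \<le> ennreal q * (ennpow (\<integral>\<^sup>+x. ennreal (\<bar>h x\<bar> powr p) \<partial>lborel) (1/2) *
        ennpow (\<integral>\<^sup>+x. ennreal ((norm (Dh x))\<^sup>2) \<partial>lborel) (1/2))"
      by (intro mult_left_mono Cauchy_Schwarz_nn_integral) auto
    also have "\<dots> \<le> ennreal q * (ennpow (ennreal s) (1/2) * ennpow (ennreal e) (1/2))"
      by (intro mult_left_mono mult_mono ennpow_mono e) (auto simp: s)
    also have "\<dots> = ennreal (q * (s powr (1/2) * e powr (1/2)))"
      using q s e by (simp add: ennpow_ennreal ennreal_mult)
    finally show "(\<integral>\<^sup>+x. ennreal (norm (Dg x)) \<partial>lborel) \<le> ennreal (q * (s powr (1/2) * e powr (1/2)))" .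
  qed (use n in auto)
  finally have 1: "s \<le> (q * (s powr (1/2) * e powr (1/2))) powr (n / (n - 1))"
    using q by (simp add: ennpow_ennreal)
  have "s \<le> (q\<^sup>2 * e) powr (p / 2)"
  proof (cases "s = 0")
    case False
    then have s0: "s > 0" using s by simp
    with 1 have "s powr ((n - 1) / n) \<le> ((q * (s powr (1/2) * e powr (1/2))) powr (n / (n - 1))) powr ((n - 1) / n)"
      using n by (intro powr_mono2) auto
    also have "\<dots> = q * (s powr (1/2) * e powr (1/2))"
      using n q by (simp add: powr_powr)
    \<comment> \<open>The exponent that survives is
      \<open>(N-1)/N - 1/2 = (N-2)/(2N) = 1/p\<close>.\<close>
    finally have "s powr ((n - 1) / n) / s powr (1/2) \<le> q * e powr (1/2)"
      using s0 by (simp add: field_simps)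
    also have "s powr ((n - 1) / n) / s powr (1/2) = s powr (1 / p)"
      using n by (simp add: p_def flip: powr_diff n_def) (simp add: field_simps)
    finally have "(s powr (1 / p)) powr p \<le> (q * e powr (1/2)) powr p"
      using p by (intro powr_mono2) auto
    then have "s \<le> (q * e powr (1/2)) powr p"
      using p s0 by (simp add: powr_powr)
    also have "q * e powr (1/2) = (q\<^sup>2 * e) powr (1/2)"
      using q e by (simp add: powr_mult powr_half_sqrt)
    finally show ?thesis by (simp add: powr_powr)
  qed simp
  then show ?thesis by (simp add: s ennreal_leI)
qed

subsection \<open>Polar coordinates\<close>

lemma sets_sphere_measure [measurable_cong, simp]: "sets sphere_measure = sets borel"
  by (simp add: sphere_measure_def sets_scale_measure)

lemma nn_integral_sphere_measure:
  fixes g :: "real^'n \<Rightarrow> ennreal"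
  assumes [measurable]: "g \<in> borel_measurable borel"
  shows "(\<integral>\<^sup>+x. g x \<partial>sphere_measure) =
    of_nat CARD('n) * (\<integral>\<^sup>+x\<in>ball 0 1. g (sgn x) \<partial>lborel)"
proof -
  have "(sgn :: real^'n \<Rightarrow> _) \<in> restrict_space lborel (ball 0 1) \<rightarrow>\<^sub>M borel"
    by (intro measurable_restrict_space1) simp
  then show ?thesis
    unfolding sphere_measure_def
    by (subst nn_integral_scale_measure)
      (simp_all add: nn_integral_distr nn_integral_restrict_space)
qed

lemma nn_integral_lborel_scale:
  fixes g :: "'a::euclidean_space \<Rightarrow> ennreal"
  assumes [measurable]: "g \<in> borel_measurable borel" and c: "c > 0"
  shows "(\<integral>\<^sup>+x. g x \<partial>lborel) = ennreal (c ^ DIM('a)) * (\<integral>\<^sup>+x. g (c *\<^sub>R x) \<partial>lborel)"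
proof -
  let ?M = "density (distr lborel borel (\<lambda>x::'a. 0 + c *\<^sub>R x)) (\<lambda>_. ennreal (\<bar>c\<bar> ^ DIM('a)))"
  have "lborel = ?M"
    using c by (intro lborel_affine) auto
  then have "(\<integral>\<^sup>+x. g x \<partial>lborel) = (\<integral>\<^sup>+x. g x \<partial>?M)" by (rule arg_cong)
  also have "\<dots> = (\<integral>\<^sup>+x. ennreal (\<bar>c\<bar> ^ DIM('a)) * g (c *\<^sub>R x) \<partial>lborel)"
    by (simp add: nn_integral_density nn_integral_distr)
  also have "\<dots> = ennreal (c ^ DIM('a)) * (\<integral>\<^sup>+x. g (c *\<^sub>R x) \<partial>lborel)"
    using c by (simp add: nn_integral_cmult)
  finally show ?thesis .
qed

text \<open>The normalisation that makes the passage to polar coordinates exact; it is used with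
  \<open>a = norm y\<close>.\<close>

lemma nn_integral_inverse_power:
  fixes a :: real assumes a: "a > 0" and n: "n > 0"
  shows "(\<integral>\<^sup>+s\<in>{a<..}. ennreal (n * a ^ n / s ^ (n + 1)) \<partial>lborel) = 1"
proof -
  have "(\<integral>\<^sup>+s\<in>{a<..}. ennreal (n * a ^ n / s ^ (n + 1)) \<partial>lborel) =
      (\<integral>\<^sup>+s\<in>{a..}. ennreal (n * a ^ n / s ^ (n + 1)) \<partial>lborel)"
    by (rule nn_integral_cong_AE, rule AE_mp[OF AE_lborel_singleton[of a]], rule AE_I2)
      (auto simp: indicator_def)
  also have "\<dots> = ennreal (0 - (- (a ^ n / a ^ n)))"
  proof (rule nn_integral_FTC_atLeast[where F="\<lambda>s. - (a ^ n / s ^ n)"])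
    show "((\<lambda>s. - (a ^ n / s ^ n)) \<longlongrightarrow> 0) at_top"
    proof -
      have "filterlim (\<lambda>s::real. s ^ n) at_top at_top"
        using n by (intro filterlim_pow_at_top filterlim_ident)
      then have "((\<lambda>s::real. a ^ n / s ^ n) \<longlongrightarrow> 0) at_top"
        by (rule real_tendsto_divide_at_top[OF tendsto_const])
      then show ?thesis using tendsto_minus by fastforce
    qed
    show "((\<lambda>s. - (a ^ n / s ^ n)) has_real_derivative n * a ^ n / s ^ (n + 1)) (at s)" if "a \<le> s" for s
    proof -
      obtain m where m: "n = Suc m" using n by (cases n) auto
      show ?thesis unfolding m using that a
        by (auto intro!: derivative_eq_intros simp: divide_simps) (auto simp: algebra_simps power_eq_if)
    qed
  qed (use a in auto)
  also have "\<dots> = 1" using a by simp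
  finally show ?thesis .
qed

text \<open>Inserting the cone measure, the right-hand side is an integral over \<open>(r, x)\<close> with \<open>x\<close> in the ball;
  the substitutions \<open>r = s|x|\<close> and then \<open>y = s x\<close> make the integral over \<open>s\<close> explicit.\<close>

lemma nn_integral_polar:
  fixes g :: "real^'n \<Rightarrow> ennreal"
  assumes g [measurable]: "g \<in> borel_measurable borel"
  shows "(\<integral>\<^sup>+x. g x \<partial>lborel) = (\<integral>\<^sup>+w. (\<integral>\<^sup>+r\<in>{0<..}. g (r *\<^sub>R w) * ennreal (r ^ (CARD('n) - 1)) \<partial>lborel) \<partial>sphere_measure)"
proof -
  let ?N = "CARD('n)"
  let ?rad = "\<lambda>x. (\<integral>\<^sup>+r\<in>{0<..}. g (r *\<^sub>R sgn x) * ennreal (r ^ (?N - 1)) \<partial>lborel)"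
  \<comment> \<open>The kernel left after the substitution \<open>y = s x\<close>. For fixed
    \<open>y \<noteq> 0\<close> it is a probability density in \<open>s\<close>, so integrating over
    \<open>s\<close> gives back \<open>g y\<close>.\<close>
  let ?k = "\<lambda>(s::real) (y :: real^'n). if norm y < s then ennreal (?N * norm y ^ ?N / s ^ (?N + 1)) else 0"
  have [measurable]: "Measurable.pred borel (\<lambda>x::real^'n. x \<in> ball 0 1)"
    by (simp add: pred_def)
  have rad: "?rad x = (\<integral>\<^sup>+s\<in>{0<..}. g (s *\<^sub>R x) * ennreal (norm x ^ ?N * s ^ (?N - 1)) \<partial>lborel)"
    if "x \<noteq> 0" for x
  proof -
    have n: "norm x > 0" using that by simp
    have "norm x *\<^sub>R sgn x = x" using that by (simp add: sgn_div_norm)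
    then have "?rad x = ennreal (norm x) * (\<integral>\<^sup>+s. g (s *\<^sub>R x) * ennreal ((norm x * s) ^ (?N - 1)) * indicator {0<..} (norm x * s) \<partial>lborel)"
      using n by (subst nn_integral_real_affine[where c="norm x" and t=0]) (auto simp: mult.commute[of "norm x"] simp flip: scaleR_scaleR)
    also have "\<dots> = (\<integral>\<^sup>+s. ennreal (norm x) * (g (s *\<^sub>R x) * ennreal ((norm x * s) ^ (?N - 1)) * indicator {0<..} (norm x * s)) \<partial>lborel)"
      by (rule nn_integral_cmult[symmetric]) measurable
    also have "\<dots> = (\<integral>\<^sup>+s\<in>{0<..}. g (s *\<^sub>R x) * ennreal (norm x ^ ?N * s ^ (?N - 1)) \<partial>lborel)"
    proof (intro nn_integral_cong)
      fix s :: real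
      have "norm x ^ ?N = norm x * norm x ^ (?N - 1)"
        by (metis power_eq_if zero_less_card_finite less_irrefl)
      then have "ennreal (norm x ^ ?N * s ^ (?N - 1)) = ennreal (norm x) * ennreal ((norm x * s) ^ (?N - 1))" if "s > 0"
        using that by (simp add: power_mult_distrib mult_ac flip: ennreal_mult)
      then show "ennreal (norm x) * (g (s *\<^sub>R x) * ennreal ((norm x * s) ^ (?N - 1)) * indicator {0<..} (norm x * s)) =
          g (s *\<^sub>R x) * ennreal (norm x ^ ?N * s ^ (?N - 1)) * indicator {0<..} s"
        using n by (cases "s > 0") (auto simp: mult_ac zero_less_mult_iff)
    qed
    finally show ?thesis .
  qed
  have sc: "ennreal (?N * s ^ (?N - 1)) * (\<integral>\<^sup>+x\<in>ball 0 1. g (s *\<^sub>R x) * ennreal (norm x ^ ?N) \<partial>lborel) =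
      (\<integral>\<^sup>+y. g y * ?k s y \<partial>lborel)" if s: "s > 0" for s :: real
  proof -
    have "(\<integral>\<^sup>+y. g y * ?k s y \<partial>lborel) = ennreal (s ^ ?N) * (\<integral>\<^sup>+x. g (s *\<^sub>R x) * ?k s (s *\<^sub>R x) \<partial>lborel)"
      using s by (subst nn_integral_lborel_scale[where c=s]) auto
    also have "(\<integral>\<^sup>+x. g (s *\<^sub>R x) * ?k s (s *\<^sub>R x) \<partial>lborel) =
       (\<integral>\<^sup>+x. ennreal (?N / s) * (g (s *\<^sub>R x) * ennreal (norm x ^ ?N) * indicator (ball 0 1) x) \<partial>lborel)"
    proof (intro nn_integral_cong)
      fix x :: "real^'n"
      have "?N * norm (s *\<^sub>R x) ^ ?N / s ^ (?N + 1) = ?N / s * norm x ^ ?N"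
        using s by (simp add: power_mult_distrib)
      moreover have "norm (s *\<^sub>R x) < s \<longleftrightarrow> x \<in> ball 0 1"
        using s by auto
      ultimately show "g (s *\<^sub>R x) * ?k s (s *\<^sub>R x) =
          ennreal (?N / s) * (g (s *\<^sub>R x) * ennreal (norm x ^ ?N) * indicator (ball 0 1) x)"
        using s by (auto simp: mult_ac simp del: norm_scaleR simp flip: ennreal_mult)
    qed
    also have "\<dots> = ennreal (?N / s) * (\<integral>\<^sup>+x\<in>ball 0 1. g (s *\<^sub>R x) * ennreal (norm x ^ ?N) \<partial>lborel)"
      by (intro nn_integral_cmult) measurable
    also have "ennreal (s ^ ?N) * (ennreal (?N / s) * (\<integral>\<^sup>+x\<in>ball 0 1. g (s *\<^sub>R x) * ennreal (norm x ^ ?N) \<partial>lborel))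
       = ennreal (s ^ ?N * (?N / s)) * (\<integral>\<^sup>+x\<in>ball 0 1. g (s *\<^sub>R x) * ennreal (norm x ^ ?N) \<partial>lborel)"
      using s by (subst ennreal_mult) (auto simp: mult.assoc)
    also have "s ^ ?N * (?N / s) = ?N * s ^ (?N - 1)"
    proof -
      have "s ^ ?N = s * s ^ (?N - 1)"
        by (metis power_eq_if zero_less_card_finite less_irrefl)
      then show ?thesis using s by simp
    qed
    finally show ?thesis by simp
  qed
  have "(\<integral>\<^sup>+w. (\<integral>\<^sup>+r\<in>{0<..}. g (r *\<^sub>R w) * ennreal (r ^ (?N - 1)) \<partial>lborel) \<partial>sphere_measure)
      = of_nat ?N * (\<integral>\<^sup>+x\<in>ball 0 1. ?rad x \<partial>lborel)"
    by (intro nn_integral_sphere_measure) measurable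
  also have "\<dots> = (\<integral>\<^sup>+x. of_nat ?N * (?rad x * indicator (ball 0 1) x) \<partial>lborel)"
    by (intro nn_integral_cmult[symmetric]) measurable
  also have "\<dots> = (\<integral>\<^sup>+x. (\<integral>\<^sup>+s. ennreal (?N * s ^ (?N - 1)) * indicator {0<..} s * (g (s *\<^sub>R x) * ennreal (norm x ^ ?N) * indicator (ball 0 1) x) \<partial>lborel) \<partial>lborel)"
  proof (rule nn_integral_cong_AE, rule AE_mp[OF AE_lborel_singleton[of 0]], rule AE_I2, rule impI)
    fix x :: "real^'n" assume "x \<noteq> 0"
    then have "of_nat ?N * (?rad x * indicator (ball 0 1) x) =
       of_nat ?N * indicator (ball 0 1) x * (\<integral>\<^sup>+s\<in>{0<..}. g (s *\<^sub>R x) * ennreal (norm x ^ ?N * s ^ (?N - 1)) \<partial>lborel)"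
      unfolding rad[OF \<open>x \<noteq> 0\<close>] by (simp only: mult_ac)
    also have "\<dots> = (\<integral>\<^sup>+s. of_nat ?N * indicator (ball 0 1) x * (g (s *\<^sub>R x) * ennreal (norm x ^ ?N * s ^ (?N - 1)) * indicator {0<..} s) \<partial>lborel)"
      by (intro nn_integral_cmult[symmetric]) measurable
    also have "\<dots> = (\<integral>\<^sup>+s. ennreal (?N * s ^ (?N - 1)) * indicator {0<..} s * (g (s *\<^sub>R x) * ennreal (norm x ^ ?N) * indicator (ball 0 1) x) \<partial>lborel)"
      by (intro nn_integral_cong) (auto simp: indicator_def ennreal_mult ennreal_of_nat_eq_real_of_nat mult_ac)
    finally show "of_nat ?N * (?rad x * indicator (ball 0 1) x) = \<dots>" .
  qed
  also have "\<dots> = (\<integral>\<^sup>+s. (\<integral>\<^sup>+x. ennreal (?N * s ^ (?N - 1)) * indicator {0<..} s * (g (s *\<^sub>R x) * ennreal (norm x ^ ?N) * indicator (ball 0 1) x) \<partial>lborel) \<partial>lborel)"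
    by (intro lborel_pair.Fubini') measurable
  also have "\<dots> = (\<integral>\<^sup>+s. indicator {0<..} s * (\<integral>\<^sup>+y. g y * ?k s y \<partial>lborel) \<partial>lborel)"
  proof (intro nn_integral_cong)
    fix s :: real
    have "(\<integral>\<^sup>+x. ennreal (?N * s ^ (?N - 1)) * indicator {0<..} s * (g (s *\<^sub>R x) * ennreal (norm x ^ ?N) * indicator (ball 0 1) x) \<partial>lborel)
      = ennreal (?N * s ^ (?N - 1)) * indicator {0<..} s * (\<integral>\<^sup>+x\<in>ball 0 1. g (s *\<^sub>R x) * ennreal (norm x ^ ?N) \<partial>lborel)"
      by (intro nn_integral_cmult) measurable
    then show "(\<integral>\<^sup>+x. ennreal (?N * s ^ (?N - 1)) * indicator {0<..} s * (g (s *\<^sub>R x) * ennreal (norm x ^ ?N) * indicator (ball 0 1) x) \<partial>lborel)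
      = indicator {0<..} s * (\<integral>\<^sup>+y. g y * ?k s y \<partial>lborel)"
      using sc[of s] by (cases "s > 0") (auto simp: mult_ac)
  qed
  also have "\<dots> = (\<integral>\<^sup>+s. (\<integral>\<^sup>+y. g y * ?k s y \<partial>lborel) \<partial>lborel)"
  proof (intro nn_integral_cong)
    fix s :: real
    have "?k s y = 0" if "\<not> s > 0" for y
      using that norm_ge_zero[of y] by (auto simp del: norm_ge_zero)
    then show "indicator {0<..} s * (\<integral>\<^sup>+y. g y * ?k s y \<partial>lborel) = (\<integral>\<^sup>+y. g y * ?k s y \<partial>lborel)"
      by (cases "s > 0") auto
  qed
  also have "\<dots> = (\<integral>\<^sup>+y. (\<integral>\<^sup>+s. g y * ?k s y \<partial>lborel) \<partial>lborel)"
    by (intro lborel_pair.Fubini') measurable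
  also have "\<dots> = (\<integral>\<^sup>+y. g y \<partial>lborel)"
  proof (rule nn_integral_cong_AE, rule AE_mp[OF AE_lborel_singleton[of 0]], rule AE_I2, rule impI)
    fix y :: "real^'n" assume "y \<noteq> 0"
    have "(\<integral>\<^sup>+s. g y * ?k s y \<partial>lborel) = g y * (\<integral>\<^sup>+s. ?k s y \<partial>lborel)"
      by (intro nn_integral_cmult) measurable
    moreover have "?k s y = ennreal (?N * norm y ^ ?N / s ^ (?N + 1)) * indicator {norm y<..} s" for s
      by simp
    ultimately show "(\<integral>\<^sup>+s. g y * ?k s y \<partial>lborel) = g y"
      using nn_integral_inverse_power[of "norm y" ?N] \<open>y \<noteq> 0\<close> by simp
  qed
  finally show ?thesis by simp
qed

subsection \<open>Iterated logarithms\<close>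

lemma X_0: "X 0 t = t" and X_Suc: "X (Suc j) t = X1 (X j t)"
  by (simp_all add: X_def)

lemma X1_bounds: "0 < t \<Longrightarrow> t \<le> 1 \<Longrightarrow> 0 < X1 t \<and> X1 t \<le> 1"
  by (simp add: X1_def divide_simps) (smt (verit) ln_le_zero_iff)

lemma X_bounds: "0 < t \<Longrightarrow> t \<le> 1 \<Longrightarrow> 0 < X j t \<and> X j t \<le> 1"
  by (induction j) (simp_all add: X_0 X_Suc X1_bounds)

lemma X_1: "X j 1 = 1"
  by (induction j) (simp_all add: X_0 X_Suc X1_def)

lemma measurable_X [measurable]: "X j \<in> borel_measurable borel"
proof (induction j)
  case (Suc j)
  have "X1 \<in> borel_measurable borel" unfolding X1_def by measurable
  then have "(\<lambda>t. X1 (X j t)) \<in> borel_measurable borel"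
    using Suc by (rule measurable_compose[rotated])
  then show ?case by (simp add: X_Suc[abs_def])
qed (simp add: X_0[abs_def])

definition XP :: "nat \<Rightarrow> real \<Rightarrow> real" where
  "XP i t = (\<Prod>j=1..i. X j t)"

lemma XP_Suc: "XP (Suc i) t = XP i t * X (Suc i) t"
  by (simp add: XP_def)

lemma measurable_XP [measurable]: "XP j \<in> borel_measurable borel"
  unfolding XP_def by measurable

lemma XP_bounds: "0 < t \<Longrightarrow> t \<le> 1 \<Longrightarrow> 0 < XP j t \<and> XP j t \<le> 1"
  unfolding XP_def using X_bounds[of t] by (intro conjI prod_pos prod_le_1) (auto simp: le_less)

lemma XP_1: "XP j 1 = 1"
  by (simp add: XP_def X_1)

text \<open>As \<open>X1' = X1^2 / t\<close>, the chain rule cancels one factor \<open>X j t\<close>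
  at each step. Thus the logarithmic derivative of \<open>X j\<close> is \<open>XP j t / t\<close>,
  whose sum over \<open>j\<close> is that of a product \<open>XP i\<close>.\<close>

lemma X_has_derivative:
  assumes t: "0 < t" "t \<le> 1"
  shows "(X j has_real_derivative X j t * XP j t / t) (at t)"
proof (induction j)
  case 0
  then show ?case using t by (simp add: X_0[abs_def] XP_def)
next
  case (Suc j)
  have x: "0 < X j t" "X j t \<le> 1" using X_bounds[OF t] by auto
  have "(X1 has_real_derivative (X1 (X j t))\<^sup>2 / X j t) (at (X j t))"
  proof -
    have "1 - ln (X j t) \<noteq> 0" using x by (smt (verit) ln_le_zero_iff)
    then show ?thesis unfolding X1_def using x
      by (auto intro!: derivative_eq_intros simp: field_simps power2_eq_square)
  qed
  from DERIV_chain2[OF this Suc.IH] show ?case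
    using x by (simp add: X_Suc[abs_def] XP_Suc power2_eq_square field_simps)
qed

lemma XP_has_derivative:
  assumes t: "0 < t" "t \<le> 1"
  shows "(XP i has_real_derivative XP i t * (\<Sum>j=1..i. XP j t) / t) (at t)"
proof (induction i)
  case 0
  then show ?case using t by (simp add: XP_def)
next
  case (Suc i)
  have "((\<lambda>t. XP i t * X (Suc i) t) has_real_derivative
      XP i t * (\<Sum>j=1..i. XP j t) / t * X (Suc i) t + X (Suc i) t * XP (Suc i) t / t * XP i t) (at t)"
    by (intro DERIV_mult Suc X_has_derivative[OF t])
  then show ?case
    by (simp add: XP_Suc[abs_def] XP_Suc add_divide_distrib algebra_simps)
qed

text \<open>\<open>1 - ln b \<le> ln 2 + (1 - ln a)\<close> and
  \<open>ln 2 < 1 \<le> 1 - ln a\<close>. The factor 2 is reproduced, so the bound iterates to every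
  \<open>X j\<close> without deteriorating.\<close>

lemma X1_double:
  assumes "0 < a" "a \<le> 1" "0 < b" "b \<le> 1" "a \<le> 2 * b"
  shows "X1 a \<le> 2 * X1 b"
proof -
  have "ln a \<le> ln (2 * b)" using assms by (subst ln_le_cancel_iff) auto
  also have "\<dots> = ln 2 + ln b" using assms by (simp add: ln_mult)
  finally have "ln a \<le> ln 2 + ln b" .
  moreover have neg: "ln a \<le> 0" "ln b \<le> 0" using assms by auto
  ultimately have "1 - ln b \<le> 2 * (1 - ln a)" using ln_2_less_1 by argo
  moreover have "0 < 1 - ln a" "0 < 1 - ln b" using neg by auto
  ultimately show ?thesis unfolding X1_def by (simp add: divide_simps)
qed

lemma X_double:
  assumes "0 < a" "a \<le> 1" "0 < b" "b \<le> 1" "a \<le> 2 * b"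
  shows "X j a \<le> 2 * X j b"
  using assms by (induction j) (auto simp: X_0 X_Suc X_bounds intro!: X1_double)

text \<open>The weight of the theorem: the product of the \<open>X_tilde j\<close> as a function of the radius.\<close>

definition XW :: "nat \<Rightarrow> real \<Rightarrow> real" where
  "XW i r = XP i (min r 1)"

lemma XW_bounds: "0 < r \<Longrightarrow> 0 < XW i r \<and> XW i r \<le> 1"
  unfolding XW_def by (intro XP_bounds) auto

lemma measurable_XW [measurable]: "XW i \<in> borel_measurable borel"
  unfolding XW_def by measurable

text \<open>This freezes the weight at one scale: throughout an annulus it may be exchanged for its
  value at a comparable radius, at the cost of \<open>2 ^ i\<close>. The bound is one-sided, so
  radii much smaller than \<open>s\<close> are allowed too.\<close>

lemma XW_double:
  assumes "0 < r" "0 < s" "r \<le> 2 * s"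
  shows "XW i r \<le> 2 ^ i * XW i s"
proof -
  have "XP i (min r 1) \<le> (\<Prod>j=1..i. 2 * X j (min s 1))"
    unfolding XP_def using assms X_bounds[of "min r 1"]
    by (intro prod_mono conjI X_double) (auto simp: le_less min_def)
  then show ?thesis by (simp add: XW_def XP_def prod.distrib)
qed

lemma prod_X_tilde: "(\<Prod>j=1..i. X_tilde j x) = XW i (norm x)"
  by (cases "norm x < 1") (simp_all add: X_tilde_def XW_def XP_def X_1)

subsection \<open>Inequalities along rays\<close>

lemma nn_integral_continuous_interval:
  fixes f :: "real \<Rightarrow> real"
  assumes f: "continuous_on {a..b} f" and nn: "\<And>x. x \<in> {a..b} \<Longrightarrow> 0 \<le> f x"
  shows "(\<integral>\<^sup>+x\<in>{a..b}. ennreal (f x) \<partial>lborel) = ennreal (integral {a..b} f)"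
proof -
  have int: "set_integrable lborel {a..b} f"
    by (rule borel_integrable_atLeastAtMost'[OF f])
  have "(\<integral>\<^sup>+x\<in>{a..b}. ennreal (f x) \<partial>lborel) = (\<integral>\<^sup>+x. ennreal (indicator {a..b} x *\<^sub>R f x) \<partial>lborel)"
    by (intro nn_integral_cong) (auto simp: indicator_def)
  also have "\<dots> = ennreal (LBINT x:{a..b}. f x)"
    unfolding set_lebesgue_integral_def using int nn
    by (intro nn_integral_eq_integral) (auto simp: set_integrable_def indicator_def)
  also have "(LBINT x:{a..b}. f x) = integral {a..b} f"
    by (rule set_borel_integral_eq_integral(2)[OF int])
  finally show ?thesis .
qed

lemma nn_integral_le_of_incseq:
  fixes f :: "'a \<Rightarrow> ennreal"
  assumes [measurable]: "f \<in> borel_measurable M" "\<And>n. A n \<in> sets M" and inc: "incseq A"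
    and le: "\<And>n. (\<integral>\<^sup>+x. f x * indicator (A n) x \<partial>M) \<le> C"
  shows "(\<integral>\<^sup>+x. f x * indicator (\<Union>n. A n) x \<partial>M) \<le> C"
proof -
  have "(\<integral>\<^sup>+x. f x * indicator (\<Union>n. A n) x \<partial>M) = emeasure (density M f) (\<Union>n. A n)"
    by (simp add: emeasure_density)
  also have "\<dots> = (SUP n. emeasure (density M f) (A n))"
    using inc by (intro SUP_emeasure_incseq[symmetric]) auto
  also have "\<dots> \<le> C"
    using le by (intro SUP_least) (simp add: emeasure_density)
  finally show ?thesis .
qed

text \<open>Integrating the derivative of \<open>r\<^sup>l\<^sup>+\<^sup>1 c y\<^sup>2\<close>.  Here and below \<open>l = N - 3\<close>; each application chooses
  \<open>c\<close> so that the pointwise hypothesis becomes a complete square.\<close>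

lemma ray_inequality:
  fixes y y' c c' \<alpha> \<beta> :: "real \<Rightarrow> real"
  assumes ab: "0 < a" "a \<le> b"
    and y: "\<And>r. r \<in> {a..b} \<Longrightarrow> (y has_real_derivative y' r) (at r)"
    and c: "\<And>r. r \<in> {a..b} \<Longrightarrow> (c has_real_derivative c' r / r) (at r)"
    and cont: "continuous_on {a..b} \<alpha>" "continuous_on {a..b} \<beta>"
    and nn: "\<And>r. r \<in> {a..b} \<Longrightarrow> 0 \<le> \<alpha> r" "\<And>r. r \<in> {a..b} \<Longrightarrow> 0 \<le> \<beta> r" "0 \<le> c a" "0 \<le> c b"
    and le: "\<And>r. r \<in> {a..b} \<Longrightarrow>
      \<alpha> r \<le> \<beta> r + r ^ l * ((real l + 1) * c r * (y r)\<^sup>2 + c' r * (y r)\<^sup>2 + 2 * r * c r * y r * y' r)"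
  shows "ennreal (a ^ (l + 1) * c a * (y a)\<^sup>2) + (\<integral>\<^sup>+r\<in>{a..b}. ennreal (\<alpha> r) \<partial>lborel)
    \<le> ennreal (b ^ (l + 1) * c b * (y b)\<^sup>2) + (\<integral>\<^sup>+r\<in>{a..b}. ennreal (\<beta> r) \<partial>lborel)"
proof -
  let ?F = "\<lambda>r. r ^ (l + 1) * c r * (y r)\<^sup>2"
  let ?F' = "\<lambda>r. r ^ l * ((real l + 1) * c r * (y r)\<^sup>2 + c' r * (y r)\<^sup>2 + 2 * r * c r * y r * y' r)"
  have "(?F has_real_derivative ?F' r) (at r)" if r: "r \<in> {a..b}" for r
  proof -
    have 1: "((\<lambda>r. r ^ (l + 1)) has_real_derivative (real l + 1) * r ^ l) (at r)"
      using DERIV_pow[of "l + 1" r] by (simp add: add.commute)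
    have 2: "((\<lambda>r. (y r)\<^sup>2) has_real_derivative 2 * y r * y' r) (at r)"
      by (auto intro!: derivative_eq_intros y r)
    show ?thesis
      by (rule DERIV_cong[OF DERIV_mult[OF DERIV_mult[OF 1 c[OF r]] 2]])
        (use r ab in \<open>simp add: field_simps\<close>)
  qed
  then have "(?F' has_integral ?F b - ?F a) {a..b}"
    using ab by (intro fundamental_theorem_of_calculus)
      (auto simp flip: has_real_derivative_iff_has_vector_derivative intro: has_field_derivative_at_within)
  then have I\<beta>: "((\<lambda>r. \<beta> r + ?F' r) has_integral integral {a..b} \<beta> + (?F b - ?F a)) {a..b}"
    by (intro has_integral_add integrable_integral integrable_continuous_real cont)
  have I\<alpha>: "(\<alpha> has_integral integral {a..b} \<alpha>) {a..b}"
    by (intro integrable_integral integrable_continuous_real cont)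
  have "integral {a..b} \<alpha> \<le> integral {a..b} \<beta> + (?F b - ?F a)"
    by (rule has_integral_le[OF I\<alpha> I\<beta> le])
  moreover have "0 \<le> ?F a" "0 \<le> ?F b" "0 \<le> integral {a..b} \<alpha>" "0 \<le> integral {a..b} \<beta>"
    using nn ab cont by (auto intro!: integral_nonneg integrable_continuous_real)
  ultimately have "ennreal (?F a + integral {a..b} \<alpha>) \<le> ennreal (?F b + integral {a..b} \<beta>)"
    "ennreal (?F a + integral {a..b} \<alpha>) = ennreal (?F a) + ennreal (integral {a..b} \<alpha>)"
    "ennreal (?F b + integral {a..b} \<beta>) = ennreal (?F b) + ennreal (integral {a..b} \<beta>)"
    by (intro ennreal_leI ennreal_plus; linarith)+
  moreover have "(\<integral>\<^sup>+r\<in>{a..b}. ennreal (\<alpha> r) \<partial>lborel) = ennreal (integral {a..b} \<alpha>)"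
    "(\<integral>\<^sup>+r\<in>{a..b}. ennreal (\<beta> r) \<partial>lborel) = ennreal (integral {a..b} \<beta>)"
    by (intro nn_integral_continuous_interval cont nn; assumption)+
  ultimately show ?thesis by (simp only:)
qed

text \<open>The lower endpoint runs through \<open>1/(n+1)\<close>. The boundary term there is
  non-negative and stands on the left, so it is dropped, and no information about \<open>c\<close>
  or \<open>y\<close> near 0 is required.\<close>

lemma ray_inequality_0_1:
  fixes y y' c c' \<alpha> \<beta> :: "real \<Rightarrow> real"
  assumes y: "\<And>r. r \<in> {0<..1} \<Longrightarrow> (y has_real_derivative y' r) (at r)"
    and c: "\<And>r. r \<in> {0<..1} \<Longrightarrow> (c has_real_derivative c' r / r) (at r)"
    and cont: "continuous_on {0<..1} \<alpha>" "continuous_on {0<..1} \<beta>"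
    and nn: "\<And>r. r \<in> {0<..1} \<Longrightarrow> 0 \<le> \<alpha> r" "\<And>r. r \<in> {0<..1} \<Longrightarrow> 0 \<le> \<beta> r" "\<And>r. r \<in> {0<..1} \<Longrightarrow> 0 \<le> c r"
    and le: "\<And>r. r \<in> {0<..1} \<Longrightarrow>
      \<alpha> r \<le> \<beta> r + r ^ l * ((real l + 1) * c r * (y r)\<^sup>2 + c' r * (y r)\<^sup>2 + 2 * r * c r * y r * y' r)"
  shows "(\<integral>\<^sup>+r\<in>{0<..1}. ennreal (\<alpha> r) \<partial>lborel)
    \<le> ennreal (c 1 * (y 1)\<^sup>2) + (\<integral>\<^sup>+r\<in>{0<..1}. ennreal (\<beta> r) \<partial>lborel)" (is "_ \<le> ?C")
proof -
  let ?\<alpha> = "\<lambda>r. ennreal (\<alpha> r) * indicator {0<..1} r"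
  have "(\<lambda>r. indicator {0<..1} r *\<^sub>R \<alpha> r) \<in> borel_measurable borel"
    by (intro borel_measurable_continuous_on_indicator cont) auto
  then have "(\<lambda>r. ennreal (indicator {0<..1} r *\<^sub>R \<alpha> r)) \<in> borel_measurable borel" by measurable
  also have "(\<lambda>r. ennreal (indicator {0<..1} r *\<^sub>R \<alpha> r)) = ?\<alpha>"
    by (auto simp: indicator_def)
  finally have meas: "?\<alpha> \<in> borel_measurable lborel" by simp
  have "(\<integral>\<^sup>+r\<in>{1 / real (Suc n)..1}. ?\<alpha> r \<partial>lborel) \<le> ?C" for n
  proof -
    let ?a = "1 / real (Suc n)"
    have a: "0 < ?a" "?a \<le> 1" by auto
    have sub: "{?a..1} \<subseteq> {0<..1}" using a(1) by (meson atLeastAtMost_iff greaterThanAtMost_iff less_le_trans subsetI)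
    have "ennreal (?a ^ (l + 1) * c ?a * (y ?a)\<^sup>2) + (\<integral>\<^sup>+r\<in>{?a..1}. ennreal (\<alpha> r) \<partial>lborel)
      \<le> ennreal (1 ^ (l + 1) * c 1 * (y 1)\<^sup>2) + (\<integral>\<^sup>+r\<in>{?a..1}. ennreal (\<beta> r) \<partial>lborel)"
      by (rule ray_inequality[OF a, where y'=y' and c'=c'];
          (intro y c nn le cont[THEN continuous_on_subset] sub)?) (use sub a in auto)
    also have "\<dots> \<le> ?C"
      using sub by (auto simp: indicator_def intro!: add_left_mono nn_integral_mono)
    finally have "(\<integral>\<^sup>+r\<in>{?a..1}. ennreal (\<alpha> r) \<partial>lborel) \<le> ?C"
      by (rule order_trans[rotated]) simp
    moreover have "?\<alpha> r * indicator {?a..1} r = ennreal (\<alpha> r) * indicator {?a..1} r" for r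
      using subsetD[OF sub, of r] by (auto simp: indicator_def simp del: of_nat_Suc)
    ultimately show ?thesis by (simp only:)
  qed
  moreover have "incseq (\<lambda>n. {1 / real (Suc n)..1})"
    by (auto simp: incseq_def frac_le intro: order_trans[rotated])
  moreover have "(\<Union>n. {1 / real (Suc n)..1}) = {0<..1::real}" (is "?L = ?R")
  proof
    show "?L \<subseteq> ?R"
    proof
      fix x assume "x \<in> ?L"
      then obtain n where "1 / real (Suc n) \<le> x" "x \<le> 1" by auto
      moreover have "0 < 1 / real (Suc n)" by simp
      ultimately have "0 < x" "x \<le> 1" by linarith+
      then show "x \<in> ?R" by simp
    qed
    show "?R \<subseteq> ?L"
    proof
      fix x :: real assume x: "x \<in> ?R"
      then have "0 < x" by simp
      then obtain n where "1 / real (Suc n) < x" by (rule nat_approx_posE)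
      then have "x \<in> {1 / real (Suc n)..1}" using x by (simp del: of_nat_Suc)
      then show "x \<in> ?L" by blast
    qed
  qed
  moreover have "?\<alpha> r * indicator {0<..1} r = ?\<alpha> r" for r by (auto simp: indicator_def)
  ultimately show ?thesis
    using nn_integral_le_of_incseq[OF meas, of "\<lambda>n. {1 / real (Suc n)..1}" ?C] by simp
qed

text \<open>Once the upper endpoint has passed the support of \<open>y\<close>, the boundary term
  there vanishes; the one at \<open>a\<close> is kept, since it becomes the boundary integral over
  the sphere.\<close>

lemma ray_inequality_inf:
  fixes y y' \<alpha> \<beta> :: "real \<Rightarrow> real"
  assumes a: "0 < a"
    and y: "\<And>r. (y has_real_derivative y' r) (at r)" "\<And>r. r > R \<Longrightarrow> y r = 0"
    and c: "0 \<le> c"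
    and cont: "continuous_on {a..} \<alpha>" "continuous_on {a..} \<beta>"
    and nn: "\<And>r. r \<ge> a \<Longrightarrow> 0 \<le> \<alpha> r" "\<And>r. r \<ge> a \<Longrightarrow> 0 \<le> \<beta> r"
    and le: "\<And>r. r \<ge> a \<Longrightarrow>
      \<alpha> r \<le> \<beta> r + r ^ l * ((real l + 1) * c * (y r)\<^sup>2 + 2 * r * c * y r * y' r)"
  shows "ennreal (a ^ (l + 1) * c * (y a)\<^sup>2) + (\<integral>\<^sup>+r\<in>{a..}. ennreal (\<alpha> r) \<partial>lborel)
    \<le> (\<integral>\<^sup>+r\<in>{a..}. ennreal (\<beta> r) \<partial>lborel)"
proof -
  let ?C = "\<integral>\<^sup>+r\<in>{a..}. ennreal (\<beta> r) \<partial>lborel"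
  let ?\<alpha> = "\<lambda>r. ennreal (\<alpha> r) * indicator {a..} r"
  \<comment> \<open>The boundary term is written as an integral over an interval of length 1 to the
    left of \<open>a\<close>, so monotone convergence handles it together with
    \<open>?\<alpha>\<close>.\<close>
  let ?e = "\<lambda>r. ennreal (a ^ (l + 1) * c * (y a)\<^sup>2) * indicator {a - 1..<a} r"
  let ?A = "\<lambda>n. {a - 1..max a (R + 1) + real n}"
  have "(\<lambda>r. indicator {a..} r *\<^sub>R \<alpha> r) \<in> borel_measurable borel"
    by (intro borel_measurable_continuous_on_indicator cont) auto
  then have "(\<lambda>r. ennreal (indicator {a..} r *\<^sub>R \<alpha> r)) \<in> borel_measurable borel" by measurable
  also have "(\<lambda>r. ennreal (indicator {a..} r *\<^sub>R \<alpha> r)) = ?\<alpha>"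
    by (auto simp: indicator_def)
  finally have meas [measurable]: "?\<alpha> \<in> borel_measurable lborel" by simp
  have e: "(\<integral>\<^sup>+r. ?e r \<partial>lborel) = ennreal (a ^ (l + 1) * c * (y a)\<^sup>2)"
    by (subst nn_integral_cmult_indicator) auto
  have "(\<integral>\<^sup>+r. (?e r + ?\<alpha> r) * indicator (?A n) r \<partial>lborel) \<le> ?C" for n
  proof -
    let ?b = "max a (R + 1) + real n"
    have b: "a \<le> ?b" by auto
    have yb: "y ?b = 0" by (intro y) auto
    have "ennreal (a ^ (l + 1) * c * (y a)\<^sup>2) + (\<integral>\<^sup>+r\<in>{a..?b}. ennreal (\<alpha> r) \<partial>lborel)
      \<le> ennreal (?b ^ (l + 1) * c * (y ?b)\<^sup>2) + (\<integral>\<^sup>+r\<in>{a..?b}. ennreal (\<beta> r) \<partial>lborel)"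
      by (rule ray_inequality[OF a b, where y'=y' and c'="\<lambda>_. 0"])
        (use nn le c y in \<open>auto intro: continuous_on_subset[OF cont(1)] continuous_on_subset[OF cont(2)]\<close>)
    also have "\<dots> \<le> ?C"
      using yb by (auto simp: indicator_def intro!: nn_integral_mono)
    also have "ennreal (a ^ (l + 1) * c * (y a)\<^sup>2) + (\<integral>\<^sup>+r\<in>{a..?b}. ennreal (\<alpha> r) \<partial>lborel)
       = (\<integral>\<^sup>+r. ?e r \<partial>lborel) + (\<integral>\<^sup>+r. ?\<alpha> r * indicator (?A n) r \<partial>lborel)"
      unfolding e by (intro arg_cong2[where f="(+)"] refl nn_integral_cong) (auto simp: indicator_def)
    also have "\<dots> = (\<integral>\<^sup>+r. ?e r + ?\<alpha> r * indicator (?A n) r \<partial>lborel)"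
      by (intro nn_integral_add[symmetric]) measurable
    also have "\<dots> = (\<integral>\<^sup>+r. (?e r + ?\<alpha> r) * indicator (?A n) r \<partial>lborel)"
      using b by (intro nn_integral_cong) (auto simp: indicator_def)
    finally show ?thesis .
  qed
  moreover have "incseq ?A" by (auto simp: incseq_def)
  moreover have "(\<Union>n. ?A n) = {a - 1..}"
  proof -
    have "\<exists>n. x \<le> max a (R + 1) + real n" for x
      using real_arch_simple[of "x - max a (R + 1)"] by (auto simp: algebra_simps)
    then show ?thesis by auto
  qed
  moreover have "(?e r + ?\<alpha> r) * indicator {a - 1..} r = ?e r + ?\<alpha> r" for r
    by (auto simp: indicator_def)
  ultimately have "(\<integral>\<^sup>+r. ?e r + ?\<alpha> r \<partial>lborel) \<le> ?C"
    using nn_integral_le_of_incseq[of "\<lambda>r. ?e r + ?\<alpha> r" lborel ?A ?C] by (simp only:) auto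
  then show ?thesis by (subst (asm) nn_integral_add) (simp_all only: e meas, measurable)
qed

text \<open>\<open>- HP l k r / r\<close> is the logarithmic derivative of the ground state, and \<open>Vrad l k r / r\<^sup>2\<close> is the
  potential; the ground state equation is the Riccati equation below.\<close>

definition HP :: "nat \<Rightarrow> nat \<Rightarrow> real \<Rightarrow> real" where
  "HP l k r = (real l + 1) / 2 + (\<Sum>i=1..k. XP i r) / 2"

lemma HP_bounds:
  assumes "0 < r" "r \<le> 1"
  shows "0 < HP l k r \<and> HP l k r \<le> (real l + 1 + real k) / 2"
proof -
  define S where "S = (\<Sum>i=1..k. XP i r)"
  have "S \<le> (\<Sum>i=1..k. 1)" "0 \<le> S"
    unfolding S_def using XP_bounds[OF assms] by (intro sum_mono sum_nonneg; simp add: le_less)+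
  then show ?thesis unfolding HP_def S_def[symmetric] add_divide_distrib[symmetric] by simp
qed

lemma HP_1: "HP l k 1 = (real l + 1 + real k) / 2"
  by (simp add: HP_def XP_1)

lemma measurable_HP [measurable]: "HP l k \<in> borel_measurable borel"
  unfolding HP_def by measurable

lemma HP_has_derivative:
  assumes r: "0 < r" "r \<le> 1"
  shows "(HP l k has_real_derivative ((\<Sum>i=1..k. XP i r * (\<Sum>j=1..i. XP j r)) / 2) / r) (at r)"
  unfolding HP_def using r
  by (auto intro!: derivative_eq_intros XP_has_derivative simp: sum_divide_distrib mult.commute)

lemma sum_mult_partial_sums:
  fixes f :: "nat \<Rightarrow> real"
  shows "2 * (\<Sum>i=1..k. f i * (\<Sum>j=1..i. f j)) = (\<Sum>i=1..k. f i)\<^sup>2 + (\<Sum>i=1..k. (f i)\<^sup>2)"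
  by (induction k) (simp_all add: algebra_simps power2_eq_square)

definition Vrad :: "nat \<Rightarrow> nat \<Rightarrow> real \<Rightarrow> real" where
  "Vrad l k r = ((real l + 1) / 2)\<^sup>2 + (\<Sum>i=1..k. (XP i r)\<^sup>2) / 4"

text \<open>With \<open>H = HP l k\<close> the last sum is \<open>r H'\<close>, so this reads
  \<open>V + H^2 = (N-2) H + r H'\<close>. It is the equation
  \<open>-\<Delta>\<phi> = V \<phi> / r^2\<close> for a radial function with
  \<open>\<phi>'/\<phi> = -H/r\<close>.\<close>

lemma HP_Riccati:
  "Vrad l k r + (HP l k r)\<^sup>2 = (real l + 1) * HP l k r + (\<Sum>i=1..k. XP i r * (\<Sum>j=1..i. XP j r)) / 2"
  using sum_mult_partial_sums[of "\<lambda>i. XP i r" k]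
  by (simp add: HP_def Vrad_def power2_eq_square field_simps)

lemma continuous_on_Ioc_0_1:
  assumes "\<And>r. 0 < r \<Longrightarrow> r \<le> 1 \<Longrightarrow> (f has_real_derivative f' r) (at r)"
  shows "continuous_on {0<..1} f"
  using assms by (intro continuous_at_imp_continuous_on ballI DERIV_isCont) auto

lemma continuous_on_XP: "continuous_on {0<..1} (XP i)"
  by (rule continuous_on_Ioc_0_1, rule XP_has_derivative)

lemma continuous_on_HP: "continuous_on {0<..1} (HP l k)"
  by (rule continuous_on_Ioc_0_1, rule HP_has_derivative)

section \<open>Hardy-type inequalities on a single ray, by completing squares\<close>

context
  fixes y y' :: "real \<Rightarrow> real"
  assumes y: "\<And>r. (y has_real_derivative y' r) (at r)" and y': "continuous_on UNIV y'"
begin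

lemma y_continuous: "continuous_on S y"
  using DERIV_isCont[OF y] by (intro continuous_at_imp_continuous_on) blast

lemma y'_continuous: "continuous_on S y'"
  by (rule continuous_on_subset[OF y']) simp

text \<open>With \<open>c = HP l k\<close> the Riccati equation makes the pointwise comparison an
  equality. All \<open>XP i\<close> equal 1 at radius 1, which is where the boundary constant
  \<open>(N-2+k)/2\<close> comes from.\<close>

lemma ray_ground_state:
  "(\<integral>\<^sup>+r\<in>{0<..1}. ennreal (r ^ l * Vrad l k r * (y r)\<^sup>2 + r ^ l * (r * y' r + HP l k r * y r)\<^sup>2) \<partial>lborel)
    \<le> ennreal ((real l + 1 + real k) / 2 * (y 1)\<^sup>2) + (\<integral>\<^sup>+r\<in>{0<..1}. ennreal (r ^ (l + 2) * (y' r)\<^sup>2) \<partial>lborel)"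
  unfolding HP_1[symmetric]
proof (rule ray_inequality_0_1[OF y HP_has_derivative])
  fix r :: real assume r: "r \<in> {0<..1}"
  have V: "0 \<le> Vrad l k r" by (simp add: Vrad_def sum_nonneg)
  show "0 \<le> r ^ l * Vrad l k r * (y r)\<^sup>2 + r ^ l * (r * y' r + HP l k r * y r)\<^sup>2"
    using r V by simp
  have "r ^ l * Vrad l k r * (y r)\<^sup>2 + r ^ l * (r * y' r + HP l k r * y r)\<^sup>2 =
      r ^ l * ((Vrad l k r + (HP l k r)\<^sup>2) * (y r)\<^sup>2 + (r * y' r)\<^sup>2 + 2 * r * HP l k r * y r * y' r)"
    by (simp add: power2_eq_square algebra_simps)
  also have "\<dots> = r ^ (l + 2) * (y' r)\<^sup>2 + r ^ l * ((real l + 1) * HP l k r * (y r)\<^sup>2 +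
         (\<Sum>i=1..k. XP i r * (\<Sum>j=1..i. XP j r)) / 2 * (y r)\<^sup>2 + 2 * r * HP l k r * y r * y' r)"
    unfolding HP_Riccati by (simp add: power2_eq_square algebra_simps)
  finally show "r ^ l * Vrad l k r * (y r)\<^sup>2 + r ^ l * (r * y' r + HP l k r * y r)\<^sup>2 \<le> \<dots>"
    by simp
qed (auto simp: Vrad_def HP_bounds less_imp_le
      intro!: continuous_intros y_continuous y'_continuous continuous_on_HP continuous_on_XP)

text \<open>The multiplier is half of \<open>P = XP (Suc k)\<close>. In its derivative the terms
  \<open>XP j\<close> with \<open>j \<le> k\<close> combine with \<open>N-2\<close> to
  \<open>2 HP l k\<close> and fit the square of \<open>r y' + HP l k r y + P y / 2\<close>; the term
  with \<open>j = Suc k\<close> supplies the gain \<open>P^2/4\<close>.\<close>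

lemma ray_Hardy:
  "(\<integral>\<^sup>+r\<in>{0<..1}. ennreal (r ^ l * (XP (Suc k) r)\<^sup>2 * (y r)\<^sup>2 / 4) \<partial>lborel)
    \<le> ennreal ((y 1)\<^sup>2 / 2) + (\<integral>\<^sup>+r\<in>{0<..1}. ennreal (r ^ l * (r * y' r + HP l k r * y r)\<^sup>2) \<partial>lborel)"
proof -
  let ?P = "XP (Suc k)" let ?S = "\<lambda>r. \<Sum>j=1..Suc k. XP j r"
  have der: "((\<lambda>r. ?P r / 2) has_real_derivative (?P r * ?S r / 2) / r) (at r)" if "r \<in> {0<..1}" for r
    using that by (auto intro!: derivative_eq_intros XP_has_derivative)
  have "(\<integral>\<^sup>+r\<in>{0<..1}. ennreal (r ^ l * (?P r)\<^sup>2 * (y r)\<^sup>2 / 4) \<partial>lborel)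
    \<le> ennreal (?P 1 / 2 * (y 1)\<^sup>2) + (\<integral>\<^sup>+r\<in>{0<..1}. ennreal (r ^ l * (r * y' r + HP l k r * y r)\<^sup>2) \<partial>lborel)"
  proof (rule ray_inequality_0_1[OF y der])
    fix r :: real assume r: "r \<in> {0<..1}"
    have "0 \<le> r ^ l * (r * y' r + HP l k r * y r + ?P r * y r / 2)\<^sup>2" using r by simp
    also have "\<dots> = r ^ l * (r * y' r + HP l k r * y r)\<^sup>2 + r ^ l * ((real l + 1) * (?P r / 2) * (y r)\<^sup>2 +
       ?P r * ?S r / 2 * (y r)\<^sup>2 + 2 * r * (?P r / 2) * y r * y' r) - r ^ l * (?P r)\<^sup>2 * (y r)\<^sup>2 / 4"
      by (simp add: HP_def power2_eq_square field_simps)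
    finally show "r ^ l * (?P r)\<^sup>2 * (y r)\<^sup>2 / 4 \<le> r ^ l * (r * y' r + HP l k r * y r)\<^sup>2 +
      r ^ l * ((real l + 1) * (?P r / 2) * (y r)\<^sup>2 +
       ?P r * ?S r / 2 * (y r)\<^sup>2 + 2 * r * (?P r / 2) * y r * y' r)" by simp
  qed (auto simp: XP_bounds less_imp_le
      intro!: continuous_intros y_continuous y'_continuous continuous_on_HP continuous_on_XP)
  then show ?thesis by (simp add: XP_1)
qed

text \<open>Twice the multiplier of \<open>ray_Hardy\<close> uses up the whole \<open>P^2\<close>
  term in the square. No integral is gained; what remains is the boundary value at \<open>a\<close>,
  bounded uniformly in \<open>a\<close>.\<close>

lemma ray_sup:
  assumes a: "0 < a" "a \<le> 1"
  shows "ennreal (a ^ (l + 1) * XP (Suc k) a * (y a)\<^sup>2) \<le>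
    ennreal ((y 1)\<^sup>2) + (\<integral>\<^sup>+r\<in>{0<..1}. ennreal (r ^ l * (r * y' r + HP l k r * y r)\<^sup>2) \<partial>lborel)"
proof -
  let ?P = "XP (Suc k)" let ?S = "\<lambda>r. \<Sum>j=1..Suc k. XP j r"
  have sub: "{a..1} \<subseteq> {0<..1}" using a by auto
  have der: "(?P has_real_derivative (?P r * ?S r) / r) (at r)" if "r \<in> {a..1}" for r
    using that a XP_has_derivative[of r "Suc k"] by simp
  have "ennreal (a ^ (l + 1) * ?P a * (y a)\<^sup>2) + (\<integral>\<^sup>+r\<in>{a..1}. ennreal 0 \<partial>lborel)
    \<le> ennreal (1 ^ (l + 1) * ?P 1 * (y 1)\<^sup>2) + (\<integral>\<^sup>+r\<in>{a..1}. ennreal (r ^ l * (r * y' r + HP l k r * y r)\<^sup>2) \<partial>lborel)"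
  proof (rule ray_inequality[OF a y der])
    fix r :: real assume r: "r \<in> {a..1}"
    have "0 \<le> r ^ l * (r * y' r + HP l k r * y r + ?P r * y r)\<^sup>2" using r a by simp
    also have "\<dots> = r ^ l * (r * y' r + HP l k r * y r)\<^sup>2 + r ^ l * ((real l + 1) * ?P r * (y r)\<^sup>2 +
       ?P r * ?S r * (y r)\<^sup>2 + 2 * r * ?P r * y r * y' r)"
      by (simp add: HP_def power2_eq_square field_simps)
    finally show "0 \<le> r ^ l * (r * y' r + HP l k r * y r)\<^sup>2 + r ^ l * ((real l + 1) * ?P r * (y r)\<^sup>2 +
       ?P r * ?S r * (y r)\<^sup>2 + 2 * r * ?P r * y r * y' r)" by simp
    show "0 \<le> r ^ l * (r * y' r + HP l k r * y r)\<^sup>2" using r a by simp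
  next
    show "continuous_on {a..1} (\<lambda>r. r ^ l * (r * y' r + HP l k r * y r)\<^sup>2)"
      by (intro continuous_intros y_continuous y'_continuous continuous_on_subset[OF continuous_on_HP sub])
  qed (use a XP_bounds[of a "Suc k"] in \<open>auto simp: XP_1\<close>)
  also have "\<dots> \<le> ennreal ((y 1)\<^sup>2) + (\<integral>\<^sup>+r\<in>{0<..1}. ennreal (r ^ l * (r * y' r + HP l k r * y r)\<^sup>2) \<partial>lborel)"
    using sub by (auto simp: XP_1 indicator_def intro!: add_left_mono nn_integral_mono)
  finally show ?thesis by simp
qed

text \<open>A constant multiplier \<open>c\<close> yields the boundary term \<open>c\<close> and the
  Hardy coefficient \<open>(N-2) c - c^2\<close>. Here \<open>c = (N-2)/2\<close>, which maximises
  the latter.\<close>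

lemma ray_exterior_Hardy:
  assumes R: "\<And>r. r > R \<Longrightarrow> y r = 0"
  shows "ennreal ((real l + 1) / 2 * (y 1)\<^sup>2) + (\<integral>\<^sup>+r\<in>{1..}. ennreal (r ^ l * (((real l + 1) / 2)\<^sup>2 * (y r)\<^sup>2)) \<partial>lborel)
    \<le> (\<integral>\<^sup>+r\<in>{1..}. ennreal (r ^ (l + 2) * (y' r)\<^sup>2) \<partial>lborel)"
proof -
  let ?m = "(real l + 1) / 2"
  have "ennreal (1 ^ (l + 1) * ?m * (y 1)\<^sup>2) + (\<integral>\<^sup>+r\<in>{1..}. ennreal (r ^ l * (?m\<^sup>2 * (y r)\<^sup>2)) \<partial>lborel)
    \<le> (\<integral>\<^sup>+r\<in>{1..}. ennreal (r ^ (l + 2) * (y' r)\<^sup>2) \<partial>lborel)"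
  proof (rule ray_inequality_inf[OF _ y R])
    fix r :: real assume r: "r \<ge> 1"
    have "0 \<le> r ^ l * (r * y' r + ?m * y r)\<^sup>2" using r by simp
    also have "\<dots> = r ^ (l + 2) * (y' r)\<^sup>2 + r ^ l * ((real l + 1) * ?m * (y r)\<^sup>2 + 2 * r * ?m * y r * y' r) - r ^ l * (?m\<^sup>2 * (y r)\<^sup>2)"
      by (simp add: power2_eq_square field_simps)
    finally show "r ^ l * (?m\<^sup>2 * (y r)\<^sup>2) \<le> r ^ (l + 2) * (y' r)\<^sup>2 + r ^ l * ((real l + 1) * ?m * (y r)\<^sup>2 + 2 * r * ?m * y r * y' r)"
      by simp
  qed (auto intro!: continuous_intros y_continuous y'_continuous)
  then show ?thesis by simp
qed

text \<open>The other extreme, \<open>c = N-2\<close>: the Hardy coefficient vanishes and the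
  boundary term is as large as possible. The square vanishes for \<open>r^(2-N)\<close>, the
  decaying radial harmonic function.\<close>

lemma ray_exterior_sup:
  assumes R: "\<And>r. r > R \<Longrightarrow> y r = 0" and a: "a > 0"
  shows "ennreal (a ^ (l + 1) * (real l + 1) * (y a)\<^sup>2)
    \<le> (\<integral>\<^sup>+r\<in>{a..}. ennreal (r ^ (l + 2) * (y' r)\<^sup>2) \<partial>lborel)"
proof -
  let ?m = "real l + 1"
  have "ennreal (a ^ (l + 1) * ?m * (y a)\<^sup>2) + (\<integral>\<^sup>+r\<in>{a..}. ennreal 0 \<partial>lborel)
    \<le> (\<integral>\<^sup>+r\<in>{a..}. ennreal (r ^ (l + 2) * (y' r)\<^sup>2) \<partial>lborel)"
  proof (rule ray_inequality_inf[OF a y R])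
    fix r :: real assume r: "r \<ge> a"
    have "0 \<le> r ^ l * (r * y' r + ?m * y r)\<^sup>2" using r a by simp
    also have "\<dots> = r ^ (l + 2) * (y' r)\<^sup>2 + r ^ l * ((real l + 1) * ?m * (y r)\<^sup>2 + 2 * r * ?m * y r * y' r)"
      by (simp add: power2_eq_square field_simps)
    finally show "0 \<le> r ^ (l + 2) * (y' r)\<^sup>2 + r ^ l * ((real l + 1) * ?m * (y r)\<^sup>2 + 2 * r * ?m * y r * y' r)" .
  qed (use a in \<open>auto intro!: continuous_intros y_continuous y'_continuous\<close>)
  then show ?thesis by simp
qed

end

subsection \<open>Integration over the sphere\<close>

lemma pred_in_ball [measurable]: "Measurable.pred borel (\<lambda>x::'a::euclidean_space. x \<in> ball a r)"
  by (simp add: pred_def)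

lemma nn_integral_sphere_mono:
  fixes f g :: "real^'n \<Rightarrow> ennreal"
  assumes [measurable]: "f \<in> borel_measurable borel" "g \<in> borel_measurable borel"
    and le: "\<And>w. norm w = 1 \<Longrightarrow> f w \<le> g w"
  shows "(\<integral>\<^sup>+w. f w \<partial>sphere_measure) \<le> (\<integral>\<^sup>+w. g w \<partial>sphere_measure)"
proof -
  have "AE x in lborel. f (sgn x) * indicator (ball 0 1) x \<le> g (sgn x) * indicator (ball 0 1) x"
    by (rule AE_mp[OF AE_lborel_singleton[of 0]], rule AE_I2) (auto intro!: mult_right_mono le simp: norm_sgn)
  then show ?thesis
    by (simp add: nn_integral_sphere_measure mult_left_mono nn_integral_mono_AE)
qed

lemma nn_integral_sphere_cong:
  fixes f g :: "real^'n \<Rightarrow> ennreal"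
  assumes "f \<in> borel_measurable borel" "g \<in> borel_measurable borel"
    and "\<And>w. norm w = 1 \<Longrightarrow> f w = g w"
  shows "(\<integral>\<^sup>+w. f w \<partial>sphere_measure) = (\<integral>\<^sup>+w. g w \<partial>sphere_measure)"
  using assms by (intro antisym nn_integral_sphere_mono) auto

lemma nn_integral_polar_set:
  fixes g :: "real^'n \<Rightarrow> ennreal"
  assumes [measurable]: "g \<in> borel_measurable borel" "S \<in> sets borel" and S: "S \<subseteq> {0<..}" and A: "A = {x. norm x \<in> S}"
  shows "(\<integral>\<^sup>+x. g x * indicator A x \<partial>lborel) =
    (\<integral>\<^sup>+w. (\<integral>\<^sup>+r. g (r *\<^sub>R w) * ennreal (r ^ (CARD('n) - 1)) * indicator S r \<partial>lborel) \<partial>sphere_measure)"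
proof -
  have [measurable]: "Measurable.pred borel (\<lambda>x::real^'n. norm x \<in> S)"
    by measurable
  have "(\<integral>\<^sup>+x. g x * indicator A x \<partial>lborel) = (\<integral>\<^sup>+x. (if norm x \<in> S then g x else 0) \<partial>lborel)"
    by (intro nn_integral_cong) (auto simp: A)
  also have "\<dots> = (\<integral>\<^sup>+w. (\<integral>\<^sup>+r. (if norm (r *\<^sub>R w) \<in> S then g (r *\<^sub>R w) else 0) *
      ennreal (r ^ (CARD('n) - 1)) * indicator {0<..} r \<partial>lborel) \<partial>sphere_measure)"
    by (intro nn_integral_polar) measurable
  also have "\<dots> = (\<integral>\<^sup>+w. (\<integral>\<^sup>+r. g (r *\<^sub>R w) * ennreal (r ^ (CARD('n) - 1)) * indicator S r \<partial>lborel) \<partial>sphere_measure)"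
    by (rule nn_integral_sphere_cong, measurable, rule nn_integral_cong)
      (use S in \<open>auto simp: indicator_def\<close>)
  finally show ?thesis .
qed

lemma nn_integral_Ioo_Ioc:
  fixes f :: "real \<Rightarrow> ennreal"
  shows "(\<integral>\<^sup>+r\<in>{a<..<b}. f r \<partial>lborel) = (\<integral>\<^sup>+r\<in>{a<..b}. f r \<partial>lborel)"
  by (rule nn_integral_cong_AE, rule AE_mp[OF AE_lborel_singleton[of b]], rule AE_I2) (auto simp: indicator_def)

lemma ball_minus_0_polar: "ball 0 1 - {0} = {x :: real^'n. norm x \<in> {0<..<1}}"
  by (auto simp: dist_norm)

lemma ext_ball_polar: "ext_ball = {x :: real^'n. norm x \<in> {1..}}"
  by (auto simp: ext_ball_def dist_norm)

lemma nn_integral_ball_minus_0: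
  fixes g :: "real^'n \<Rightarrow> ennreal"
  shows "(\<integral>\<^sup>+x\<in>ball 0 1. g x \<partial>lborel) = (\<integral>\<^sup>+x. g x * indicator (ball 0 1 - {0}) x \<partial>lborel)"
  by (rule nn_integral_cong_AE, rule AE_mp[OF AE_lborel_singleton[of 0]], rule AE_I2) (auto simp: indicator_def)

text \<open>The density \<open>\<phi>\<^sup>2|\<nabla>(u/\<phi>)|\<^sup>2\<close> for the ground state \<open>\<phi>\<close>.\<close>

definition remainder :: "nat \<Rightarrow> nat \<Rightarrow> (real^'n \<Rightarrow> real) \<Rightarrow> (real^'n \<Rightarrow> real^'n) \<Rightarrow> real^'n \<Rightarrow> real" where
  "remainder l k u G x = (norm (G x + (HP l k (norm x) / (norm x)\<^sup>2 * u x) *\<^sub>R x))\<^sup>2"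

text \<open>With \<open>l = N - 3\<close> the radial powers \<open>r ^ l\<close> and
  \<open>r ^ (l + 2)\<close> need no truncated subtraction. The number \<open>k\<close> enters only
  definitions inside the locale, so the locale predicate takes the four arguments
  \<open>u G R l\<close>.\<close>

locale C1_compact =
  fixes u :: "real^'n \<Rightarrow> real" and G :: "real^'n \<Rightarrow> real^'n" and R :: real and l k :: nat
  assumes u: "\<And>x. (u has_derivative (\<lambda>v. G x \<bullet> v)) (at x)"
    and G: "continuous_on UNIV G"
    and R: "\<And>x. norm x > R \<Longrightarrow> u x = 0"
    and card: "CARD('n) = l + 3"
begin

lemma u_continuous: "continuous_on UNIV u"
  using u by (meson has_derivative_continuous_on has_derivative_at_withinI)

lemma measurable_u [measurable]: "u \<in> borel_measurable borel"
  by (rule borel_measurable_continuous_onI[OF u_continuous])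

lemma measurable_G [measurable]: "G \<in> borel_measurable borel"
  by (rule borel_measurable_continuous_onI[OF G])

lemma measurable_remainder [measurable]: "remainder l k u G \<in> borel_measurable borel"
  unfolding remainder_def by measurable

lemma ray_derivative: "((\<lambda>r. u (r *\<^sub>R w)) has_real_derivative G (r *\<^sub>R w) \<bullet> w) (at r)"
  unfolding has_field_derivative_def
  by (rule has_derivative_compose[OF _ u, THEN has_derivative_eq_rhs])
    (auto intro!: derivative_eq_intros simp: fun_eq_iff)

lemma ray_derivative_continuous: "continuous_on UNIV (\<lambda>r. G (r *\<^sub>R w) \<bullet> w)"
  by (intro continuous_intros continuous_on_compose2[OF G]) auto

lemma ray_support: "norm w = 1 \<Longrightarrow> r > \<bar>R\<bar> \<Longrightarrow> u (r *\<^sub>R w) = 0"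
  by (rule R) auto

text \<open>The ground state is radial, so it modifies only the radial component of the gradient;
  the tangential part is the last term.\<close>

lemma remainder_ray:
  assumes w: "norm w = 1" and r: "r > 0"
  shows "r ^ (l + 2) * remainder l k u G (r *\<^sub>R w) =
    r ^ l * (r * (G (r *\<^sub>R w) \<bullet> w) + HP l k r * u (r *\<^sub>R w))\<^sup>2 +
    r ^ (l + 2) * ((norm (G (r *\<^sub>R w)))\<^sup>2 - (G (r *\<^sub>R w) \<bullet> w)\<^sup>2)"
proof -
  define c where "c = HP l k r * u (r *\<^sub>R w) / r"
  have "(HP l k (norm (r *\<^sub>R w)) / (norm (r *\<^sub>R w))\<^sup>2 * u (r *\<^sub>R w)) *\<^sub>R r *\<^sub>R w = c *\<^sub>R w"
    using w r by (simp add: c_def power2_eq_square)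
  then have "remainder l k u G (r *\<^sub>R w) = (norm (G (r *\<^sub>R w) + c *\<^sub>R w))\<^sup>2"
    by (simp only: remainder_def)
  also have "\<dots> = (norm (G (r *\<^sub>R w)))\<^sup>2 + 2 * c * (G (r *\<^sub>R w) \<bullet> w) + c\<^sup>2 * (norm w)\<^sup>2"
    unfolding power2_norm_eq_inner
    by (simp add: inner_add_left inner_add_right inner_commute power2_eq_square)
  also have "r ^ (l + 2) * \<dots> = r ^ l * (r * (G (r *\<^sub>R w) \<bullet> w) + r * c)\<^sup>2 +
    r ^ (l + 2) * ((norm (G (r *\<^sub>R w)))\<^sup>2 - (G (r *\<^sub>R w) \<bullet> w)\<^sup>2)"
    by (simp add: w power2_eq_square algebra_simps)
  also have "r * c = HP l k r * u (r *\<^sub>R w)"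
    using r by (simp add: c_def)
  finally show ?thesis .
qed

lemma radial_le: "norm w = 1 \<Longrightarrow> (G x \<bullet> w)\<^sup>2 \<le> (norm (G x))\<^sup>2"
  using Cauchy_Schwarz_ineq2[of "G x" w] by (intro power2_le_iff_abs_le[THEN iffD2]) auto

lemma radial_le_remainder:
  assumes w: "norm w = 1" and r: "r > 0"
  shows "r ^ l * (r * (G (r *\<^sub>R w) \<bullet> w) + HP l k r * u (r *\<^sub>R w))\<^sup>2 \<le> remainder l k u G (r *\<^sub>R w) * r ^ (l + 2)"
  using remainder_ray[OF w r] radial_le[OF w, of "r *\<^sub>R w"] r by (simp add: mult.commute)

definition bdry :: ennreal where "bdry = (\<integral>\<^sup>+w. ennreal ((u w)\<^sup>2) \<partial>sphere_measure)"
definition D_int :: ennreal where "D_int = (\<integral>\<^sup>+x\<in>ball 0 1. ennreal (remainder l k u G x) \<partial>lborel)"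
definition D_ext :: ennreal where "D_ext = (\<integral>\<^sup>+x\<in>ext_ball. ennreal ((norm (G x))\<^sup>2) \<partial>lborel)"

section \<open>The ray inequalities integrated over the sphere\<close>

lemma nn_integral_ball_polar:
  assumes [measurable]: "g \<in> borel_measurable borel"
  shows "(\<integral>\<^sup>+x\<in>ball 0 1. g x \<partial>lborel) =
    (\<integral>\<^sup>+w. (\<integral>\<^sup>+r\<in>{0<..1}. g (r *\<^sub>R w) * ennreal (r ^ (l + 2)) \<partial>lborel) \<partial>(sphere_measure :: (real^'n) measure))"
  unfolding nn_integral_ball_minus_0
  by (subst nn_integral_polar_set[where S="{0<..<1}"])
    (auto simp: ball_minus_0_polar card nn_integral_Ioo_Ioc)

lemma nn_integral_ext_polar:
  assumes [measurable]: "g \<in> borel_measurable borel"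
  shows "(\<integral>\<^sup>+x\<in>ext_ball. g x \<partial>lborel) =
    (\<integral>\<^sup>+w. (\<integral>\<^sup>+r\<in>{1..}. g (r *\<^sub>R w) * ennreal (r ^ (l + 2)) \<partial>lborel) \<partial>(sphere_measure :: (real^'n) measure))"
  by (subst nn_integral_polar_set[where S="{1..}"]) (auto simp: ext_ball_polar card)

lemma ball_ground_state:
  "(\<integral>\<^sup>+x\<in>ball 0 1. ennreal (Vrad l k (norm x) / (norm x)\<^sup>2 * (u x)\<^sup>2) \<partial>lborel) + D_int
   \<le> ennreal ((real l + 1 + real k) / 2) * bdry + (\<integral>\<^sup>+x\<in>ball 0 1. ennreal ((norm (G x))\<^sup>2) \<partial>lborel)"
proof -
  have [measurable]: "Vrad l k \<in> borel_measurable borel" unfolding Vrad_def by measurable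
  let ?V = "\<lambda>x. ennreal (Vrad l k (norm x) / (norm x)\<^sup>2 * (u x)\<^sup>2)"
  let ?g = "\<lambda>x. ?V x + ennreal (remainder l k u G x)"
  let ?h = "\<lambda>x. ennreal ((norm (G x))\<^sup>2)"
  let ?k = "(real l + 1 + real k) / 2"
  have V: "0 \<le> Vrad l k r" for r by (simp add: Vrad_def sum_nonneg)
  have "(\<integral>\<^sup>+x\<in>ball 0 1. ?V x \<partial>lborel) + D_int =
      (\<integral>\<^sup>+x. ?V x * indicator (ball 0 1) x + ennreal (remainder l k u G x) * indicator (ball 0 1) x \<partial>lborel)"
    unfolding D_int_def by (rule nn_integral_add[symmetric]) measurable
  also have "\<dots> = (\<integral>\<^sup>+x\<in>ball 0 1. ?g x \<partial>lborel)"
    by (simp only: distrib_right)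
  also have "\<dots> = (\<integral>\<^sup>+w. (\<integral>\<^sup>+r\<in>{0<..1}. ?g (r *\<^sub>R w) * ennreal (r ^ (l + 2)) \<partial>lborel) \<partial>sphere_measure)"
    by (rule nn_integral_ball_polar) measurable
  also have "\<dots> \<le> (\<integral>\<^sup>+w. ennreal ?k * ennreal ((u w)\<^sup>2) + (\<integral>\<^sup>+r\<in>{0<..1}. ?h (r *\<^sub>R w) * ennreal (r ^ (l + 2)) \<partial>lborel) \<partial>sphere_measure)"
  proof (rule nn_integral_sphere_mono)
    fix w :: "real^'n" assume w: "norm w = 1"
    \<comment> \<open>The tangential energy occurs unchanged on both sides; only the radial part
      \<open>?a\<close> is subjected to the ray inequality.\<close>
    let ?T = "\<lambda>r. ennreal (r ^ (l + 2) * ((norm (G (r *\<^sub>R w)))\<^sup>2 - (G (r *\<^sub>R w) \<bullet> w)\<^sup>2)) * indicator {0<..1} r"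
    let ?a = "\<lambda>r. ennreal (r ^ l * Vrad l k r * (u (r *\<^sub>R w))\<^sup>2 + r ^ l * (r * (G (r *\<^sub>R w) \<bullet> w) + HP l k r * u (r *\<^sub>R w))\<^sup>2) * indicator {0<..1} r"
    let ?b = "\<lambda>r. ennreal (r ^ (l + 2) * (G (r *\<^sub>R w) \<bullet> w)\<^sup>2) * indicator {0<..1} r"
    have "(\<integral>\<^sup>+r\<in>{0<..1}. ?g (r *\<^sub>R w) * ennreal (r ^ (l + 2)) \<partial>lborel) = (\<integral>\<^sup>+r. ?a r + ?T r \<partial>lborel)"
    proof (intro nn_integral_cong)
      fix r :: real
      show "?g (r *\<^sub>R w) * ennreal (r ^ (l + 2)) * indicator {0<..1} r = ?a r + ?T r"
      proof (cases "r \<in> {0<..1}")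
        case True
        then have r: "r > 0" by simp
        let ?v = "Vrad l k (norm (r *\<^sub>R w)) / (norm (r *\<^sub>R w))\<^sup>2 * (u (r *\<^sub>R w))\<^sup>2" and ?e = "remainder l k u G (r *\<^sub>R w)"
        have nn: "0 \<le> ?e" by (simp add: remainder_def)
        have "?v * r ^ (l + 2) = r ^ l * Vrad l k r * (u (r *\<^sub>R w))\<^sup>2"
          using r w by (simp add: power2_eq_square)
        then have "(?v + ?e) * r ^ (l + 2) =
           r ^ l * Vrad l k r * (u (r *\<^sub>R w))\<^sup>2 + r ^ l * (r * (G (r *\<^sub>R w) \<bullet> w) + HP l k r * u (r *\<^sub>R w))\<^sup>2
           + r ^ (l + 2) * ((norm (G (r *\<^sub>R w)))\<^sup>2 - (G (r *\<^sub>R w) \<bullet> w)\<^sup>2)"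
          using remainder_ray[OF w r] by (simp only: distrib_right mult.commute[of "?e" "r ^ (l + 2)"] add.assoc)
        moreover have "?g (r *\<^sub>R w) * ennreal (r ^ (l + 2)) =
          ennreal ((?v + ?e) * r ^ (l + 2))"
          using r nn V by (simp only: ennreal_mult'' ennreal_plus zero_le_power less_imp_le
              mult_nonneg_nonneg divide_nonneg_nonneg zero_le_power2 add_nonneg_nonneg)
        ultimately show ?thesis
          using True r V[of r] radial_le[OF w, of "r *\<^sub>R w"] by (simp add: ennreal_plus)
      qed simp
    qed
    also have "\<dots> = (\<integral>\<^sup>+r. ?a r \<partial>lborel) + (\<integral>\<^sup>+r. ?T r \<partial>lborel)"
      by (intro nn_integral_add) measurable
    also have "\<dots> \<le> (ennreal (?k * (u (1 *\<^sub>R w))\<^sup>2) + (\<integral>\<^sup>+r. ?b r \<partial>lborel)) + (\<integral>\<^sup>+r. ?T r \<partial>lborel)"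
      by (intro add_right_mono ray_ground_state[OF ray_derivative ray_derivative_continuous])
    also have "\<dots> = ennreal (?k * (u w)\<^sup>2) + ((\<integral>\<^sup>+r. ?b r \<partial>lborel) + (\<integral>\<^sup>+r. ?T r \<partial>lborel))"
      by (simp add: add.assoc)
    also have "(\<integral>\<^sup>+r. ?b r \<partial>lborel) + (\<integral>\<^sup>+r. ?T r \<partial>lborel) = (\<integral>\<^sup>+r. ?b r + ?T r \<partial>lborel)"
      by (intro nn_integral_add[symmetric]) measurable
    also have "\<dots> = (\<integral>\<^sup>+r\<in>{0<..1}. ?h (r *\<^sub>R w) * ennreal (r ^ (l + 2)) \<partial>lborel)"
      using radial_le[OF w]
      by (intro nn_integral_cong)
        (auto simp: indicator_def algebra_simps simp flip: ennreal_plus ennreal_mult'')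
    also have "ennreal (?k * (u w)\<^sup>2) = ennreal ?k * ennreal ((u w)\<^sup>2)"
      by (intro ennreal_mult) auto
    finally show "(\<integral>\<^sup>+r\<in>{0<..1}. ?g (r *\<^sub>R w) * ennreal (r ^ (l + 2)) \<partial>lborel)
       \<le> ennreal ?k * ennreal ((u w)\<^sup>2) + (\<integral>\<^sup>+r\<in>{0<..1}. ?h (r *\<^sub>R w) * ennreal (r ^ (l + 2)) \<partial>lborel)" .
  qed measurable
  also have "\<dots> = (\<integral>\<^sup>+w. ennreal ?k * ennreal ((u w)\<^sup>2) \<partial>sphere_measure) + (\<integral>\<^sup>+w. (\<integral>\<^sup>+r\<in>{0<..1}. ?h (r *\<^sub>R w) * ennreal (r ^ (l + 2)) \<partial>lborel) \<partial>sphere_measure)"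
    by (intro nn_integral_add) measurable
  also have "(\<integral>\<^sup>+w. ennreal ?k * ennreal ((u w)\<^sup>2) \<partial>sphere_measure) = ennreal ?k * bdry"
    unfolding bdry_def by (intro nn_integral_cmult) measurable
  also have "(\<integral>\<^sup>+w. (\<integral>\<^sup>+r\<in>{0<..1}. ?h (r *\<^sub>R w) * ennreal (r ^ (l + 2)) \<partial>lborel) \<partial>sphere_measure)
     = (\<integral>\<^sup>+x\<in>ball 0 1. ?h x \<partial>lborel)"
    by (rule nn_integral_ball_polar[symmetric]) measurable
  finally show ?thesis .
qed

lemma remainder_ray_integral:
  assumes w: "norm w = 1"
  shows "(\<integral>\<^sup>+r\<in>{0<..1}. ennreal (r ^ l * (r * (G (r *\<^sub>R w) \<bullet> w) + HP l k r * u (r *\<^sub>R w))\<^sup>2) \<partial>lborel)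
    \<le> (\<integral>\<^sup>+r\<in>{0<..1}. ennreal (remainder l k u G (r *\<^sub>R w)) * ennreal (r ^ (l + 2)) \<partial>lborel)"
  using radial_le_remainder[OF w]
  by (intro nn_integral_mono) (auto simp: indicator_def simp flip: ennreal_mult'' intro!: ennreal_leI)

lemma ball_Hardy:
  "(\<integral>\<^sup>+x\<in>ball 0 1. ennreal ((XP (Suc k) (norm x))\<^sup>2 * (u x)\<^sup>2 / (norm x)\<^sup>2) \<partial>lborel) \<le> 2 * bdry + 4 * D_int"
proof -
  let ?g = "\<lambda>x. ennreal ((XP (Suc k) (norm x))\<^sup>2 * (u x)\<^sup>2 / (norm x)\<^sup>2)"
  let ?h = "\<lambda>w. \<integral>\<^sup>+r\<in>{0<..1}. ennreal (remainder l k u G (r *\<^sub>R w)) * ennreal (r ^ (l + 2)) \<partial>lborel"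
  have "(\<integral>\<^sup>+x\<in>ball 0 1. ?g x \<partial>lborel) =
    (\<integral>\<^sup>+w. (\<integral>\<^sup>+r\<in>{0<..1}. ?g (r *\<^sub>R w) * ennreal (r ^ (l + 2)) \<partial>lborel) \<partial>sphere_measure)"
    by (rule nn_integral_ball_polar) measurable
  also have "\<dots> \<le> (\<integral>\<^sup>+w. 2 * ennreal ((u w)\<^sup>2) + 4 * ?h w \<partial>sphere_measure)"
  proof (rule nn_integral_sphere_mono)
    fix w :: "real^'n" assume w: "norm w = 1"
    have "(\<integral>\<^sup>+r\<in>{0<..1}. ?g (r *\<^sub>R w) * ennreal (r ^ (l + 2)) \<partial>lborel)
      = (\<integral>\<^sup>+r. 4 * (ennreal (r ^ l * (XP (Suc k) r)\<^sup>2 * (u (r *\<^sub>R w))\<^sup>2 / 4) * indicator {0<..1} r) \<partial>lborel)"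
    proof (intro nn_integral_cong)
      fix r :: real
      have "?g (r *\<^sub>R w) * ennreal (r ^ (l + 2)) = 4 * ennreal (r ^ l * (XP (Suc k) r)\<^sup>2 * (u (r *\<^sub>R w))\<^sup>2 / 4)" if "r > 0"
      proof -
        have "?g (r *\<^sub>R w) * ennreal (r ^ (l + 2)) = ennreal ((XP (Suc k) r)\<^sup>2 * (u (r *\<^sub>R w))\<^sup>2 / r\<^sup>2 * r ^ (l + 2))"
          using that w by (subst ennreal_mult) auto
        also have "(XP (Suc k) r)\<^sup>2 * (u (r *\<^sub>R w))\<^sup>2 / r\<^sup>2 * r ^ (l + 2) = 4 * (r ^ l * (XP (Suc k) r)\<^sup>2 * (u (r *\<^sub>R w))\<^sup>2 / 4)"
          using that by (simp add: power2_eq_square)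
        also have "ennreal \<dots> = 4 * ennreal (r ^ l * (XP (Suc k) r)\<^sup>2 * (u (r *\<^sub>R w))\<^sup>2 / 4)"
          using that by (subst ennreal_mult) auto
        finally show ?thesis .
      qed
      then show "?g (r *\<^sub>R w) * ennreal (r ^ (l + 2)) * indicator {0<..1} r = 4 * (ennreal (r ^ l * (XP (Suc k) r)\<^sup>2 * (u (r *\<^sub>R w))\<^sup>2 / 4) * indicator {0<..1} r)"
        by (auto simp: indicator_def)
    qed
    also have "\<dots> = 4 * (\<integral>\<^sup>+r\<in>{0<..1}. ennreal (r ^ l * (XP (Suc k) r)\<^sup>2 * (u (r *\<^sub>R w))\<^sup>2 / 4) \<partial>lborel)"
      by (intro nn_integral_cmult) measurable
    also have "\<dots> \<le> 4 * (ennreal ((u (1 *\<^sub>R w))\<^sup>2 / 2) + ?h w)"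
      using order_trans[OF ray_Hardy[OF ray_derivative ray_derivative_continuous, of l k w] add_left_mono[OF remainder_ray_integral[OF w]]]
      by (intro mult_left_mono) auto
    also have "\<dots> = 2 * ennreal ((u w)\<^sup>2) + 4 * ?h w"
    proof -
      have "4 * ennreal ((u w)\<^sup>2 / 2) = ennreal (4 * ((u w)\<^sup>2 / 2))" by (subst ennreal_mult) auto
      also have "\<dots> = ennreal (2 * (u w)\<^sup>2)" by simp
      also have "\<dots> = 2 * ennreal ((u w)\<^sup>2)" by (subst ennreal_mult) auto
      finally show ?thesis by (simp add: distrib_left)
    qed
    finally show "(\<integral>\<^sup>+r\<in>{0<..1}. ?g (r *\<^sub>R w) * ennreal (r ^ (l + 2)) \<partial>lborel) \<le> 2 * ennreal ((u w)\<^sup>2) + 4 * ?h w" .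
  qed measurable
  also have "\<dots> = 2 * bdry + 4 * (\<integral>\<^sup>+w. ?h w \<partial>sphere_measure)"
    unfolding bdry_def by (simp add: nn_integral_add nn_integral_cmult)
  also have "(\<integral>\<^sup>+w. ?h w \<partial>sphere_measure) = D_int"
    unfolding D_int_def by (rule nn_integral_ball_polar[symmetric]) measurable
  finally show ?thesis .
qed

lemma sphere_sup_interior:
  assumes a: "0 < a" "a \<le> 1"
  shows "(\<integral>\<^sup>+w. ennreal (a ^ (l + 1) * XP (Suc k) a * (u (a *\<^sub>R w))\<^sup>2) \<partial>sphere_measure) \<le> bdry + D_int"
proof -
  let ?h = "\<lambda>w. \<integral>\<^sup>+r\<in>{0<..1}. ennreal (remainder l k u G (r *\<^sub>R w)) * ennreal (r ^ (l + 2)) \<partial>lborel"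
  have "(\<integral>\<^sup>+w. ennreal (a ^ (l + 1) * XP (Suc k) a * (u (a *\<^sub>R w))\<^sup>2) \<partial>sphere_measure)
    \<le> (\<integral>\<^sup>+w. ennreal ((u w)\<^sup>2) + ?h w \<partial>sphere_measure)"
  proof (rule nn_integral_sphere_mono)
    fix w :: "real^'n" assume w: "norm w = 1"
    show "ennreal (a ^ (l + 1) * XP (Suc k) a * (u (a *\<^sub>R w))\<^sup>2) \<le> ennreal ((u w)\<^sup>2) + ?h w"
      using order_trans[OF ray_sup[OF ray_derivative ray_derivative_continuous a, of l k w] add_left_mono[OF remainder_ray_integral[OF w]]]
      by simp
  qed measurable
  also have "\<dots> = bdry + (\<integral>\<^sup>+w. ?h w \<partial>sphere_measure)"
    unfolding bdry_def by (intro nn_integral_add) measurable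
  also have "(\<integral>\<^sup>+w. ?h w \<partial>sphere_measure) = D_int"
    unfolding D_int_def by (rule nn_integral_ball_polar[symmetric]) measurable
  finally show ?thesis .
qed

lemma D_ext_polar:
  "(\<integral>\<^sup>+w. (\<integral>\<^sup>+r\<in>{1..}. ennreal ((norm (G (r *\<^sub>R w)))\<^sup>2) * ennreal (r ^ (l + 2)) \<partial>lborel) \<partial>sphere_measure) = D_ext"
  unfolding D_ext_def by (rule nn_integral_ext_polar[symmetric]) measurable

lemma radial_ray_integral:
  assumes w: "norm w = 1" and a: "a \<ge> 1"
  shows "(\<integral>\<^sup>+r\<in>{a..}. ennreal (r ^ (l + 2) * (G (r *\<^sub>R w) \<bullet> w)\<^sup>2) \<partial>lborel)
    \<le> (\<integral>\<^sup>+r\<in>{1..}. ennreal ((norm (G (r *\<^sub>R w)))\<^sup>2) * ennreal (r ^ (l + 2)) \<partial>lborel)"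
proof (intro nn_integral_mono)
  fix r :: real
  have "r ^ (l + 2) * (G (r *\<^sub>R w) \<bullet> w)\<^sup>2 \<le> (norm (G (r *\<^sub>R w)))\<^sup>2 * r ^ (l + 2)" if "r \<ge> 1"
    using that radial_le[OF w, of "r *\<^sub>R w"] by (subst mult.commute) (intro mult_right_mono, auto)
  then show "ennreal (r ^ (l + 2) * (G (r *\<^sub>R w) \<bullet> w)\<^sup>2) * indicator {a..} r
      \<le> ennreal ((norm (G (r *\<^sub>R w)))\<^sup>2) * ennreal (r ^ (l + 2)) * indicator {1..} r"
    using a by (auto simp: indicator_def simp flip: ennreal_mult'' intro!: ennreal_leI)
qed

lemma ext_Hardy:
  "ennreal ((real l + 1) / 2) * bdry + ennreal (((real l + 1) / 2)\<^sup>2) *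
    (\<integral>\<^sup>+x\<in>ext_ball. ennreal ((u x)\<^sup>2 / (norm x)\<^sup>2) \<partial>lborel) \<le> D_ext"
proof -
  let ?m = "(real l + 1) / 2"
  let ?g = "\<lambda>x. ennreal ((u x)\<^sup>2 / (norm x)\<^sup>2)"
  let ?i = "\<lambda>w. \<integral>\<^sup>+r\<in>{1..}. ?g (r *\<^sub>R w) * ennreal (r ^ (l + 2)) \<partial>lborel"
  let ?h = "\<lambda>w. \<integral>\<^sup>+r\<in>{1..}. ennreal ((norm (G (r *\<^sub>R w)))\<^sup>2) * ennreal (r ^ (l + 2)) \<partial>lborel"
  have "ennreal ?m * bdry + ennreal (?m\<^sup>2) * (\<integral>\<^sup>+x\<in>ext_ball. ?g x \<partial>lborel)
     = (\<integral>\<^sup>+w. ennreal ?m * ennreal ((u w)\<^sup>2) + ennreal (?m\<^sup>2) * ?i w \<partial>sphere_measure)"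
    unfolding bdry_def by (subst nn_integral_ext_polar) (simp_all add: nn_integral_add nn_integral_cmult)
  also have "\<dots> \<le> (\<integral>\<^sup>+w. ?h w \<partial>sphere_measure)"
  proof (rule nn_integral_sphere_mono)
    fix w :: "real^'n" assume w: "norm w = 1"
    have "ennreal (?m\<^sup>2) * ?i w = (\<integral>\<^sup>+r. ennreal (?m\<^sup>2) * (?g (r *\<^sub>R w) * ennreal (r ^ (l + 2)) * indicator {1..} r) \<partial>lborel)"
      by (intro nn_integral_cmult[symmetric]) measurable
    also have "\<dots> = (\<integral>\<^sup>+r\<in>{1..}. ennreal (r ^ l * (?m\<^sup>2 * (u (r *\<^sub>R w))\<^sup>2)) \<partial>lborel)"
    proof (intro nn_integral_cong)
      fix r :: real
      have "ennreal (?m\<^sup>2) * (?g (r *\<^sub>R w) * ennreal (r ^ (l + 2))) = ennreal (r ^ l * (?m\<^sup>2 * (u (r *\<^sub>R w))\<^sup>2))" if "r \<ge> 1"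
      proof -
        have "ennreal (?m\<^sup>2) * (?g (r *\<^sub>R w) * ennreal (r ^ (l + 2))) = ennreal (?m\<^sup>2 * ((u (r *\<^sub>R w))\<^sup>2 / r\<^sup>2 * r ^ (l + 2)))"
          using that w
          by (subst ennreal_mult[symmetric], simp, simp, subst ennreal_mult[symmetric], simp, simp, simp)
        also have "?m\<^sup>2 * ((u (r *\<^sub>R w))\<^sup>2 / r\<^sup>2 * r ^ (l + 2)) = r ^ l * (?m\<^sup>2 * (u (r *\<^sub>R w))\<^sup>2)"
          using that by (simp add: power2_eq_square)
        finally show ?thesis .
      qed
      then show "ennreal (?m\<^sup>2) * (?g (r *\<^sub>R w) * ennreal (r ^ (l + 2)) * indicator {1..} r) = ennreal (r ^ l * (?m\<^sup>2 * (u (r *\<^sub>R w))\<^sup>2)) * indicator {1..} r"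
        by (auto simp: indicator_def)
    qed
    finally have i: "ennreal (?m\<^sup>2) * ?i w = (\<integral>\<^sup>+r\<in>{1..}. ennreal (r ^ l * (?m\<^sup>2 * (u (r *\<^sub>R w))\<^sup>2)) \<partial>lborel)" .
    have "ennreal ?m * ennreal ((u w)\<^sup>2) = ennreal (?m * (u (1 *\<^sub>R w))\<^sup>2)"
      by (subst ennreal_mult) auto
    then show "ennreal ?m * ennreal ((u w)\<^sup>2) + ennreal (?m\<^sup>2) * ?i w \<le> ?h w"
      unfolding i using order_trans[OF ray_exterior_Hardy[OF ray_derivative ray_derivative_continuous ray_support[OF w], where l=l] radial_ray_integral[OF w order_refl]]
      by simp
  qed measurable
  finally show ?thesis by (simp only: D_ext_polar)
qed

lemma sphere_sup_exterior:
  assumes a: "1 \<le> a"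
  shows "(\<integral>\<^sup>+w. ennreal (a ^ (l + 1) * (real l + 1) * (u (a *\<^sub>R w))\<^sup>2) \<partial>sphere_measure) \<le> D_ext"
  unfolding D_ext_polar[symmetric]
proof (rule nn_integral_sphere_mono)
  fix w :: "real^'n" assume w: "norm w = 1"
  have a0: "a > 0" using a by simp
  show "ennreal (a ^ (l + 1) * (real l + 1) * (u (a *\<^sub>R w))\<^sup>2) \<le>
      (\<integral>\<^sup>+r\<in>{1..}. ennreal ((norm (G (r *\<^sub>R w)))\<^sup>2) * ennreal (r ^ (l + 2)) \<partial>lborel)"
    by (rule order_trans[OF ray_exterior_sup[OF ray_derivative ray_derivative_continuous ray_support[OF w] a0] radial_ray_integral[OF w a]])
qed measurable

text \<open>Radius 1 in the exterior estimate: a trace inequality with constant \<open>N-2\<close>,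
  which is larger than \<open>(N-2+k)/2\<close> for \<open>k < N-2\<close>.\<close>

lemma bdry_le: "ennreal (real l + 1) * bdry \<le> D_ext"
proof -
  have "ennreal (real l + 1) * bdry = (\<integral>\<^sup>+w. ennreal (1 ^ (l + 1) * (real l + 1) * (u (1 *\<^sub>R w))\<^sup>2) \<partial>sphere_measure)"
    unfolding bdry_def by (subst nn_integral_cmult[symmetric]) (auto simp: ennreal_mult)
  then show ?thesis using sphere_sup_exterior[of 1] by simp
qed

end

subsection \<open>Localised Sobolev inequality\<close>

text \<open>Evaluated at \<open>|x|\<^sup>2/s\<^sup>2\<close>, this is supported in \<open>s/2 \<le> |x| \<le> 4s\<close> and at least \<open>1\<close> for
  \<open>s \<le> |x| \<le> 2s\<close>; squaring the positive part makes it continuously differentiable.\<close>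

definition cutoff :: "real \<Rightarrow> real" where
  "cutoff t = (max 0 ((t - 1 / 4) * (16 - t)))\<^sup>2"

definition cutoff' :: "real \<Rightarrow> real" where
  "cutoff' t = 2 * max 0 ((t - 1 / 4) * (16 - t)) * (65 / 4 - 2 * t)"

lemma has_real_derivative_max_0_sq:
  "((\<lambda>x::real. (max 0 x)\<^sup>2) has_real_derivative 2 * max 0 x) (at x)"
proof -
  consider "x > 0" | "x < 0" | "x = 0" by linarith
  then show ?thesis
  proof cases
    case 1
    have "((\<lambda>x. x\<^sup>2) has_real_derivative 2 * max 0 x) (at x)"
      using 1 by (auto intro!: derivative_eq_intros)
    then show ?thesis
      by (rule has_field_derivative_transform_within_open[where S="{0<..}"]) (use 1 in auto)
  next
    case 2
    have "((\<lambda>x. 0) has_real_derivative 2 * max 0 x) (at x)"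
      using 2 by (auto intro!: derivative_eq_intros)
    then show ?thesis
      by (rule has_field_derivative_transform_within_open[where S="{..<0}"]) (use 2 in auto)
  next
    case 3
    have "((\<lambda>h::real. max 0 h) \<longlongrightarrow> max 0 0) (at 0)"
      by (intro tendsto_intros)
    then have "((\<lambda>h::real. max 0 h) \<longlongrightarrow> 0) (at 0)" by simp
    then have "((\<lambda>h::real. (max 0 h)\<^sup>2 / h) \<longlongrightarrow> 0) (at 0)"
      by (rule Lim_transform_eventually)
        (auto simp: eventually_at_filter max_def power2_eq_square)
    then show ?thesis using 3 by (simp add: DERIV_def)
  qed
qed

lemma cutoff_has_derivative: "(cutoff has_real_derivative cutoff' t) (at t)"
  unfolding cutoff_def[abs_def] cutoff'_def
  by (rule DERIV_cong[OF DERIV_chain2[OF has_real_derivative_max_0_sq]])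
    (auto intro!: derivative_eq_intros simp: algebra_simps)

lemma cutoff'_continuous: "continuous_on UNIV cutoff'"
  unfolding cutoff'_def[abs_def] by (intro continuous_intros)

lemma cutoff_ge_1: "1 \<le> t \<Longrightarrow> t \<le> 4 \<Longrightarrow> 1 \<le> cutoff t"
proof -
  assume t: "1 \<le> t" "t \<le> 4"
  have "1 * 1 \<le> (t - 1 / 4) * (16 - t) * 4"
    using t mult_mono[of "3/4" "t - 1/4" 12 "16 - t"] by auto
  then have "1 \<le> max 0 ((t - 1 / 4) * (16 - t))"
    using t mult_mono[of "3/4" "t - 1/4" 12 "16 - t"] by auto
  then show "1 \<le> cutoff t" unfolding cutoff_def by (rule one_le_power)
qed

lemma cutoff_outside:
  assumes "t < 1 / 4 \<or> t > 16"
  shows "cutoff t = 0" "cutoff' t = 0"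
proof -
  have "(t - 1 / 4) * (16 - t) \<le> 0"
    using assms by (auto intro: mult_nonpos_nonneg mult_nonneg_nonpos)
  then show "cutoff t = 0" "cutoff' t = 0" by (simp_all add: cutoff_def cutoff'_def)
qed

lemma cutoff_bounds:
  "0 \<le> cutoff t" "cutoff t \<le> 2 ^ 16" "\<bar>cutoff' t\<bar> \<le> 2 ^ 13"
proof -
  show "0 \<le> cutoff t" by (simp add: cutoff_def)
  show "cutoff t \<le> 2 ^ 16" "\<bar>cutoff' t\<bar> \<le> 2 ^ 13"
  proof (atomize (full), cases "t < 1 / 4 \<or> t > 16")
    case True
    then show "cutoff t \<le> 2 ^ 16 \<and> \<bar>cutoff' t\<bar> \<le> 2 ^ 13" by (simp add: cutoff_outside)
  next
    case False
    then have t: "1 / 4 \<le> t" "t \<le> 16" by auto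
    have P: "0 \<le> (t - 1 / 4) * (16 - t)" "(t - 1 / 4) * (16 - t) \<le> 2 ^ 8"
      using t mult_mono[of "t - 1/4" 16 "16 - t" 16] by auto
    have "((t - 1 / 4) * (16 - t))\<^sup>2 \<le> (2 ^ 8)\<^sup>2" using P by (intro power_mono) auto
    moreover have "\<bar>2 * ((t - 1 / 4) * (16 - t)) * (65 / 4 - 2 * t)\<bar> \<le> 2 * 2 ^ 8 * 2 ^ 4"
      unfolding abs_mult using P t by (intro mult_mono) auto
    ultimately show "cutoff t \<le> 2 ^ 16 \<and> \<bar>cutoff' t\<bar> \<le> 2 ^ 13"
      using P by (simp add: cutoff_def cutoff'_def)
  qed
qed

definition sob_exp :: "nat \<Rightarrow> real" where "sob_exp l = 2 * (real l + 3) / (real l + 1)"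
text \<open>The square of the factor \<open>q\<close> in \<open>Sobolev_inequality\<close>, times
  the factor \<open>2 ^ 37\<close> by which multiplication with the cutoff can enlarge the
  energy.\<close>

definition sob_const :: "nat \<Rightarrow> real" where "sob_const l = (2 * (real l + 2) / (real l + 1))\<^sup>2 * 2 ^ 37"

context C1_compact
begin

definition energy :: "real \<Rightarrow> ennreal" where
  "energy s = (\<integral>\<^sup>+x\<in>{x. s / 2 \<le> norm x \<and> norm x \<le> 4 * s}. ennreal ((norm (G x))\<^sup>2 + (u x)\<^sup>2 / (norm x)\<^sup>2) \<partial>lborel)"

text \<open>The Sobolev inequality is applied to the cutoff times \<open>u\<close>. The gradient of
  the cutoff is at most a constant over \<open>|x|\<close>, which is why \<open>energy\<close>
  contains \<open>u^2/|x|^2\<close> and why the constant is the same at every scale.\<close>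

lemma local_Sobolev:
  assumes s: "s > 0" and e: "energy s \<le> ennreal e" "e \<ge> 0"
  shows "(\<integral>\<^sup>+x\<in>{x. s \<le> norm x \<and> norm x \<le> 2 * s}. ennreal (\<bar>u x\<bar> powr sob_exp l) \<partial>lborel)
    \<le> ennreal ((sob_const l * e) powr (sob_exp l / 2))"
proof -
  let ?t = "\<lambda>x::real^'n. (x \<bullet> x) / s\<^sup>2"
  let ?A = "{x::real^'n. s / 2 \<le> norm x \<and> norm x \<le> 4 * s}"
  define h where "h x = cutoff (?t x) * u x" for x
  define K where "K x = (cutoff' (?t x) * (2 / s\<^sup>2)) *\<^sub>R x" for x :: "real^'n"
  define Dh where "Dh x = cutoff (?t x) *\<^sub>R G x + u x *\<^sub>R K x" for x
  have [measurable]: "Measurable.pred borel (\<lambda>x::real^'n. s / 2 \<le> norm x \<and> norm x \<le> 4 * s)"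
    by measurable
  have cutoff_cont: "continuous_on UNIV cutoff"
    using DERIV_isCont[OF cutoff_has_derivative] by (intro continuous_at_imp_continuous_on) blast
  have der: "(h has_derivative (\<lambda>v. Dh x \<bullet> v)) (at x)" for x
  proof -
    have 1: "(?t has_derivative (\<lambda>v. 2 / s\<^sup>2 * (x \<bullet> v))) (at x)"
      using s by (auto intro!: derivative_eq_intros simp: fun_eq_iff inner_commute power4_eq_xxxx power2_eq_square)
    have 2: "((\<lambda>x. cutoff (?t x)) has_derivative (\<lambda>v. K x \<bullet> v)) (at x)"
      by (rule has_derivative_compose[OF 1 cutoff_has_derivative[unfolded has_field_derivative_def], THEN has_derivative_eq_rhs])
        (simp add: K_def fun_eq_iff)
    show ?thesis
      unfolding h_def[abs_def]
      by (rule has_derivative_mult[OF 2 u, THEN has_derivative_eq_rhs])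
        (simp add: Dh_def fun_eq_iff inner_add_left algebra_simps)
  qed
  have cont: "continuous_on UNIV Dh"
    unfolding Dh_def K_def
    by (intro continuous_intros G u_continuous continuous_on_compose2[OF cutoff_cont] continuous_on_compose2[OF cutoff'_continuous])
      (use s in auto)
  have supp: "h x = 0" if "norm x > R" for x
    using R[OF that] by (simp add: h_def)
  have outside: "cutoff (?t x) = 0 \<and> cutoff' (?t x) = 0" if "x \<notin> ?A" for x
  proof -
    have "norm x < s / 2 \<or> norm x > 4 * s" using that by auto
    then have "(norm x)\<^sup>2 < (s / 2)\<^sup>2 \<or> (norm x)\<^sup>2 > (4 * s)\<^sup>2"
      using s power_strict_mono[of "norm x" "s / 2" 2] power_strict_mono[of "4 * s" "norm x" 2] by auto
    then have "?t x < 1 / 4 \<or> ?t x > 16"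
      using s by (auto simp: power2_norm_eq_inner[symmetric] field_simps power2_eq_square)
    then show ?thesis by (simp add: cutoff_outside)
  qed
  have Dh_le: "(norm (Dh x))\<^sup>2 \<le> 2 ^ 37 * ((norm (G x))\<^sup>2 + (u x)\<^sup>2 / (norm x)\<^sup>2) * indicator ?A x" for x
  proof (cases "x \<in> ?A")
    case False
    then show ?thesis using outside[OF False] by (simp add: Dh_def K_def)
  next
    case True
    then have n: "norm x > 0" "norm x \<le> 4 * s" using s by auto
    have "norm (K x) \<le> 2 ^ 13 * (2 / s\<^sup>2) * norm x"
      unfolding K_def norm_scaleR abs_mult using cutoff_bounds(3)
      by (intro mult_mono) auto
    \<comment> \<open>On the support \<open>|x| \<le> 4s\<close>, hence
      \<open>|x|/s^2 \<le> 16/|x|\<close>, and \<open>2^13 * 2 * 16 = 2^18\<close>.\<close>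
    also have "\<dots> \<le> 2 ^ 18 / norm x"
    proof -
      have "norm x * norm x \<le> (4 * s) * (4 * s)" using n s by (intro mult_mono) auto
      then show ?thesis using n s by (simp add: field_simps power2_eq_square)
    qed
    finally have K: "norm (K x) \<le> 2 ^ 18 / norm x" .
    have "norm (Dh x) \<le> norm (cutoff (?t x) *\<^sub>R G x) + norm (u x *\<^sub>R K x)"
      unfolding Dh_def by (rule norm_triangle_ineq)
    also have "\<dots> \<le> 2 ^ 18 * norm (G x) + \<bar>u x\<bar> * (2 ^ 18 / norm x)"
      unfolding norm_scaleR using cutoff_bounds(1,2)[of "?t x"]
      by (intro add_mono mult_right_mono mult_left_mono K) auto
    also have "\<dots> = 2 ^ 18 * (norm (G x) + \<bar>u x\<bar> / norm x)" by (simp add: algebra_simps)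
    finally have "(norm (Dh x))\<^sup>2 \<le> (2 ^ 18 * (norm (G x) + \<bar>u x\<bar> / norm x))\<^sup>2"
      by (rule power_mono) simp
    also have "\<dots> = 2 ^ 36 * (norm (G x) + \<bar>u x\<bar> / norm x)\<^sup>2"
      by (subst power_mult_distrib) simp
    also have "(norm (G x) + \<bar>u x\<bar> / norm x)\<^sup>2 \<le> 2 * ((norm (G x))\<^sup>2 + (\<bar>u x\<bar> / norm x)\<^sup>2)"
      using sum_squares_bound[of "norm (G x)" "\<bar>u x\<bar> / norm x"] by (simp add: power2_sum)
    finally show ?thesis using True by (simp add: power_divide)
  qed
  have dim: "real DIM(real^'n) = real l + 3" using card by simp
  have "(\<integral>\<^sup>+x. ennreal ((norm (Dh x))\<^sup>2) \<partial>lborel) \<le>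
      (\<integral>\<^sup>+x. ennreal (2 ^ 37) * (ennreal ((norm (G x))\<^sup>2 + (u x)\<^sup>2 / (norm x)\<^sup>2) * indicator ?A x) \<partial>lborel)"
  proof (intro nn_integral_mono)
    fix x
    have "ennreal ((norm (Dh x))\<^sup>2) \<le> ennreal (2 ^ 37 * ((norm (G x))\<^sup>2 + (u x)\<^sup>2 / (norm x)\<^sup>2) * indicator ?A x)"
      by (rule ennreal_leI[OF Dh_le])
    also have "\<dots> = ennreal (2 ^ 37) * (ennreal ((norm (G x))\<^sup>2 + (u x)\<^sup>2 / (norm x)\<^sup>2) * indicator ?A x)"
      by (cases "x \<in> ?A") (simp_all only: indicator_simps mult_1_right mult_zero_right ennreal_0,
          subst ennreal_mult, auto)
    finally show "ennreal ((norm (Dh x))\<^sup>2) \<le> \<dots>" .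
  qed
  also have "\<dots> = ennreal (2 ^ 37) * energy s"
    unfolding energy_def by (intro nn_integral_cmult) measurable
  also have "\<dots> \<le> ennreal (2 ^ 37) * ennreal e"
    by (intro mult_left_mono e) simp
  also have "\<dots> = ennreal (2 ^ 37 * e)" using e by (subst ennreal_mult) auto
  finally have "(\<integral>\<^sup>+x. ennreal (\<bar>h x\<bar> powr sob_exp l) \<partial>lborel) \<le> ennreal ((sob_const l * e) powr (sob_exp l / 2))"
    using Sobolev_inequality[OF der cont supp, where e="2 ^ 37 * e"] e dim
    by (simp add: sob_exp_def sob_const_def mult.assoc add.commute)
  moreover have "(\<integral>\<^sup>+x\<in>{x. s \<le> norm x \<and> norm x \<le> 2 * s}. ennreal (\<bar>u x\<bar> powr sob_exp l) \<partial>lborel)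
      \<le> (\<integral>\<^sup>+x. ennreal (\<bar>h x\<bar> powr sob_exp l) \<partial>lborel)"
  proof (intro nn_integral_mono)
    fix x :: "real^'n"
    show "ennreal (\<bar>u x\<bar> powr sob_exp l) * indicator {x. s \<le> norm x \<and> norm x \<le> 2 * s} x \<le> ennreal (\<bar>h x\<bar> powr sob_exp l)"
    proof (cases "s \<le> norm x \<and> norm x \<le> 2 * s")
      case True
      then have "s\<^sup>2 \<le> (norm x)\<^sup>2" "(norm x)\<^sup>2 \<le> (2 * s)\<^sup>2" using s by (intro power_mono; simp)+
      then have "1 \<le> ?t x" "?t x \<le> 4"
        using s by (auto simp: power2_norm_eq_inner[symmetric] field_simps power2_eq_square)
      then have "1 \<le> cutoff (?t x)" by (rule cutoff_ge_1)
      then have "1 * \<bar>u x\<bar> \<le> \<bar>h x\<bar>"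
        unfolding h_def abs_mult by (intro mult_right_mono) auto
      then show ?thesis using True by (auto simp: sob_exp_def intro!: ennreal_leI powr_mono2)
    qed simp
  qed
  ultimately show ?thesis by (rule order_trans[rotated])
qed

end

subsection \<open>The weighted Sobolev inequality\<close>

lemma space_sphere_measure [simp]: "space sphere_measure = UNIV"
  using sets_eq_imp_space_eq[OF sets_sphere_measure] by simp

lemma finite_measure_sphere_measure: "finite_measure (sphere_measure :: (real^'n) measure)"
proof
  have "emeasure (sphere_measure :: (real^'n) measure) UNIV = (\<integral>\<^sup>+x. 1 \<partial>(sphere_measure :: (real^'n) measure))"
    by simp
  also have "\<dots> = of_nat CARD('n) * emeasure lborel (ball (0 :: real^'n) 1)"
    by (subst nn_integral_sphere_measure) simp_all
  also have "\<dots> < \<infinity>"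
    using emeasure_lborel_ball_finite[of "0 :: real^'n" 1] by (auto simp: ennreal_mult_less_top of_nat_less_top)
  finally show "emeasure (sphere_measure :: (real^'n) measure) (space sphere_measure) \<noteq> \<infinity>"
    by simp
qed

lemma nn_integral_inverse_le:
  fixes a b :: real assumes "0 < a" "a \<le> b"
  shows "(\<integral>\<^sup>+s\<in>{a..b}. ennreal (1 / s) \<partial>lborel) \<le> ennreal ((b - a) / a)"
proof -
  have "(\<integral>\<^sup>+s\<in>{a..b}. ennreal (1 / s) \<partial>lborel) \<le> (\<integral>\<^sup>+s\<in>{a..b}. ennreal (1 / a) \<partial>lborel)"
    using assms by (intro nn_integral_mono) (auto simp: indicator_def frac_le intro!: ennreal_leI)
  also have "\<dots> = ennreal (1 / a) * ennreal (b - a)"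
    using assms by (subst nn_integral_cmult_indicator) auto
  also have "\<dots> = ennreal ((b - a) / a)"
    using assms by (subst ennreal_mult[symmetric]) auto
  finally show ?thesis .
qed

text \<open>Both the boundary constant of the theorem and the bound for \<open>HP l k\<close> on
  \<open>(0,1]\<close>, hence for the zeroth-order term of the remainder.\<close>

definition bd_const :: "nat \<Rightarrow> nat \<Rightarrow> real" where
  "bd_const l k = (real l + 1 + real k) / 2"

text \<open>In this and the next constant, 7 bounds the integral of \<open>1/s\<close> over an
  interval whose endpoints have ratio 8, \<open>2 ^ Suc k\<close> is the doubling constant of the
  weight, and \<open>2 * (bd_const l k)\<^sup>2 + 1\<close> is the price of replacing the gradient
  by the remainder.\<close>

definition C_sup :: "nat \<Rightarrow> nat \<Rightarrow> real" where
  "C_sup l k = 2 + (2 * (bd_const l k)\<^sup>2 + 1) * (7 * 2 ^ Suc k)"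

definition C_int :: "nat \<Rightarrow> nat \<Rightarrow> real" where
  "C_int l k = 7 * (2 + 6 * ((2 * (bd_const l k)\<^sup>2 + 1) * (2 ^ Suc k)\<^sup>2))"

definition C_S :: "nat \<Rightarrow> nat \<Rightarrow> real" where
  "C_S l k = 2 * (2 ^ Suc k) powr (1 + sob_exp l / 2) * (sob_const l powr (sob_exp l / 2) * C_sup l k powr (sob_exp l / 2 - 1) * C_int l k)"

text \<open>The share of the Hardy constant \<open>((N-2)/2)^2\<close> that is left once the
  boundary term of the exterior form has been absorbed.\<close>

definition C_Q :: "nat \<Rightarrow> nat \<Rightarrow> real" where
  "C_Q l k = (1 - real k / (real l + 1)) * ((real l + 1) / 2)\<^sup>2"

context C1_compact
begin

abbreviation W :: "real \<Rightarrow> real" where "W \<equiv> XW (Suc k)"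

definition D :: ennreal where "D = D_int + D_ext"


lemma bdry_le_D_ext: "bdry \<le> D_ext"
proof -
  have "1 * bdry \<le> ennreal (real l + 1) * bdry" by (intro mult_right_mono) auto
  then show ?thesis using bdry_le by (simp add: order_trans)
qed

definition D_density :: "real^'n \<Rightarrow> real" where
  "D_density x = (if norm x < 1 then remainder l k u G x else (norm (G x))\<^sup>2)"

lemma measurable_D_density [measurable]: "D_density \<in> borel_measurable borel"
  unfolding D_density_def by measurable

lemma D_density_nonneg: "0 \<le> D_density x"
  by (simp add: D_density_def remainder_def)

lemma pred_in_ext_ball [measurable]: "Measurable.pred borel (\<lambda>x::real^'n. x \<in> ext_ball)"
  unfolding ext_ball_polar by measurable

lemma nn_integral_D_density: "(\<integral>\<^sup>+x. ennreal (D_density x) \<partial>lborel) = D"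
proof -
  have "(\<integral>\<^sup>+x. ennreal (D_density x) \<partial>lborel) = (\<integral>\<^sup>+x. ennreal (remainder l k u G x) * indicator (ball 0 1) x + ennreal ((norm (G x))\<^sup>2) * indicator ext_ball x \<partial>lborel)"
    by (intro nn_integral_cong) (auto simp: D_density_def ext_ball_def indicator_def dist_norm)
  also have "\<dots> = D"
    unfolding D_def D_int_def D_ext_def by (intro nn_integral_add) measurable
  finally show ?thesis .
qed

text \<open>Inside the ball the gradient is the vector in the remainder minus its zeroth-order part,
  whose norm is at most \<open>bd_const l k\<close> times \<open>|u|/|x|\<close>.\<close>

lemma gradient_le_D_density:
  assumes "x \<noteq> 0"
  shows "(norm (G x))\<^sup>2 \<le> 2 * D_density x + 2 * (bd_const l k)\<^sup>2 * ((u x)\<^sup>2 / (norm x)\<^sup>2)"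
proof (cases "norm x < 1")
  case False
  then show ?thesis by (simp add: D_density_def)
next
  case True
  define c where "c = (HP l k (norm x) / (norm x)\<^sup>2 * u x) *\<^sub>R x"
  have n: "norm x > 0" using assms by simp
  have H: "0 < HP l k (norm x)" "HP l k (norm x) \<le> bd_const l k"
    using HP_bounds[OF n, of l k] True by (auto simp: bd_const_def)
  have "norm c = HP l k (norm x) * (\<bar>u x\<bar> / norm x)"
    using H n by (simp add: c_def abs_mult power2_eq_square)
  also have "\<dots> \<le> bd_const l k * (\<bar>u x\<bar> / norm x)"
    using H by (intro mult_right_mono) auto
  finally have c: "(norm c)\<^sup>2 \<le> (bd_const l k * (\<bar>u x\<bar> / norm x))\<^sup>2" by (rule power_mono) simp
  have "norm (G x) \<le> norm (G x + c) + norm c"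
    using norm_triangle_ineq4[of "G x + c" c] by simp
  then have "(norm (G x))\<^sup>2 \<le> (norm (G x + c) + norm c)\<^sup>2" by (rule power_mono) simp
  also have "\<dots> \<le> 2 * (norm (G x + c))\<^sup>2 + 2 * (norm c)\<^sup>2"
    using sum_squares_bound[of "norm (G x + c)" "norm c"] by (simp add: power2_sum)
  finally show ?thesis using c True by (simp add: D_density_def remainder_def c_def power_mult_distrib power_divide)
qed

text \<open>The bound is uniform over all radii. For \<open>a \<le> 1\<close> the interior estimate
  leaves the boundary term \<open>bdry\<close>, which \<open>D_ext\<close> dominates; for larger
  \<open>a\<close> the weight is at most 1.\<close>

lemma sphere_sup:
  assumes a: "0 < a"
  shows "(\<integral>\<^sup>+w. ennreal (a ^ (l + 1) * W a * (u (a *\<^sub>R w))\<^sup>2) \<partial>sphere_measure) \<le> D"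
proof (cases "a \<le> 1")
  case True
  then show ?thesis
    using sphere_sup_interior[OF a True] add_right_mono[OF bdry_le_D_ext, of D_int]
    by (simp add: XW_def D_def add.commute order_trans)
next
  case False
  have "(\<integral>\<^sup>+w. ennreal (a ^ (l + 1) * W a * (u (a *\<^sub>R w))\<^sup>2) \<partial>sphere_measure)
    \<le> (\<integral>\<^sup>+w. ennreal (a ^ (l + 1) * (real l + 1) * (u (a *\<^sub>R w))\<^sup>2) \<partial>sphere_measure)"
    using a XW_bounds[OF a, of "Suc k"]
    by (intro nn_integral_mono ennreal_leI mult_right_mono mult_left_mono) auto
  also have "\<dots> \<le> D_ext" using False by (intro sphere_sup_exterior) auto
  also have "\<dots> \<le> D" by (simp add: D_def)
  finally show ?thesis .
qed

text \<open>Polar coordinates turn the integral into one of spherical means against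
  \<open>dr/r\<close>. The weight moves from \<open>s\<close> to \<open>r\<close> by doubling, as
  \<open>s \<le> 2 * r\<close> on the annulus; then \<open>sphere_sup\<close> applies at each
  radius.\<close>

lemma annulus_L2:
  assumes s: "s > 0"
  shows "ennreal (W s) * (\<integral>\<^sup>+x\<in>{x. s / 2 \<le> norm x \<and> norm x \<le> 4 * s}. ennreal ((u x)\<^sup>2 / (norm x)\<^sup>2) \<partial>lborel)
    \<le> ennreal (7 * 2 ^ Suc k) * D"
proof -
  interpret S: finite_measure "sphere_measure :: (real^'n) measure"
    by (rule finite_measure_sphere_measure)
  interpret pair_sigma_finite lborel "sphere_measure :: (real^'n) measure" ..
  let ?I = "{s / 2..4 * s}"
  have "(\<integral>\<^sup>+x\<in>{x. s / 2 \<le> norm x \<and> norm x \<le> 4 * s}. ennreal ((u x)\<^sup>2 / (norm x)\<^sup>2) \<partial>lborel)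
    = (\<integral>\<^sup>+w. (\<integral>\<^sup>+r\<in>?I. ennreal ((u (r *\<^sub>R w))\<^sup>2 / (norm (r *\<^sub>R w))\<^sup>2) * ennreal (r ^ (l + 2)) \<partial>lborel) \<partial>sphere_measure)"
    by (subst nn_integral_polar_set[where S="?I"]) (use s in \<open>auto simp: card\<close>)
  also have "\<dots> = (\<integral>\<^sup>+w. (\<integral>\<^sup>+r\<in>?I. ennreal (r ^ l * (u (r *\<^sub>R w))\<^sup>2) \<partial>lborel) \<partial>sphere_measure)"
  proof (rule nn_integral_sphere_cong)
    fix w :: "real^'n" assume w: "norm w = 1"
    show "(\<integral>\<^sup>+r\<in>?I. ennreal ((u (r *\<^sub>R w))\<^sup>2 / (norm (r *\<^sub>R w))\<^sup>2) * ennreal (r ^ (l + 2)) \<partial>lborel) =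
       (\<integral>\<^sup>+r\<in>?I. ennreal (r ^ l * (u (r *\<^sub>R w))\<^sup>2) \<partial>lborel)"
    proof (intro nn_integral_cong)
      fix r :: real
      show "ennreal ((u (r *\<^sub>R w))\<^sup>2 / (norm (r *\<^sub>R w))\<^sup>2) * ennreal (r ^ (l + 2)) * indicator ?I r =
          ennreal (r ^ l * (u (r *\<^sub>R w))\<^sup>2) * indicator ?I r"
      proof (cases "r \<in> ?I")
        case True
        then have r: "r > 0" using s by auto
        then have "(u (r *\<^sub>R w))\<^sup>2 / (norm (r *\<^sub>R w))\<^sup>2 * r ^ (l + 2) = r ^ l * (u (r *\<^sub>R w))\<^sup>2"
          using w by (simp add: power2_eq_square)
        then show ?thesis using True r by (subst ennreal_mult[symmetric]) auto
      qed simp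
    qed
  qed measurable
  also have "\<dots> = (\<integral>\<^sup>+r. (\<integral>\<^sup>+w. ennreal (r ^ l * (u (r *\<^sub>R w))\<^sup>2) * indicator ?I r \<partial>sphere_measure) \<partial>lborel)"
    by (intro Fubini') measurable
  finally have "ennreal (W s) * (\<integral>\<^sup>+x\<in>{x. s / 2 \<le> norm x \<and> norm x \<le> 4 * s}. ennreal ((u x)\<^sup>2 / (norm x)\<^sup>2) \<partial>lborel)
    = (\<integral>\<^sup>+r. ennreal (W s) * (\<integral>\<^sup>+w. ennreal (r ^ l * (u (r *\<^sub>R w))\<^sup>2) * indicator ?I r \<partial>sphere_measure) \<partial>lborel)"
    by (subst nn_integral_cmult) auto
  also have "\<dots> \<le> (\<integral>\<^sup>+r. ennreal (2 ^ Suc k) * D * (ennreal (1 / r) * indicator ?I r) \<partial>lborel)"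
  proof (intro nn_integral_mono)
    fix r :: real
    show "ennreal (W s) * (\<integral>\<^sup>+w. ennreal (r ^ l * (u (r *\<^sub>R w))\<^sup>2) * indicator ?I r \<partial>sphere_measure)
        \<le> ennreal (2 ^ Suc k) * D * (ennreal (1 / r) * indicator ?I r)"
    proof (cases "r \<in> ?I")
      case True
      then have r: "r > 0" "s \<le> 2 * r" using s by auto
      have W: "W s \<le> 2 ^ Suc k * W r" "0 < W r" "0 < W s"
        using XW_double[OF s r, of "Suc k"] XW_bounds[OF r(1), of "Suc k"] XW_bounds[OF s, of "Suc k"] by auto
      have "ennreal (W s) * (\<integral>\<^sup>+w. ennreal (r ^ l * (u (r *\<^sub>R w))\<^sup>2) \<partial>sphere_measure)
         = (\<integral>\<^sup>+w. ennreal (W s) * ennreal (r ^ l * (u (r *\<^sub>R w))\<^sup>2) \<partial>sphere_measure)"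
        by (intro nn_integral_cmult[symmetric]) measurable
      also have "\<dots> \<le> (\<integral>\<^sup>+w. ennreal (2 ^ Suc k / r) * ennreal (r ^ (l + 1) * W r * (u (r *\<^sub>R w))\<^sup>2) \<partial>sphere_measure)"
      proof (intro nn_integral_mono)
        fix w :: "real^'n"
        have "W s * (r ^ l * (u (r *\<^sub>R w))\<^sup>2) \<le> 2 ^ Suc k * W r * (r ^ l * (u (r *\<^sub>R w))\<^sup>2)"
          using W r by (intro mult_right_mono) auto
        also have "\<dots> = 2 ^ Suc k / r * (r ^ (l + 1) * W r * (u (r *\<^sub>R w))\<^sup>2)"
          using r by simp
        finally show "ennreal (W s) * ennreal (r ^ l * (u (r *\<^sub>R w))\<^sup>2) \<le>
            ennreal (2 ^ Suc k / r) * ennreal (r ^ (l + 1) * W r * (u (r *\<^sub>R w))\<^sup>2)"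
          using W r by (subst (1 2) ennreal_mult[symmetric]) (auto intro!: ennreal_leI)
      qed
      also have "\<dots> = ennreal (2 ^ Suc k / r) * (\<integral>\<^sup>+w. ennreal (r ^ (l + 1) * W r * (u (r *\<^sub>R w))\<^sup>2) \<partial>sphere_measure)"
        by (intro nn_integral_cmult) measurable
      also have "\<dots> \<le> ennreal (2 ^ Suc k / r) * D"
        by (intro mult_left_mono sphere_sup r) simp
      also have "ennreal (2 ^ Suc k / r) = ennreal (2 ^ Suc k) * ennreal (1 / r)"
        using r by (subst ennreal_mult[symmetric]) auto
      finally show ?thesis using True by (simp add: mult_ac)
    qed simp
  qed
  also have "\<dots> = ennreal (2 ^ Suc k) * D * (\<integral>\<^sup>+r\<in>?I. ennreal (1 / r) \<partial>lborel)"
    by (intro nn_integral_cmult) measurable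
  also have "\<dots> \<le> ennreal (2 ^ Suc k) * D * ennreal ((4 * s - s / 2) / (s / 2))"
    using s by (intro mult_left_mono nn_integral_inverse_le) auto
  also have "(4 * s - s / 2) / (s / 2) = 7" using s by (simp add: field_simps)
  also have "ennreal (2 ^ Suc k) * D * ennreal 7 = ennreal (7 * 2 ^ Suc k) * D"
    by (subst ennreal_mult) (auto simp: mult_ac)
  finally show ?thesis .
qed


lemma energy_density_le:
  assumes "x \<noteq> 0"
  shows "ennreal ((norm (G x))\<^sup>2 + (u x)\<^sup>2 / (norm x)\<^sup>2) \<le>
    2 * ennreal (D_density x) + ennreal (2 * (bd_const l k)\<^sup>2 + 1) * ennreal ((u x)\<^sup>2 / (norm x)\<^sup>2)"
proof -
  have "ennreal ((norm (G x))\<^sup>2 + (u x)\<^sup>2 / (norm x)\<^sup>2) \<le> ennreal (2 * D_density x + (2 * (bd_const l k)\<^sup>2 + 1) * ((u x)\<^sup>2 / (norm x)\<^sup>2))"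
  proof (intro ennreal_leI)
    have *: "a + q \<le> b + (2 * c + 1) * q" if "a \<le> b + 2 * c * q" for a b c q :: real
      using that by (simp add: algebra_simps)
    show "(norm (G x))\<^sup>2 + (u x)\<^sup>2 / (norm x)\<^sup>2 \<le> 2 * D_density x + (2 * (bd_const l k)\<^sup>2 + 1) * ((u x)\<^sup>2 / (norm x)\<^sup>2)"
      by (rule *[OF gradient_le_D_density[OF assms]])
  qed
  also have "\<dots> = 2 * ennreal (D_density x) + ennreal (2 * (bd_const l k)\<^sup>2 + 1) * ennreal ((u x)\<^sup>2 / (norm x)\<^sup>2)"
    using D_density_nonneg[of x] by (simp add: ennreal_plus ennreal_mult del: times_divide_eq_right)
  finally show ?thesis .
qed

text \<open>Only the term \<open>u^2/|x|^2\<close> needs the weight; the part coming from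
  \<open>D_density\<close> is bounded by \<open>D\<close> already, and
  \<open>W s \<le> 1\<close>.\<close>

lemma energy_sup:
  assumes s: "s > 0"
  shows "ennreal (W s) * energy s \<le> ennreal (C_sup l k) * D"
proof -
  let ?m = "ennreal (2 * (bd_const l k)\<^sup>2 + 1)"
  let ?A = "{x::real^'n. s / 2 \<le> norm x \<and> norm x \<le> 4 * s}"
  let ?L = "\<integral>\<^sup>+x\<in>?A. ennreal ((u x)\<^sup>2 / (norm x)\<^sup>2) \<partial>lborel"
  have [measurable]: "Measurable.pred borel (\<lambda>x::real^'n. s / 2 \<le> norm x \<and> norm x \<le> 4 * s)"
    by measurable
  have "energy s \<le> (\<integral>\<^sup>+x. 2 * ennreal (D_density x) + ?m * (ennreal ((u x)\<^sup>2 / (norm x)\<^sup>2) * indicator ?A x) \<partial>lborel)"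
    unfolding energy_def
  proof (intro nn_integral_mono)
    fix x :: "real^'n"
    show "ennreal ((norm (G x))\<^sup>2 + (u x)\<^sup>2 / (norm x)\<^sup>2) * indicator ?A x \<le>
      2 * ennreal (D_density x) + ?m * (ennreal ((u x)\<^sup>2 / (norm x)\<^sup>2) * indicator ?A x)"
    proof (cases "x \<in> ?A")
      case True
      then have "x \<noteq> 0" using s by auto
      from energy_density_le[OF this] True show ?thesis by simp
    qed simp
  qed
  also have "\<dots> = 2 * D + ?m * ?L"
    by (simp add: nn_integral_add nn_integral_cmult nn_integral_D_density)
  finally have "ennreal (W s) * energy s \<le> ennreal (W s) * (2 * D + ?m * ?L)"
    by (rule mult_left_mono) simp
  also have "\<dots> = ennreal (W s) * (2 * D) + ?m * (ennreal (W s) * ?L)"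
    by (simp add: distrib_left mult_ac)
  also have "\<dots> \<le> 1 * (2 * D) + ?m * (ennreal (7 * 2 ^ Suc k) * D)"
    using XW_bounds[OF s, of "Suc k"]
    by (intro add_mono[OF mult_right_mono mult_left_mono] annulus_L2 s) auto
  also have "\<dots> = ennreal (C_sup l k) * D"
  proof -
    have "ennreal (C_sup l k) = 2 + ?m * ennreal (7 * 2 ^ Suc k)"
      unfolding C_sup_def by (subst ennreal_plus, simp, simp, subst ennreal_mult, simp, simp, simp)
    then show ?thesis by (simp only: distrib_right mult.assoc mult_1)
  qed
  finally show ?thesis .
qed

lemma weighted_L2:
  "(\<integral>\<^sup>+x. ennreal ((W (norm x))\<^sup>2 * ((u x)\<^sup>2 / (norm x)\<^sup>2)) \<partial>lborel) \<le> 6 * D"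
proof -
  let ?L = "\<integral>\<^sup>+x\<in>ext_ball. ennreal ((u x)\<^sup>2 / (norm x)\<^sup>2) \<partial>lborel"
  have "(\<integral>\<^sup>+x. ennreal ((W (norm x))\<^sup>2 * ((u x)\<^sup>2 / (norm x)\<^sup>2)) \<partial>lborel) =
     (\<integral>\<^sup>+x. ennreal ((XP (Suc k) (norm x))\<^sup>2 * (u x)\<^sup>2 / (norm x)\<^sup>2) * indicator (ball 0 1) x
        + ennreal ((u x)\<^sup>2 / (norm x)\<^sup>2) * indicator ext_ball x \<partial>lborel)"
    by (intro nn_integral_cong) (auto simp: XW_def XP_1 ext_ball_def indicator_def dist_norm min_def)
  also have "\<dots> = (\<integral>\<^sup>+x\<in>ball 0 1. ennreal ((XP (Suc k) (norm x))\<^sup>2 * (u x)\<^sup>2 / (norm x)\<^sup>2) \<partial>lborel) + ?L"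
    by (intro nn_integral_add) measurable
  also have "\<dots> \<le> (2 * D_ext + 4 * D_int) + 4 * D_ext"
  proof (intro add_mono)
    show "(\<integral>\<^sup>+x\<in>ball 0 1. ennreal ((XP (Suc k) (norm x))\<^sup>2 * (u x)\<^sup>2 / (norm x)\<^sup>2) \<partial>lborel) \<le> 2 * D_ext + 4 * D_int"
      by (rule order_trans[OF ball_Hardy]) (intro add_mono mult_left_mono bdry_le_D_ext order_refl, simp)
    \<comment> \<open>This is \<open>(N-2)^2 \<ge> 1\<close>, so the exterior Hardy constant is at
      least \<open>1/4\<close>.\<close>
    have "1 \<le> 4 * ((real l + 1) / 2)\<^sup>2" by (simp add: power2_eq_square field_simps)
    then have "1 * ?L \<le> ennreal (4 * ((real l + 1) / 2)\<^sup>2) * ?L"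
      by (intro mult_right_mono) auto
    also have "\<dots> = 4 * (ennreal (((real l + 1) / 2)\<^sup>2) * ?L)"
      by (subst ennreal_mult) (auto simp: mult.assoc)
    also have "\<dots> \<le> 4 * D_ext"
      by (intro mult_left_mono order_trans[OF _ ext_Hardy]) auto
    finally show "?L \<le> 4 * D_ext" by simp
  qed
  also have "\<dots> \<le> 6 * D"
  proof -
    have "6 * a = 2 * a + 4 * a" for a :: ennreal by (simp flip: distrib_right)
    then have "6 * D = (2 * D_ext + 4 * D_int) + 4 * D_ext + 2 * D_int"
      unfolding D_def by (simp only: distrib_left) (simp only: ac_simps)
    then show ?thesis by simp
  qed
  finally show ?thesis .
qed


text \<open>Tonelli: a fixed point lies only in the annuli of comparable scale, which have bounded
  mass for \<open>ds/s\<close>. Doubling replaces \<open>W s\<close> by the weight at the point, and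
  \<open>weighted_L2\<close> finishes.\<close>

lemma energy_integral:
  "(\<integral>\<^sup>+s\<in>{0<..}. ennreal ((W s)\<^sup>2 / s) * energy s \<partial>lborel) \<le> ennreal (C_int l k) * D"
proof -
  let ?A = "\<lambda>s. {x::real^'n. s / 2 \<le> norm x \<and> norm x \<le> 4 * s}"
  let ?e = "\<lambda>x. ennreal ((norm (G x))\<^sup>2 + (u x)\<^sup>2 / (norm x)\<^sup>2)"
  let ?f = "\<lambda>x. ennreal ((W (norm x))\<^sup>2 * ((u x)\<^sup>2 / (norm x)\<^sup>2))"
  let ?c = "ennreal ((2 * (bd_const l k)\<^sup>2 + 1) * (2 ^ Suc k)\<^sup>2)"
  have "(\<integral>\<^sup>+s\<in>{0<..}. ennreal ((W s)\<^sup>2 / s) * energy s \<partial>lborel) =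
    (\<integral>\<^sup>+s. (\<integral>\<^sup>+x. ennreal ((W s)\<^sup>2 / s) * indicator {0<..} s * (?e x * indicator (?A s) x) \<partial>lborel) \<partial>lborel)"
    unfolding energy_def by (intro nn_integral_cong, subst nn_integral_cmult) (auto simp: mult_ac)
  also have "\<dots> = (\<integral>\<^sup>+x. (\<integral>\<^sup>+s. ennreal ((W s)\<^sup>2 / s) * indicator {0<..} s * (?e x * indicator (?A s) x) \<partial>lborel) \<partial>lborel)"
  proof (intro lborel_pair.Fubini')
    have "(\<lambda>(x, s). ennreal ((W s)\<^sup>2 / s) * indicator {0<..} s * (?e x * (if s / 2 \<le> norm x \<and> norm x \<le> 4 * s then 1 else 0)))
        \<in> borel_measurable (lborel \<Otimes>\<^sub>M lborel)"
      by measurable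
    then show "(\<lambda>(x, s). ennreal ((W s)\<^sup>2 / s) * indicator {0<..} s * (?e x * indicator (?A s) x)) \<in> borel_measurable (lborel \<Otimes>\<^sub>M lborel)"
      by (simp add: indicator_def of_bool_def)
  qed
  also have "\<dots> \<le> (\<integral>\<^sup>+x. 7 * (2 * ennreal (D_density x) + ?c * ?f x) \<partial>lborel)"
  proof (rule nn_integral_mono_AE, rule AE_mp[OF AE_lborel_singleton[of 0]], rule AE_I2, rule impI)
    fix x :: "real^'n" assume x: "x \<noteq> 0"
    let ?m = "ennreal (2 * (bd_const l k)\<^sup>2 + 1)" and ?q = "ennreal ((u x)\<^sup>2 / (norm x)\<^sup>2)"
      and ?d = "2 * ennreal (D_density x)"
    \<comment> \<open>Exactly the scales whose enlarged annulus contains \<open>x\<close>; the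
      endpoints have ratio 8, which gives the factor 7.\<close>
    let ?I = "{norm x / 4..2 * norm x}"
    have "(\<integral>\<^sup>+s. ennreal ((W s)\<^sup>2 / s) * indicator {0<..} s * (?e x * indicator (?A s) x) \<partial>lborel)
      \<le> (\<integral>\<^sup>+s. (?d + ?c * ?f x) * (ennreal (1 / s) * indicator ?I s) \<partial>lborel)"
    proof (intro nn_integral_mono)
      fix s :: real
      show "ennreal ((W s)\<^sup>2 / s) * indicator {0<..} s * (?e x * indicator (?A s) x) \<le>
          (?d + ?c * ?f x) * (ennreal (1 / s) * indicator ?I s)"
      proof (cases "s > 0 \<and> x \<in> ?A s")
        case True
        then have s: "s > 0" "s \<in> ?I" "s \<le> 2 * norm x" by auto
        have W: "0 < W s" "W s \<le> 1" "W s \<le> 2 ^ Suc k * W (norm x)" "0 < W (norm x)"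
          using XW_bounds[OF s(1), of "Suc k"] XW_double[OF s(1) _ s(3), of "Suc k"] XW_bounds[of "norm x" "Suc k"] x by auto
        have "(W s)\<^sup>2 \<le> (2 ^ Suc k * W (norm x))\<^sup>2" "(W s)\<^sup>2 \<le> 1" using W by (auto intro!: power_mono power_le_one)
        then have W2: "ennreal ((W s)\<^sup>2) \<le> ennreal ((2 ^ Suc k * W (norm x))\<^sup>2)" "ennreal ((W s)\<^sup>2) \<le> 1"
          by (auto simp del: power_Suc intro!: ennreal_leI)
        have "ennreal ((W s)\<^sup>2) * (?d + ?m * ?q)
           = ennreal ((W s)\<^sup>2) * (?d) + ?m * (ennreal ((W s)\<^sup>2) * ?q)"
          by (simp only: distrib_left mult.left_commute)
        also have "\<dots> \<le> 1 * (?d) + ?m * (ennreal ((2 ^ Suc k * W (norm x))\<^sup>2) * ?q)"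
          by (intro add_mono mult_right_mono mult_left_mono W2) auto
        finally have "ennreal ((W s)\<^sup>2) * (?d + ?m * ?q)
           \<le> ?d + ?m * (ennreal ((2 ^ Suc k * W (norm x))\<^sup>2) * ?q)"
          by (simp only: mult_1)
        also have "?m * (ennreal ((2 ^ Suc k * W (norm x))\<^sup>2) * ?q) = ?c * ?f x"
        proof -
          have "(2 * (bd_const l k)\<^sup>2 + 1) * ((2 ^ Suc k * W (norm x))\<^sup>2 * ((u x)\<^sup>2 / (norm x)\<^sup>2)) =
             (2 * (bd_const l k)\<^sup>2 + 1) * (2 ^ Suc k)\<^sup>2 * ((W (norm x))\<^sup>2 * ((u x)\<^sup>2 / (norm x)\<^sup>2))"
            by (simp only: power_mult_distrib mult.assoc)
          then show ?thesis
            by (subst ennreal_mult[symmetric], simp, simp, subst ennreal_mult[symmetric], simp, simp,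
                subst ennreal_mult[symmetric], simp, simp, simp only:)
        qed
        finally have "ennreal ((W s)\<^sup>2) * ?e x \<le> ?d + ?c * ?f x"
          using mult_left_mono[OF energy_density_le[OF x], of "ennreal ((W s)\<^sup>2)"] by (auto intro: order_trans)
        then have "ennreal (1 / s) * (ennreal ((W s)\<^sup>2) * ?e x) \<le> ennreal (1 / s) * (?d + ?c * ?f x)"
          by (rule mult_left_mono) simp
        moreover have "ennreal ((W s)\<^sup>2 / s) = ennreal (1 / s) * ennreal ((W s)\<^sup>2)"
          using s by (subst ennreal_mult[symmetric]) auto
        ultimately show ?thesis using True s by (simp add: mult_ac)
      qed (auto simp: indicator_def)
    qed
    also have "\<dots> = (?d + ?c * ?f x) * (\<integral>\<^sup>+s\<in>?I. ennreal (1 / s) \<partial>lborel)"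
      by (intro nn_integral_cmult) measurable
    also have "\<dots> \<le> (?d + ?c * ?f x) * ennreal ((2 * norm x - norm x / 4) / (norm x / 4))"
      using x by (intro mult_left_mono nn_integral_inverse_le) auto
    also have "(2 * norm x - norm x / 4) / (norm x / 4) = 7" using x by (simp add: field_simps)
    finally show "(\<integral>\<^sup>+s. ennreal ((W s)\<^sup>2 / s) * indicator {0<..} s * (?e x * indicator (?A s) x) \<partial>lborel)
       \<le> 7 * (?d + ?c * ?f x)" by (simp add: mult.commute)
  qed
  also have "\<dots> = 7 * (2 * D + ?c * (\<integral>\<^sup>+x. ?f x \<partial>lborel))"
    by (simp add: nn_integral_add nn_integral_cmult nn_integral_D_density)
  also have "\<dots> \<le> 7 * (2 * D + ?c * (6 * D))"
    by (intro mult_left_mono add_left_mono weighted_L2) auto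
  also have "\<dots> = ennreal (C_int l k) * D"
  proof -
    have "ennreal (C_int l k) = 7 * (2 + 6 * ?c)"
      unfolding C_int_def
      by (subst ennreal_mult, simp, simp, subst ennreal_plus, simp, simp, subst ennreal_mult, simp, simp, simp only: ennreal_numeral)
    then show ?thesis by (simp only: distrib_left distrib_right mult_ac)
  qed
  finally show ?thesis .
qed

end

lemma C_sup_pos: "C_sup l k > 0" and C_int_pos: "C_int l k > 0" and sob_const_pos: "sob_const l > 0"
  and sob_exp_gt: "sob_exp l / 2 > 1"
  by (auto simp: C_sup_def C_int_def sob_const_def sob_exp_def field_simps intro!: add_pos_nonneg)

lemma C_S_pos: "C_S l k > 0"
  unfolding C_S_def using C_sup_pos[of l k] C_int_pos[of l k] sob_const_pos[of l]
  by (intro mult_pos_pos) auto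

section \<open>Assembling the scales\<close>

context C1_compact
begin

text \<open>The radius \<open>n\<close> lies in the shell from \<open>s\<close> to
  \<open>2 * s\<close> for every \<open>s\<close> in \<open>{n / 2..n}\<close>. There
  \<open>1/s \<ge> 1/n\<close> and the interval has length \<open>n/2\<close>, hence the factor 2;
  doubling allows \<open>W s\<close> in place of \<open>W n\<close>. A pointwise weight thus becomes
  an integral over scales.\<close>

lemma shell_average:
  fixes a t :: real assumes a: "0 \<le> a" and t: "t > 0" and n: "n > 0"
  shows "ennreal (a * W n powr t) \<le> ennreal (2 * (2 ^ Suc k) powr t) *
    (\<integral>\<^sup>+s. ennreal (W s powr t / s) * indicator {0<..} s * (ennreal a * indicator {s. s \<le> n \<and> n \<le> 2 * s} s) \<partial>lborel)"
proof -
  let ?q = "(2 ^ Suc k) powr t :: real"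
  let ?c = "a * W n powr t / (?q * n)"
  have q: "?q > 0" by simp
  have "ennreal (?c * (n - n / 2)) = ennreal ?c * ennreal (n - n / 2)"
    using n a by (intro ennreal_mult) auto
  also have "\<dots> = (\<integral>\<^sup>+s\<in>{n / 2..n}. ennreal ?c \<partial>lborel)"
    using n by (subst nn_integral_cmult_indicator) auto
  also have "\<dots> \<le> (\<integral>\<^sup>+s. ennreal (W s powr t / s) * indicator {0<..} s * (ennreal a * indicator {s. s \<le> n \<and> n \<le> 2 * s} s) \<partial>lborel)"
  proof (intro nn_integral_mono)
    fix s :: real
    show "ennreal ?c * indicator {n / 2..n} s \<le> ennreal (W s powr t / s) * indicator {0<..} s * (ennreal a * indicator {s. s \<le> n \<and> n \<le> 2 * s} s)"
    proof (cases "s \<in> {n / 2..n}")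
      case True
      then have s: "0 < s" "s \<le> n" "n \<le> 2 * s" using n by auto
      have W: "0 < W s" "0 < W n" "W n \<le> 2 ^ Suc k * W s"
        using XW_bounds[OF s(1), of "Suc k"] XW_bounds[OF n, of "Suc k"] XW_double[OF n s(1) s(3), of "Suc k"] by auto
      have "W n powr t \<le> (2 ^ Suc k * W s) powr t" using W t by (intro powr_mono2) auto
      also have "\<dots> = ?q * W s powr t" using W by (simp add: powr_mult)
      finally have "W n powr t / ?q \<le> W s powr t" using q by (simp add: divide_le_eq mult.commute)
      then have "W n powr t / ?q / n \<le> W s powr t / s"
        using s n by (intro frac_le) auto
      then have "a * (W n powr t / ?q / n) \<le> a * (W s powr t / s)"
        using a by (rule mult_left_mono)
      then have "ennreal ?c \<le> ennreal (W s powr t / s * a)"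
        by (intro ennreal_leI) (simp add: mult.commute)
      also have "\<dots> = ennreal (W s powr t / s) * ennreal a"
        using s a by (intro ennreal_mult) auto
      finally show ?thesis using s True by simp
    qed simp
  qed
  finally have "ennreal (2 * ?q) * ennreal (?c * (n - n / 2)) \<le> ennreal (2 * ?q) * \<dots>"
    by (rule mult_left_mono) simp
  moreover have "ennreal (2 * ?q) * ennreal (?c * (n - n / 2)) = ennreal (a * W n powr t)"
  proof -
    have "2 * ?q * (?c * (n - n / 2)) = a * W n powr t" using n q by (simp add: field_simps)
    then show ?thesis using n a by (subst ennreal_mult[symmetric]) auto
  qed
  ultimately show ?thesis by simp
qed

lemma shell_bound:
  assumes d: "D \<le> ennreal d" "d \<ge> 0" and s: "s > 0"
  shows "ennreal (W s powr (1 + sob_exp l / 2) / s) *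
      (\<integral>\<^sup>+x\<in>{x. s \<le> norm x \<and> norm x \<le> 2 * s}. ennreal (\<bar>u x\<bar> powr sob_exp l) \<partial>lborel)
    \<le> ennreal (sob_const l powr (sob_exp l / 2) * (C_sup l k * d) powr (sob_exp l / 2 - 1)) * (ennreal ((W s)\<^sup>2 / s) * energy s)"
proof -
  let ?p = "sob_exp l / 2" let ?B = "sob_const l powr ?p * (C_sup l k * d) powr (?p - 1)"
  let ?T = "\<integral>\<^sup>+x\<in>{x. s \<le> norm x \<and> norm x \<le> 2 * s}. ennreal (\<bar>u x\<bar> powr sob_exp l) \<partial>lborel"
  have W: "W s > 0" using XW_bounds[OF s] by auto
  have "ennreal (W s) * energy s \<le> ennreal (C_sup l k) * ennreal d"
    by (rule order_trans[OF energy_sup[OF s] mult_left_mono[OF d(1)]]) simp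
  then have le: "ennreal (W s) * energy s \<le> ennreal (C_sup l k * d)"
    using C_sup_pos[of l k] d by (simp add: ennreal_mult)
  \<comment> \<open>The supremum bound gives this because \<open>W s > 0\<close>; from here on real
    powers can be used.\<close>
  have "energy s \<noteq> top"
  proof
    assume "energy s = top"
    then have "ennreal (W s) * energy s = top" using W by (simp add: ennreal_mult_top)
    then show False using le by (simp add: top_unique)
  qed
  then obtain e where e: "energy s = ennreal e" "e \<ge> 0" by (cases "energy s") auto
  have We: "W s * e \<le> C_sup l k * d" using le e W C_sup_pos[of l k] d by (simp add: ennreal_mult[symmetric])
  have "?T \<le> ennreal ((sob_const l * e) powr ?p)"
    using e by (intro local_Sobolev s) auto
  then have "ennreal (W s powr (1 + ?p) / s) * ?T \<le> ennreal (W s powr (1 + ?p) / s) * ennreal ((sob_const l * e) powr ?p)"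
    by (rule mult_left_mono) simp
  also have "\<dots> = ennreal (W s powr (1 + ?p) / s * (sob_const l * e) powr ?p)"
    using s by (subst ennreal_mult) auto
  also have "\<dots> \<le> ennreal (?B * ((W s)\<^sup>2 / s * e))"
  proof (intro ennreal_leI)
    have "W s powr (1 + ?p) * e powr ?p = (W s * e) powr (?p - 1) * ((W s)\<^sup>2 * e)"
    proof (cases "e = 0")
      case False
      then have e0: "e > 0" using e by simp
      have "W s powr (1 + ?p) = W s powr (?p - 1) * W s powr 2" by (simp flip: powr_add)
      moreover have "e powr ?p = e powr (?p - 1) * e powr 1" by (simp only: flip: powr_add) simp
      ultimately show ?thesis using W e0 by (simp add: powr_mult)
    qed simp
    then have "W s powr (1 + ?p) / s * (sob_const l * e) powr ?p = sob_const l powr ?p * ((W s * e) powr (?p - 1) * ((W s)\<^sup>2 / s * e))"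
      using sob_const_pos[of l] e by (simp add: powr_mult field_simps)
    \<comment> \<open>The exponent \<open>?p - 1\<close> is positive, as half the Sobolev exponent
      exceeds 1, so the bound for \<open>W s * e\<close> passes to its power.\<close>
    also have "\<dots> \<le> sob_const l powr ?p * ((C_sup l k * d) powr (?p - 1) * ((W s)\<^sup>2 / s * e))"
      using We W e s sob_exp_gt[of l] by (intro mult_left_mono mult_right_mono powr_mono2) auto
    finally show "W s powr (1 + ?p) / s * (sob_const l * e) powr ?p \<le> ?B * ((W s)\<^sup>2 / s * e)"
      by (simp add: mult.assoc)
  qed
  also have "\<dots> = ennreal (?B) * (ennreal ((W s)\<^sup>2 / s) * energy s)"
    unfolding e(1) using s e(2) by (subst ennreal_mult, simp, simp, subst ennreal_mult[of "(W s)\<^sup>2 / s"], simp, simp, simp)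
  finally show ?thesis .
qed

text \<open>After averaging over shells and exchanging the integrals, \<open>shell_bound\<close>
  acts at each scale and \<open>energy_integral\<close> sums the scales. The former contributes the
  power \<open>p/2 - 1\<close> of \<open>d\<close>, the latter one more.\<close>

lemma weighted_Sobolev:
  assumes d: "D \<le> ennreal d" "d \<ge> 0"
  shows "(\<integral>\<^sup>+x. ennreal (\<bar>u x\<bar> powr sob_exp l * W (norm x) powr (1 + sob_exp l / 2)) \<partial>lborel)
    \<le> ennreal (C_S l k * d powr (sob_exp l / 2))"
proof -
  let ?p = "sob_exp l" let ?t = "1 + sob_exp l / 2"
  let ?A = "ennreal (2 * (2 ^ Suc k) powr ?t)"
  let ?B = "sob_const l powr (?p / 2) * (C_sup l k * d) powr (?p / 2 - 1)"
  let ?i = "\<lambda>s (x::real^'n). if s \<le> norm x \<and> norm x \<le> 2 * s then 1 else 0 :: ennreal"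
  let ?J = "\<lambda>s x. ennreal (W s powr ?t / s) * indicator {0<..} s * (ennreal (\<bar>u x\<bar> powr ?p) * ?i s x)"
  have "(\<integral>\<^sup>+x. ennreal (\<bar>u x\<bar> powr ?p * W (norm x) powr ?t) \<partial>lborel)
    \<le> (\<integral>\<^sup>+x. ?A * (\<integral>\<^sup>+s. ?J s x \<partial>lborel) \<partial>lborel)"
  proof (rule nn_integral_mono_AE, rule AE_mp[OF AE_lborel_singleton[of 0]], rule AE_I2, rule impI)
    fix x :: "real^'n" assume "x \<noteq> 0"
    then show "ennreal (\<bar>u x\<bar> powr ?p * W (norm x) powr ?t) \<le> ?A * (\<integral>\<^sup>+s. ?J s x \<partial>lborel)"
      using shell_average[of "\<bar>u x\<bar> powr ?p" ?t "norm x"] sob_exp_gt[of l] by (simp add: indicator_def of_bool_def)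
  qed
  also have "\<dots> = ?A * (\<integral>\<^sup>+x. (\<integral>\<^sup>+s. ?J s x \<partial>lborel) \<partial>lborel)"
    by (intro nn_integral_cmult) measurable
  also have "(\<integral>\<^sup>+x. (\<integral>\<^sup>+s. ?J s x \<partial>lborel) \<partial>lborel) = (\<integral>\<^sup>+s. (\<integral>\<^sup>+x. ?J s x \<partial>lborel) \<partial>lborel)"
    by (intro lborel_pair.Fubini') measurable
  also have "\<dots> \<le> (\<integral>\<^sup>+s. ennreal ?B * (ennreal ((W s)\<^sup>2 / s) * energy s * indicator {0<..} s) \<partial>lborel)"
  proof (intro nn_integral_mono)
    fix s :: real
    have "(\<integral>\<^sup>+x. ?J s x \<partial>lborel) = ennreal (W s powr ?t / s) * indicator {0<..} s * (\<integral>\<^sup>+x. ennreal (\<bar>u x\<bar> powr ?p) * ?i s x \<partial>lborel)"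
      by (intro nn_integral_cmult) measurable
    then show "(\<integral>\<^sup>+x. ?J s x \<partial>lborel) \<le> ennreal ?B * (ennreal ((W s)\<^sup>2 / s) * energy s * indicator {0<..} s)"
      using shell_bound[OF d, of s] by (cases "s > 0") (simp_all add: indicator_def of_bool_def)
  qed
  also have "\<dots> = ennreal ?B * (\<integral>\<^sup>+s\<in>{0<..}. ennreal ((W s)\<^sup>2 / s) * energy s \<partial>lborel)"
  proof (intro nn_integral_cmult)
    have "energy = (\<lambda>s. \<integral>\<^sup>+x. ennreal ((norm (G x))\<^sup>2 + (u x)\<^sup>2 / (norm x)\<^sup>2) * (if s / 2 \<le> norm x \<and> norm x \<le> 4 * s then 1 else 0) \<partial>lborel)"
      by (simp add: energy_def[abs_def] indicator_def of_bool_def)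
    moreover have "\<dots> \<in> borel_measurable borel" by measurable
    ultimately have [measurable]: "energy \<in> borel_measurable borel" by simp
    show "(\<lambda>s. ennreal ((W s)\<^sup>2 / s) * energy s * indicator {0<..} s) \<in> borel_measurable lborel" by measurable
  qed
  also have "\<dots> \<le> ennreal ?B * (ennreal (C_int l k) * ennreal d)"
    by (intro mult_left_mono order_trans[OF energy_integral] d) auto
  finally have "(\<integral>\<^sup>+x. ennreal (\<bar>u x\<bar> powr ?p * W (norm x) powr ?t) \<partial>lborel) \<le> ?A * (ennreal ?B * (ennreal (C_int l k) * ennreal d))"
    by (simp add: mult_left_mono)
  also have "\<dots> = ennreal (2 * (2 ^ Suc k) powr ?t * (?B * (C_int l k * d)))"
    using C_int_pos[of l k] d
    by (subst ennreal_mult[symmetric], simp, simp, subst ennreal_mult[symmetric], simp, simp, subst ennreal_mult[symmetric], simp_all)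
  also have "2 * (2 ^ Suc k) powr ?t * (?B * (C_int l k * d)) = C_S l k * d powr (?p / 2)"
  proof (cases "d = 0")
    case False
    then have "d powr (?p / 2) = d powr (?p / 2 - 1) * d powr 1"
      by (simp only: flip: powr_add) simp
    then show ?thesis
      using C_sup_pos[of l k] d False by (simp add: C_S_def powr_mult)
  qed simp
  finally show ?thesis .
qed

end

subsection \<open>The exterior quadratic form\<close>

lemma has_derivative_gradient:
  fixes u :: "real^'n \<Rightarrow> real"
  assumes "u differentiable (at x)"
  shows "(u has_derivative (\<lambda>v. gradient u x \<bullet> v)) (at x)"
proof -
  let ?f = "frechet_derivative u (at x)"
  have f: "(u has_derivative ?f) (at x)" using assms by (simp add: frechet_derivative_works)
  then interpret bounded_linear ?f by (rule has_derivative_bounded_linear)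
  have "?f v = gradient u x \<bullet> v" for v
  proof -
    have "?f v = ?f (\<Sum>i\<in>UNIV. (v $ i) *\<^sub>R axis i 1)"
      using basis_expansion[of v] by (simp add: scalar_mult_eq_scaleR)
    also have "\<dots> = (\<Sum>i\<in>UNIV. v $ i * ?f (axis i 1))"
      by (simp add: sum scaleR)
    finally show ?thesis by (simp add: gradient_def inner_vec_def mult.commute)
  qed
  then have "?f = (\<lambda>v. gradient u x \<bullet> v)" by auto
  with f show ?thesis by simp
qed

lemma test_function_C1_compact:
  fixes u :: "real^'n \<Rightarrow> real"
  assumes u: "u \<in> test_functions" and card: "CARD('n) = l + 3"
  obtains R where "C1_compact u (gradient u) R l"
proof -
  have "C_class (Suc 0) u" and comp: "compact (closure {x. u x \<noteq> 0})"
    using u by (auto simp: test_functions_def)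
  then have diff: "u differentiable_on UNIV" and cont: "\<And>i. continuous_on UNIV (\<lambda>x. gradient u x $ i)"
    by auto
  have "gradient u = (\<lambda>x. \<chi> i. gradient u x $ i)" by simp
  then have "continuous_on UNIV (gradient u)"
    by (rule ssubst) (intro continuous_on_vec_lambda cont)
  moreover have "(u has_derivative (\<lambda>v. gradient u x \<bullet> v)) (at x)" for x
    using diff by (intro has_derivative_gradient) (simp add: differentiable_on_def)
  moreover obtain R where "\<And>x. x \<in> closure {x. u x \<noteq> 0} \<Longrightarrow> norm x \<le> R"
    using compact_imp_bounded[OF comp] by (auto simp: bounded_iff)
  then have "u x = 0" if "norm x > R" for x
    using that closure_subset[of "{x. u x \<noteq> 0}"] by force
  ultimately have "C1_compact u (gradient u) R l"
    using card by unfold_locales auto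
  then show thesis by (rule that)
qed

context C1_compact
begin

definition Hd :: ennreal where
  "Hd = (\<integral>\<^sup>+x\<in>ext_ball. ennreal ((u x)\<^sup>2 / (norm x)\<^sup>2) \<partial>lborel)"


text \<open>The combination of \<open>bdry_le\<close> and \<open>ext_Hardy\<close> with weights \<open>k/(N-2)\<close> and \<open>1 - k/(N-2)\<close> that
  produces the boundary constant \<open>(N-2+k)/2\<close>.\<close>

lemma exterior_coercive:
  assumes k: "real k < real l + 1"
  shows "ennreal (bd_const l k) * bdry + ennreal (C_Q l k) * Hd \<le> D_ext"
proof -
  let ?m = "(real l + 1) / 2" let ?t = "real k / (real l + 1)"
  have t: "0 \<le> ?t" "0 \<le> 1 - ?t" using k by auto
  have 1: "ennreal (1 - ?t) * (ennreal ?m * bdry + ennreal (?m\<^sup>2) * Hd) \<le> ennreal (1 - ?t) * D_ext"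
    unfolding Hd_def by (intro mult_left_mono ext_Hardy) simp
  have 2: "ennreal ?t * (ennreal (real l + 1) * bdry) \<le> ennreal ?t * D_ext"
    by (intro mult_left_mono bdry_le) simp
  have conv: "(1 - t) * (a / 2) + t * a = (a + t * a) / 2" for t a :: real by (simp add: field_simps)
  have "bd_const l k = (1 - ?t) * ?m + ?t * (real l + 1)" unfolding conv bd_const_def by simp
  then have "ennreal (bd_const l k) = ennreal ((1 - ?t) * ?m) + ennreal (?t * (real l + 1))"
    using t by (subst ennreal_plus[symmetric]) auto
  also have "\<dots> = ennreal (1 - ?t) * ennreal ?m + ennreal ?t * ennreal (real l + 1)"
    using t by (subst ennreal_mult, simp, simp, subst ennreal_mult, simp_all)
  finally have "ennreal (bd_const l k) * bdry + ennreal (C_Q l k) * Hd =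
     ennreal (1 - ?t) * (ennreal ?m * bdry + ennreal (?m\<^sup>2) * Hd) + ennreal ?t * (ennreal (real l + 1) * bdry)"
    using t unfolding C_Q_def
    by (subst ennreal_mult[of "1 - ?t"], simp, simp) (simp only: distrib_left distrib_right ac_simps)
  also have "\<dots> \<le> ennreal (1 - ?t) * D_ext + ennreal ?t * D_ext"
    by (rule add_mono[OF 1 2])
  also have "\<dots> = D_ext"
    using t by (simp add: distrib_right[symmetric] ennreal_plus[symmetric])
  finally show ?thesis .
qed

lemma gradient_norm_finite: "(\<integral>\<^sup>+x. ennreal ((norm (G x))\<^sup>2) \<partial>lborel) < \<infinity>"
proof (rule nn_integral_compact_support_finite)
  show "continuous_on UNIV (\<lambda>x. (norm (G x))\<^sup>2)" by (intro continuous_intros G)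
  show "(norm (G x))\<^sup>2 = 0" if "norm x > R" for x
    using has_derivative_zero_outside[OF u R that] by simp
qed

lemma D_ext_finite: "D_ext < \<infinity>"
  unfolding D_ext_def
  by (rule le_less_trans[OF nn_integral_mono gradient_norm_finite]) (auto simp: indicator_def)

lemma bdry_finite: "bdry < \<infinity>"
  using bdry_le_D_ext D_ext_finite by (rule le_less_trans)

end

text \<open>A substitute for Minkowski's inequality that needs no square roots: the gap between the
  two pointwise sides is \<open>(d * a - b)^2 / d\<close>. Letting the error integral tend to 0
  first and \<open>d\<close> afterwards yields limits of squared norms.\<close>

lemma L2_triangle:
  fixes f g :: "'a \<Rightarrow> 'b::{second_countable_topology, real_normed_vector}"
  assumes [measurable]: "f \<in> borel_measurable M" "g \<in> borel_measurable M" and d: "d > 0"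
  shows "(\<integral>\<^sup>+x. ennreal ((norm (f x))\<^sup>2) \<partial>M) \<le>
    ennreal (1 + d) * (\<integral>\<^sup>+x. ennreal ((norm (g x))\<^sup>2) \<partial>M) + ennreal (1 + 1 / d) * (\<integral>\<^sup>+x. ennreal ((norm (f x - g x))\<^sup>2) \<partial>M)"
proof -
  have "(\<integral>\<^sup>+x. ennreal ((norm (f x))\<^sup>2) \<partial>M) \<le>
     (\<integral>\<^sup>+x. ennreal (1 + d) * ennreal ((norm (g x))\<^sup>2) + ennreal (1 + 1 / d) * ennreal ((norm (f x - g x))\<^sup>2) \<partial>M)"
  proof (intro nn_integral_mono)
    fix x
    let ?a = "norm (g x)" let ?b = "norm (f x - g x)"
    have "norm (f x) \<le> ?a + ?b" using norm_triangle_ineq[of "g x" "f x - g x"] by simp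
    then have "(norm (f x))\<^sup>2 \<le> (?a + ?b)\<^sup>2" by (rule power_mono) simp
    also have "\<dots> \<le> (1 + d) * ?a\<^sup>2 + (1 + 1 / d) * ?b\<^sup>2"
    proof -
      have "0 \<le> (d * ?a - ?b)\<^sup>2 / d" using d by simp
      also have "\<dots> = (1 + d) * ?a\<^sup>2 + (1 + 1 / d) * ?b\<^sup>2 - (?a + ?b)\<^sup>2"
        using d by (simp add: field_simps power2_eq_square)
      finally show ?thesis by simp
    qed
    finally have "ennreal ((norm (f x))\<^sup>2) \<le> ennreal ((1 + d) * ?a\<^sup>2 + (1 + 1 / d) * ?b\<^sup>2)"
      by (rule ennreal_leI)
    also have "\<dots> = ennreal (1 + d) * ennreal (?a\<^sup>2) + ennreal (1 + 1 / d) * ennreal (?b\<^sup>2)"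
      using d by (subst ennreal_plus, simp, simp, subst ennreal_mult, simp, simp, subst ennreal_mult, simp_all)
    finally show "ennreal ((norm (f x))\<^sup>2) \<le> ennreal (1 + d) * ennreal (?a\<^sup>2) + ennreal (1 + 1 / d) * ennreal (?b\<^sup>2)" .
  qed
  also have "\<dots> = ennreal (1 + d) * (\<integral>\<^sup>+x. ennreal ((norm (g x))\<^sup>2) \<partial>M) + ennreal (1 + 1 / d) * (\<integral>\<^sup>+x. ennreal ((norm (f x - g x))\<^sup>2) \<partial>M)"
    by (simp add: nn_integral_add nn_integral_cmult)
  finally show ?thesis .
qed

lemma ennreal_le_of_perturbation:
  fixes x a :: ennreal
  assumes a: "a < \<infinity>" and le: "\<And>d::real. d > 0 \<Longrightarrow> x \<le> ennreal (1 + d) * a"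
  shows "x \<le> a"
proof -
  obtain r where r: "a = ennreal r" "r \<ge> 0" using a by (cases a) auto
  have "x \<le> ennreal 2 * a" using le[of 1] by simp
  also have "\<dots> < \<infinity>" using a by (auto simp: ennreal_mult_less_top)
  finally obtain y where y: "x = ennreal y" "y \<ge> 0" by (cases x) auto
  have "y \<le> r + e" if "e > 0" for e
  proof -
    \<comment> \<open>The perturbation is chosen so that it adds
      \<open>e * r / (r + 1) \<le> e\<close>; the denominator \<open>r + 1\<close> covers
      \<open>r = 0\<close>.\<close>
    have "ennreal y \<le> ennreal (1 + e / (r + 1)) * ennreal r"
      using le[of "e / (r + 1)"] that r y by simp
    also have "\<dots> = ennreal ((1 + e / (r + 1)) * r)"
      using that r by (subst ennreal_mult) auto
    finally have "y \<le> (1 + e / (r + 1)) * r" using that r by (simp add: ennreal_le_iff)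
    also have "\<dots> = r + e * (r / (r + 1))" by (simp add: algebra_simps)
    also have "\<dots> \<le> r + e * 1" using that r by (intro add_left_mono mult_left_mono) auto
    finally show ?thesis by simp
  qed
  then have "y \<le> r" by (rule field_le_epsilon)
  then show ?thesis using r y by (simp add: ennreal_leI)
qed

text \<open>\<open>exterior_coercive\<close> holds along an approximating sequence of test functions
  and passes to the limit. It shows that the form on the whole completion stays above a multiple of
  the Hardy integral.\<close>

lemma H1_coercive:
  fixes u :: "real^'n \<Rightarrow> real"
  assumes card: "CARD('n) = l + 3" and k: "real k < real l + 1"
    and H: "(u, G) \<in> H1_ext" and T: "H1_trace u G T"
  shows "(\<integral>\<^sup>+x\<in>ext_ball. ennreal ((norm (G x))\<^sup>2) \<partial>lborel) < \<infinity>"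
    and "ennreal (bd_const l k) * (\<integral>\<^sup>+x. ennreal ((T x)\<^sup>2) \<partial>sphere_measure) +
      ennreal (C_Q l k) * (\<integral>\<^sup>+x\<in>ext_ball. ennreal ((u x)\<^sup>2 / (norm x)\<^sup>2) \<partial>lborel)
    \<le> (\<integral>\<^sup>+x\<in>ext_ball. ennreal ((norm (G x))\<^sup>2) \<partial>lborel)"
proof -
  let ?I = "indicator ext_ball :: real^'n \<Rightarrow> real"
  let ?a = "\<integral>\<^sup>+x\<in>ext_ball. ennreal ((norm (G x))\<^sup>2) \<partial>lborel"
  let ?h = "\<integral>\<^sup>+x\<in>ext_ball. ennreal ((u x)\<^sup>2 / (norm x)\<^sup>2) \<partial>lborel"
  let ?b = "\<integral>\<^sup>+x. ennreal ((T x)\<^sup>2) \<partial>sphere_measure"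
  let ?k = "bd_const l k" let ?c = "C_Q l k"
  have mu: "(\<lambda>x. ?I x *\<^sub>R u x) \<in> borel_measurable lborel" and mG: "(\<lambda>x. ?I x *\<^sub>R G x) \<in> borel_measurable lborel"
    using H by (auto simp: H1_ext_def set_borel_measurable_def)
  have [measurable]: "T \<in> borel_measurable borel" using T by (simp add: H1_trace_def)
  \<comment> \<open>Taken from the trace, not from membership in \<open>H1_ext\<close>, so that a
    single sequence approximates the gradient, the function and the boundary values.\<close>
  obtain \<phi> where \<phi>: "\<And>n. \<phi> n \<in> test_functions"
    and e: "(\<lambda>n. \<integral>\<^sup>+x\<in>ext_ball. ennreal ((norm (gradient (\<phi> n) x - G x))\<^sup>2) \<partial>lborel) \<longlonglongrightarrow> 0"
    and s: "(\<lambda>n. \<integral>\<^sup>+x\<in>ext_ball. ennreal ((\<phi> n x - u x)\<^sup>2 / (norm x)\<^sup>2) \<partial>lborel) \<longlonglongrightarrow> 0"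
    and t: "(\<lambda>n. \<integral>\<^sup>+x. ennreal ((\<phi> n x - T x)\<^sup>2) \<partial>sphere_measure) \<longlonglongrightarrow> 0"
    using T by (auto simp: H1_trace_def H1_converges_def)
  let ?e = "\<lambda>n. \<integral>\<^sup>+x\<in>ext_ball. ennreal ((norm (gradient (\<phi> n) x - G x))\<^sup>2) \<partial>lborel"
  let ?s = "\<lambda>n. \<integral>\<^sup>+x\<in>ext_ball. ennreal ((\<phi> n x - u x)\<^sup>2 / (norm x)\<^sup>2) \<partial>lborel"
  let ?t = "\<lambda>n. \<integral>\<^sup>+x. ennreal ((\<phi> n x - T x)\<^sup>2) \<partial>sphere_measure"
  let ?an = "\<lambda>n. \<integral>\<^sup>+x\<in>ext_ball. ennreal ((norm (gradient (\<phi> n) x))\<^sup>2) \<partial>lborel"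
  let ?hn = "\<lambda>n. \<integral>\<^sup>+x\<in>ext_ball. ennreal ((\<phi> n x)\<^sup>2 / (norm x)\<^sup>2) \<partial>lborel"
  let ?bn = "\<lambda>n. \<integral>\<^sup>+x. ennreal ((\<phi> n x)\<^sup>2) \<partial>sphere_measure"
  have gr: "(\<integral>\<^sup>+x\<in>ext_ball. ennreal ((norm (A x))\<^sup>2) \<partial>lborel) = (\<integral>\<^sup>+x. ennreal ((norm (?I x *\<^sub>R A x))\<^sup>2) \<partial>lborel)"
    for A :: "real^'n \<Rightarrow> real^'n"
    by (intro nn_integral_cong) (auto simp: indicator_def)
  have ur: "(\<integral>\<^sup>+x\<in>ext_ball. ennreal ((A x)\<^sup>2 / (norm x)\<^sup>2) \<partial>lborel) = (\<integral>\<^sup>+x. ennreal ((norm ((?I x *\<^sub>R A x) / norm x))\<^sup>2) \<partial>lborel)"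
    for A :: "real^'n \<Rightarrow> real"
    by (intro nn_integral_cong) (auto simp: indicator_def power_divide)
  have loc: "\<exists>R. C1_compact (\<phi> n) (gradient (\<phi> n)) R l" for n
    using test_function_C1_compact[OF \<phi> card] by metis
  have m\<phi> [measurable]: "\<phi> n \<in> borel_measurable borel" "gradient (\<phi> n) \<in> borel_measurable borel" for n
    using loc[of n] C1_compact.measurable_u C1_compact.measurable_G by blast+
  have [measurable]: "ext_ball \<in> sets (borel :: (real^'n) measure)"
    by (simp add: ext_ball_def)
  have mI: "(\<lambda>x. ?I x *\<^sub>R gradient (\<phi> n) x) \<in> borel_measurable lborel" "(\<lambda>x. ?I x *\<^sub>R \<phi> n x) \<in> borel_measurable lborel" for n
    by measurable
  have coer: "ennreal ?k * ?bn n + ennreal ?c * ?hn n \<le> ?an n" and an_fin: "?an n < \<infinity>" for n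
  proof -
    obtain R where R: "C1_compact (\<phi> n) (gradient (\<phi> n)) R l" using loc by blast
    show "ennreal ?k * ?bn n + ennreal ?c * ?hn n \<le> ?an n"
      using C1_compact.exterior_coercive[OF R k]
      by (simp only: C1_compact.bdry_def[OF R] C1_compact.Hd_def[OF R] C1_compact.D_ext_def[OF R])
    show "?an n < \<infinity>"
      using C1_compact.D_ext_finite[OF R] by (simp only: C1_compact.D_ext_def[OF R])
  qed
  have an_le: "?an n \<le> ennreal (1 + d) * ?a + ennreal (1 + 1 / d) * ?e n" if "d > 0" for n d
    using L2_triangle[OF mI(1) mG that, of n] by (simp only: gr scaleR_diff_right)
  have a_le: "?a \<le> ennreal (1 + d) * ?an n + ennreal (1 + 1 / d) * ?e n" if "d > 0" for n d
    using L2_triangle[OF mG mI(1) that, of n] by (simp only: gr scaleR_diff_right norm_minus_commute[of "gradient (\<phi> n) _"] norm_minus_commute[of "?I _ *\<^sub>R gradient (\<phi> n) _"])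
  have h_le: "?h \<le> ennreal (1 + d) * ?hn n + ennreal (1 + 1 / d) * ?s n" if "d > 0" for n d
  proof -
    have "(\<lambda>x. (?I x *\<^sub>R u x) / norm x) \<in> borel_measurable lborel" "(\<lambda>x. (?I x *\<^sub>R \<phi> n x) / norm x) \<in> borel_measurable lborel"
      using mu mI(2) by measurable
    from L2_triangle[OF this that] show ?thesis
      unfolding ur by (simp only: scaleR_diff_right diff_divide_distrib norm_minus_commute[of "(?I _ *\<^sub>R \<phi> n _) / _"])
  qed
  have b_le: "?b \<le> ennreal (1 + d) * ?bn n + ennreal (1 + 1 / d) * ?t n" if "d > 0" for n d
    using L2_triangle[of T sphere_measure "\<phi> n" d] that m\<phi>(1) by (simp add: power2_commute[of "T _"])
  show fin: "?a < \<infinity>"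
  proof -
    have "\<forall>\<^sub>F n in sequentially. ?e n < 1" using e by (rule order_tendstoD) simp
    then obtain n where n: "?e n < 1" by (auto simp: eventually_sequentially)
    have "?a \<le> ennreal (1 + 1) * ?an n + ennreal (1 + 1 / 1) * ?e n" by (rule a_le) simp
    also have "\<dots> < \<infinity>"
      using an_fin[of n] n by (auto simp: ennreal_mult_less_top intro: less_trans[OF n])
    finally show ?thesis .
  qed
  \<comment> \<open>One factor \<open>1 + d\<close> comes from comparing \<open>T\<close> and
    \<open>u\<close> with the approximants, the other from comparing the gradients of the
    approximants with \<open>G\<close>. They are removed one after the other, with the smaller of
    two parameters.\<close>
  have two: "ennreal ?k * ?b + ennreal ?c * ?h \<le> ennreal (1 + d) * (ennreal (1 + d) * ?a)" if d: "d > 0" for d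
  proof (rule tendsto_lowerbound)
    let ?q = "ennreal (1 + 1 / d)" and ?p = "ennreal (1 + d)"
    show "((\<lambda>n. ?p * (?p * ?a + ?q * ?e n) + ?q * (ennreal ?k * ?t n + ennreal ?c * ?s n)) \<longlongrightarrow> ?p * (?p * ?a)) sequentially"
    proof -
      have "((\<lambda>n. ?p * (?p * ?a + ?q * ?e n) + ?q * (ennreal ?k * ?t n + ennreal ?c * ?s n)) \<longlongrightarrow>
          ?p * (?p * ?a + ?q * 0) + ?q * (ennreal ?k * 0 + ennreal ?c * 0)) sequentially"
        using e s t by (intro tendsto_add ennreal_tendsto_cmult tendsto_const) auto
      then show ?thesis by simp
    qed
    show "\<forall>\<^sub>F n in sequentially. ennreal ?k * ?b + ennreal ?c * ?h \<le> ?p * (?p * ?a + ?q * ?e n) + ?q * (ennreal ?k * ?t n + ennreal ?c * ?s n)"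
    proof (intro always_eventually allI)
      fix n
      have "ennreal ?k * ?b + ennreal ?c * ?h \<le> ennreal ?k * (?p * ?bn n + ?q * ?t n) + ennreal ?c * (?p * ?hn n + ?q * ?s n)"
        using d by (intro add_mono mult_left_mono b_le h_le) auto
      also have "\<dots> = ?p * (ennreal ?k * ?bn n + ennreal ?c * ?hn n) + ?q * (ennreal ?k * ?t n + ennreal ?c * ?s n)"
        by (simp only: distrib_left ac_simps)
      also have "\<dots> \<le> ?p * (?p * ?a + ?q * ?e n) + ?q * (ennreal ?k * ?t n + ennreal ?c * ?s n)"
        using d by (intro add_right_mono mult_left_mono order_trans[OF coer an_le]) auto
      finally show "ennreal ?k * ?b + ennreal ?c * ?h \<le> \<dots>" .
    qed
  qed simp
  have 1: "ennreal ?k * ?b + ennreal ?c * ?h \<le> ennreal (1 + d) * ?a" if "d > 0" for d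
  proof (rule ennreal_le_of_perturbation)
    show "ennreal (1 + d) * ?a < \<infinity>" using fin by (auto simp: ennreal_mult_less_top)
    fix d' :: real assume d': "d' > 0"
    define m where "m = min d d'"
    have m: "m > 0" "m \<le> d" "m \<le> d'" using that d' by (auto simp: m_def)
    have "ennreal ?k * ?b + ennreal ?c * ?h \<le> ennreal (1 + m) * (ennreal (1 + m) * ?a)"
      by (rule two[OF m(1)])
    also have "\<dots> \<le> ennreal (1 + d') * (ennreal (1 + d) * ?a)"
      using m by (intro mult_mono ennreal_leI) auto
    finally show "ennreal ?k * ?b + ennreal ?c * ?h \<le> ennreal (1 + d') * (ennreal (1 + d) * ?a)" .
  qed
  show "ennreal ?k * ?b + ennreal ?c * ?h \<le> ?a"
    by (rule ennreal_le_of_perturbation[OF fin 1])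
qed

subsection \<open>Conclusion\<close>

lemma borel_measurable_ext_ball:
  assumes "continuous_on {x. norm x \<ge> 1} f"
  shows "(\<lambda>x::real^'n. indicator ext_ball x *\<^sub>R (f x :: real)) \<in> borel_measurable borel"
proof -
  have "ext_ball = {x::real^'n. norm x \<ge> 1}" by (auto simp: ext_ball_def dist_norm)
  moreover have "ext_ball \<in> sets (borel :: (real^'n) measure)" by (simp add: ext_ball_def)
  ultimately show ?thesis
    using assms by (intro borel_measurable_continuous_on_indicator) auto
qed

lemma lebesgue_integral_nonneg_eq:
  fixes f :: "'a \<Rightarrow> real"
  assumes "f \<in> borel_measurable M" "\<And>x. 0 \<le> f x"
  shows "(LINT x|M. f x) = enn2real (\<integral>\<^sup>+x. ennreal (f x) \<partial>M)"
  using assms by (intro integral_eq_nn_integral) auto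

lemma weight_integral_le:
  fixes f u :: "real^'n \<Rightarrow> real"
  assumes "\<sigma> > 0" "K > 0" "\<And>x. norm x \<ge> 1 \<Longrightarrow> f x \<le> K * norm x powr (- 2 - \<sigma>)"
    and mu: "(\<lambda>x. indicator ext_ball x *\<^sub>R u x) \<in> borel_measurable lborel"
  shows "(\<integral>\<^sup>+x\<in>ext_ball. ennreal (f x * (u x)\<^sup>2) \<partial>lborel)
    \<le> ennreal K * (\<integral>\<^sup>+x\<in>ext_ball. ennreal ((u x)\<^sup>2 / (norm x)\<^sup>2) \<partial>lborel)"
proof -
  have "(\<integral>\<^sup>+x\<in>ext_ball. ennreal (f x * (u x)\<^sup>2) \<partial>lborel) \<le>
    (\<integral>\<^sup>+x. ennreal K * ennreal ((indicator ext_ball x *\<^sub>R u x)\<^sup>2 / (norm x)\<^sup>2) \<partial>lborel)"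
  proof (intro nn_integral_mono)
    fix x :: "real^'n"
    show "ennreal (f x * (u x)\<^sup>2) * indicator ext_ball x \<le> ennreal K * ennreal ((indicator ext_ball x *\<^sub>R u x)\<^sup>2 / (norm x)\<^sup>2)"
    proof (cases "x \<in> ext_ball")
      case True
      then have x: "norm x \<ge> 1" by (auto simp: ext_ball_def dist_norm)
      have "norm x powr (- 2 - \<sigma>) \<le> norm x powr (- 2)"
        using x assms(1) by (intro powr_mono) auto
      also have "\<dots> = 1 / (norm x)\<^sup>2"
        using x by (simp add: powr_minus_divide)
      finally have "K * norm x powr (- 2 - \<sigma>) \<le> K * (1 / (norm x)\<^sup>2)"
        using assms(2) by (intro mult_left_mono) auto
      with assms(3)[OF x] have "f x \<le> K * (1 / (norm x)\<^sup>2)" by simp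
      then have "f x * (u x)\<^sup>2 \<le> K * (1 / (norm x)\<^sup>2) * (u x)\<^sup>2" by (rule mult_right_mono) simp
      then have "ennreal (f x * (u x)\<^sup>2) \<le> ennreal (K * ((u x)\<^sup>2 / (norm x)\<^sup>2))"
        by (intro ennreal_leI) simp
      also have "\<dots> = ennreal K * ennreal ((u x)\<^sup>2 / (norm x)\<^sup>2)"
        using assms(2) by (intro ennreal_mult) auto
      finally show ?thesis using True by simp
    qed simp
  qed
  also have "\<dots> = ennreal K * (\<integral>\<^sup>+x. ennreal ((indicator ext_ball x *\<^sub>R u x)\<^sup>2 / (norm x)\<^sup>2) \<partial>lborel)"
    by (intro nn_integral_cmult measurable_compose[OF _ measurable_ennreal] borel_measurable_divide
        borel_measurable_power mu) auto
  also have "(\<integral>\<^sup>+x. ennreal ((indicator ext_ball x *\<^sub>R u x)\<^sup>2 / (norm x)\<^sup>2) \<partial>lborel) =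
      (\<integral>\<^sup>+x\<in>ext_ball. ennreal ((u x)\<^sup>2 / (norm x)\<^sup>2) \<partial>lborel)"
    by (intro nn_integral_cong) (auto simp: indicator_def)
  finally show ?thesis .
qed

lemma set_integral_ext_ball:
  fixes g :: "real^'n \<Rightarrow> real"
  assumes "(\<lambda>x. indicator ext_ball x *\<^sub>R g x) \<in> borel_measurable lborel" "\<And>x. x \<in> ext_ball \<Longrightarrow> 0 \<le> g x"
  shows "(LINT x:ext_ball|lborel. g x) = enn2real (\<integral>\<^sup>+x\<in>ext_ball. ennreal (g x) \<partial>lborel)"
proof -
  have "(LINT x:ext_ball|lborel. g x) = enn2real (\<integral>\<^sup>+x. ennreal (indicator ext_ball x *\<^sub>R g x) \<partial>lborel)"
    unfolding set_lebesgue_integral_def using assms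
    by (intro lebesgue_integral_nonneg_eq) (auto simp: indicator_def)
  also have "(\<integral>\<^sup>+x. ennreal (indicator ext_ball x *\<^sub>R g x) \<partial>lborel) = (\<integral>\<^sup>+x. ennreal (g x) * indicator ext_ball x \<partial>lborel)"
    by (intro nn_integral_cong) (auto simp: indicator_def)
  finally show ?thesis .
qed

lemma C_Q_pos: "real k < real l + 1 \<Longrightarrow> C_Q l k > 0"
  by (simp add: C_Q_def)

lemma V_interior:
  assumes card: "CARD('n) = l + 3" and x: "norm (x :: real^'n) < 1"
  shows "V f k \<epsilon> x = Vrad l k (norm x) / (norm x)\<^sup>2"
  using x by (simp add: V_def Vrad_def card XP_def prod_power_distrib add_divide_distrib)

text \<open>The decay of \<open>f\<close> gives a denominator of at most \<open>K\<close> times the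
  Hardy integral, and coercivity a numerator of at least \<open>C_Q l k\<close> times it. If nothing
  is admissible, the infimum is infinite and the bound still holds.\<close>

lemma eps_k0_lower_bound:
  fixes f :: "real^'n \<Rightarrow> real"
  assumes card: "CARD('n) = l + 3" and k: "real k < real l + 1"
    and f: "\<And>x. norm x \<ge> 1 \<Longrightarrow> f x \<ge> 0" "continuous_on {x. norm x \<ge> 1} f"
    and K: "\<sigma> > 0" "K > 0" "\<And>x. norm x \<ge> 1 \<Longrightarrow> f x \<le> K * norm x powr (- 2 - \<sigma>)"
  shows "ereal (C_Q l k / K) \<le> eps_k0 k f"
  unfolding eps_k0_def
proof (intro INF_greatest, clarify)
  fix u G T
  assume H: "(u, G) \<in> H1_ext" and T: "H1_trace u G T" and pos: "0 < (LINT x:ext_ball|lborel. f x * (u x)\<^sup>2)"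
  let ?a = "\<integral>\<^sup>+x\<in>ext_ball. ennreal ((norm (G x))\<^sup>2) \<partial>lborel"
  let ?h = "\<integral>\<^sup>+x\<in>ext_ball. ennreal ((u x)\<^sup>2 / (norm x)\<^sup>2) \<partial>lborel"
  let ?b = "\<integral>\<^sup>+x. ennreal ((T x)\<^sup>2) \<partial>sphere_measure"
  let ?F = "\<integral>\<^sup>+x\<in>ext_ball. ennreal (f x * (u x)\<^sup>2) \<partial>lborel"
  let ?I = "indicator ext_ball :: real^'n \<Rightarrow> real"
  have mu: "(\<lambda>x. ?I x *\<^sub>R u x) \<in> borel_measurable lborel" and mG: "(\<lambda>x. ?I x *\<^sub>R G x) \<in> borel_measurable lborel"
    using H by (auto simp: H1_ext_def set_borel_measurable_def)
  have mT [measurable]: "T \<in> borel_measurable borel" using T by (simp add: H1_trace_def)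
  have mf: "(\<lambda>x. ?I x *\<^sub>R f x) \<in> borel_measurable lborel"
    using borel_measurable_ext_ball[OF f(2)] by simp
  have ext: "x \<in> ext_ball \<Longrightarrow> norm x \<ge> 1" for x :: "real^'n" by (auto simp: ext_ball_def dist_norm)
  note co = H1_coercive[OF card k H T]
  have c: "C_Q l k > 0" by (rule C_Q_pos[OF k])
  have kp: "bd_const l k > 0" by (simp add: bd_const_def)
  obtain a where a: "?a = ennreal a" "a \<ge> 0" using co(1) by (cases ?a) auto
  have "ennreal (C_Q l k) * ?h \<le> ennreal a" "ennreal (bd_const l k) * ?b \<le> ennreal a"
    using co(2) unfolding a by (auto intro: order_trans[rotated])
  then have "?h \<noteq> top" "?b \<noteq> top"
    using c kp by (auto simp: ennreal_mult_top top_unique)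
  then obtain h b where h: "?h = ennreal h" "h \<ge> 0" and b: "?b = ennreal b" "b \<ge> 0"
    by (cases ?h; cases ?b) auto
  have coer: "bd_const l k * b + C_Q l k * h \<le> a"
    using co(2) a b h c kp by (simp add: ennreal_mult[symmetric] ennreal_plus[symmetric] del: ennreal_plus)
  have "?F \<le> ennreal K * ennreal h"
    using weight_integral_le[OF K mu] by (simp add: h)
  then have "?F \<le> ennreal (K * h)" using K h by (simp add: ennreal_mult)
  then obtain F where F: "?F = ennreal F" "F \<ge> 0" "F \<le> K * h"
    using K h by (cases ?F) (auto simp: top_unique)
  have "(\<lambda>x. (?I x *\<^sub>R f x) * (?I x *\<^sub>R u x)\<^sup>2) \<in> borel_measurable lborel" using mf mu by measurable
  also have "(\<lambda>x. (?I x *\<^sub>R f x) * (?I x *\<^sub>R u x)\<^sup>2) = (\<lambda>x. ?I x *\<^sub>R (f x * (u x)\<^sup>2))"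
    by (auto simp: indicator_def)
  finally have "(LINT x:ext_ball|lborel. f x * (u x)\<^sup>2) = enn2real ?F"
    using f(1) ext by (intro set_integral_ext_ball) auto
  then have F': "(LINT x:ext_ball|lborel. f x * (u x)\<^sup>2) = F" by (simp add: F)
  have "(\<lambda>x. (norm (?I x *\<^sub>R G x))\<^sup>2) \<in> borel_measurable lborel" using mG by measurable
  also have "(\<lambda>x. (norm (?I x *\<^sub>R G x))\<^sup>2) = (\<lambda>x. ?I x *\<^sub>R (norm (G x))\<^sup>2)"
    by (auto simp: indicator_def)
  finally have "(LINT x:ext_ball|lborel. (norm (G x))\<^sup>2) = enn2real ?a"
    by (intro set_integral_ext_ball) auto
  then have a': "(LINT x:ext_ball|lborel. (norm (G x))\<^sup>2) = a" by (simp add: a)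
  have "(LINT x|sphere_measure. (T x)\<^sup>2) = enn2real ?b"
    by (intro lebesgue_integral_nonneg_eq) auto
  then have b': "(LINT x|sphere_measure. (T x)\<^sup>2) = b" by (simp add: b)
  have "C_Q l k / K * F \<le> C_Q l k / K * (K * h)"
    using F c K by (intro mult_left_mono) auto
  also have "\<dots> = C_Q l k * h" using K by simp
  also have "\<dots> \<le> a - bd_const l k * b" using coer by simp
  finally have "C_Q l k / K \<le> (a - bd_const l k * b) / F"
    using pos by (simp add: F' pos_le_divide_eq)
  moreover have "(real CARD('n) - 2 + real k) / 2 = bd_const l k" by (simp add: bd_const_def card)
  ultimately show "ereal (C_Q l k / K) \<le> ereal (((LINT x:ext_ball|lborel. (norm (G x))\<^sup>2)
      - (real CARD('n) - 2 + real k) / 2 * (LINT x|sphere_measure. (T x)\<^sup>2))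
      / (LINT x:ext_ball|lborel. f x * (u x)\<^sup>2))"
    by (simp add: F' a' b')
qed

text \<open>A test function, with its classical gradient and its own boundary values, is
  approximated by the constant sequence and is therefore admissible.\<close>

lemma eps_k0_le_quotient:
  fixes f :: "real^'n \<Rightarrow> real"
  assumes R: "C1_compact u (gradient u) R l" and u: "u \<in> test_functions"
    and pos: "0 < (LINT x:ext_ball|lborel. f x * (u x)\<^sup>2)"
  shows "eps_k0 k f \<le> ereal (((LINT x:ext_ball|lborel. (norm (gradient u x))\<^sup>2)
      - (real CARD('n) - 2 + real k) / 2 * (LINT x|sphere_measure. (u x)\<^sup>2))
      / (LINT x:ext_ball|lborel. f x * (u x)\<^sup>2))"
proof -
  have [measurable]: "ext_ball \<in> sets (borel :: (real^'n) measure)" by (simp add: ext_ball_def)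
  have [measurable]: "u \<in> borel_measurable borel" "gradient u \<in> borel_measurable borel"
    by (rule C1_compact.measurable_u[OF R], rule C1_compact.measurable_G[OF R])
  have conv: "H1_converges (\<lambda>_. u) u (gradient u)"
    by (simp add: H1_converges_def)
  have "(u, gradient u) \<in> H1_ext"
    unfolding H1_ext_def set_borel_measurable_def using conv u by auto
  moreover have "H1_trace u (gradient u) u"
    unfolding H1_trace_def using conv u by (auto intro!: exI[of _ "\<lambda>_. u"])
  ultimately have "(u, gradient u, u) \<in> {(u, G, T). (u, G) \<in> H1_ext \<and> H1_trace u G T \<and> (LINT x:ext_ball|lborel. f x * (u x)\<^sup>2) > 0}"
    using pos by simp
  then show ?thesis
    unfolding eps_k0_def by (rule INF_lower2) simp
qed

text \<open>The real number \<open>\<epsilon>'\<close> stands in for the possibly infinite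
  \<open>eps_k0 k f\<close>. The fraction \<open>\<epsilon> / \<epsilon>'\<close> of the exterior
  form pays for the term with \<open>f\<close>, and the rest still controls the exterior
  gradient.\<close>

lemma improved_Hardy_Sobolev:
  fixes f :: "real^'n \<Rightarrow> real"
  assumes card: "CARD('n) = l + 3" and k: "real k < real l + 1"
    and f: "\<And>x. norm x \<ge> 1 \<Longrightarrow> f x \<ge> 0" "continuous_on {x. norm x \<ge> 1} f"
    and K: "\<sigma> > 0" "K > 0" "\<And>x. norm x \<ge> 1 \<Longrightarrow> f x \<le> K * norm x powr (- 2 - \<sigma>)"
    and eps: "0 < \<epsilon>" "\<epsilon> < \<epsilon>'" "ereal \<epsilon>' \<le> eps_k0 k f"
    and test: "u \<in> test_functions"
  shows "(LINT x|lborel. (norm (gradient u x))\<^sup>2) - (LINT x|lborel. V f k \<epsilon> x * (u x)\<^sup>2)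
    \<ge> (1 - \<epsilon> / \<epsilon>') * (1 - bd_const l k / (real l + 1)) / C_S l k powr (2 / sob_exp l) *
      (LINT x|lborel. \<bar>u x\<bar> powr sob_exp l * (\<Prod>j=1..k+1. X_tilde j x) powr (1 + sob_exp l / 2)) powr (2 / sob_exp l)"
proof -
  obtain R where loc: "C1_compact u (gradient u) R l" by (rule test_function_C1_compact[OF test card])
  interpret C1_compact u "gradient u" R l k by (rule loc)
  let ?I = "indicator ext_ball :: real^'n \<Rightarrow> real"
  let ?a = "\<integral>\<^sup>+x\<in>ball 0 1. ennreal ((norm (gradient u x))\<^sup>2) \<partial>lborel"
  let ?v = "\<integral>\<^sup>+x\<in>ball 0 1. ennreal (Vrad l k (norm x) / (norm x)\<^sup>2 * (u x)\<^sup>2) \<partial>lborel"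
  let ?F = "\<integral>\<^sup>+x\<in>ext_ball. ennreal (f x * (u x)\<^sup>2) \<partial>lborel"
  have [measurable]: "ext_ball \<in> sets (borel :: (real^'n) measure)" by (simp add: ext_ball_def)
  have ext: "x \<in> ext_ball \<longleftrightarrow> \<not> norm x < 1" for x :: "real^'n" by (auto simp: ext_ball_def dist_norm)
  have mf [measurable]: "(\<lambda>x. ?I x *\<^sub>R f x) \<in> borel_measurable borel"
    by (rule borel_measurable_ext_ball[OF f(2)])
  have mV [measurable]: "Vrad l k \<in> borel_measurable borel" unfolding Vrad_def by measurable
  have kp: "bd_const l k > 0" by (simp add: bd_const_def)
  have Vnn: "0 \<le> Vrad l k r" for r by (simp add: Vrad_def sum_nonneg)
  have fnn: "0 \<le> f x" if "x \<in> ext_ball" for x using that ext f(1) by simp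

  obtain A where A: "D_ext = ennreal A" "A \<ge> 0" using D_ext_finite by (cases D_ext) auto
  obtain b where b: "bdry = ennreal b" "b \<ge> 0" using bdry_finite by (cases bdry) auto
  have "?a < \<infinity>"
    by (rule le_less_trans[OF nn_integral_mono gradient_norm_finite]) (auto simp: indicator_def)
  then obtain a where a: "?a = ennreal a" "a \<ge> 0" by (cases ?a) auto
  \<comment> \<open>Finiteness of the singular potential term and of the remainder follows from this
    inequality itself, since its right-hand side is finite.\<close>
  have gs: "?v + D_int \<le> ennreal (bd_const l k * b + a)"
  proof -
    have "ennreal (bd_const l k * b + a) = ennreal (bd_const l k) * bdry + ?a"
      unfolding a(1) b(1) using a(2) b(2) kp by (subst ennreal_plus) (auto simp: ennreal_mult)
    then show ?thesis using ball_ground_state by (simp only: bd_const_def)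
  qed
  then have "?v \<noteq> top" "D_int \<noteq> top" by (auto simp: top_unique)
  then obtain v d where v: "?v = ennreal v" "v \<ge> 0" and d: "D_int = ennreal d" "d \<ge> 0"
    by (cases ?v; cases D_int) auto
  have gs': "v + d \<le> bd_const l k * b + a"
    using gs v d a b kp by (simp add: ennreal_plus[symmetric] del: ennreal_plus)
  have bA: "(real l + 1) * b \<le> A"
  proof -
    have "ennreal ((real l + 1) * b) = ennreal (real l + 1) * bdry"
      unfolding b(1) using b(2) by (intro ennreal_mult) auto
    then have "ennreal ((real l + 1) * b) \<le> ennreal A" using bdry_le A by simp
    then show ?thesis using A by (simp only: ennreal_le_iff)
  qed
  have mu: "(\<lambda>x. ?I x *\<^sub>R u x) \<in> borel_measurable lborel" by measurable
  have "ennreal (C_Q l k) * Hd \<le> ennreal A"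
    using exterior_coercive[OF k] A by (auto intro: order_trans[rotated])
  then have "Hd \<noteq> top" using C_Q_pos[OF k] by (auto simp: ennreal_mult_top top_unique)
  then have "ennreal K * Hd < \<infinity>" by (auto simp: ennreal_mult_less_top less_top)
  then have "?F < \<infinity>" using weight_integral_le[OF K mu] by (simp add: Hd_def le_less_trans)
  then obtain F where F: "?F = ennreal F" "F \<ge> 0" by (cases ?F) auto
  have "(\<lambda>x. (?I x *\<^sub>R f x) * (u x)\<^sup>2) \<in> borel_measurable lborel" by measurable
  also have "(\<lambda>x. (?I x *\<^sub>R f x) * (u x)\<^sup>2) = (\<lambda>x. ?I x *\<^sub>R (f x * (u x)\<^sup>2))" by auto
  finally have F': "(LINT x:ext_ball|lborel. f x * (u x)\<^sup>2) = F"
    using fnn F by (subst set_integral_ext_ball) auto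
  have A': "(LINT x:ext_ball|lborel. (norm (gradient u x))\<^sup>2) = A"
    using A by (subst set_integral_ext_ball) (auto simp: D_ext_def)
  have b': "(LINT x|sphere_measure. (u x)\<^sup>2) = b"
    using b by (subst lebesgue_integral_nonneg_eq) (auto simp: bdry_def)

  have kl: "bd_const l k < real l + 1" using k by (simp add: bd_const_def)
  have Q: "(1 - bd_const l k / (real l + 1)) * A \<le> A - bd_const l k * b"
  proof -
    have "bd_const l k / (real l + 1) * ((real l + 1) * b) \<le> bd_const l k / (real l + 1) * A"
      using bA kp by (intro mult_left_mono) auto
    moreover have "bd_const l k / (real l + 1) * ((real l + 1) * b) = bd_const l k * b" by simp
    ultimately show ?thesis by (simp only: left_diff_distrib mult_1 diff_left_mono)
  qed
  have Q0: "0 \<le> (1 - bd_const l k / (real l + 1)) * A" using kl A by simp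
  \<comment> \<open>If \<open>F = 0\<close>, the function is not admissible in the infimum and the
    claim reduces to the non-negativity of the exterior form.\<close>
  have QF: "\<epsilon>' * F \<le> A - bd_const l k * b"
  proof (cases "F = 0")
    case True
    then show ?thesis using Q Q0 by simp
  next
    case False
    have "(real CARD('n) - 2 + real k) / 2 = bd_const l k" by (simp add: bd_const_def card)
    with False have "ereal \<epsilon>' \<le> ereal ((A - bd_const l k * b) / F)"
      using order_trans[OF eps(3) eps_k0_le_quotient[OF loc test, of f k]] F
      by (simp add: F' A' b')
    then show ?thesis using False F by (simp add: pos_le_divide_eq)
  qed
  have eF: "(1 - \<epsilon> / \<epsilon>') * (A - bd_const l k * b) \<le> A - bd_const l k * b - \<epsilon> * F"
  proof -
    have "\<epsilon> / \<epsilon>' * (\<epsilon>' * F) \<le> \<epsilon> / \<epsilon>' * (A - bd_const l k * b)"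
      using QF eps by (intro mult_left_mono) auto
    then show ?thesis using eps by (simp add: left_diff_distrib)
  qed
  let ?c = "(1 - \<epsilon> / \<epsilon>') * (1 - bd_const l k / (real l + 1))"
  \<comment> \<open>The bound by 1 lets the same constant multiply the interior remainder, which
    enters with coefficient 1.\<close>
  have c: "0 < ?c" "?c \<le> 1"
    using eps kl kp by (auto intro!: mult_le_one mult_pos_pos)

  have "(LINT x|lborel. (norm (gradient u x))\<^sup>2) = enn2real (\<integral>\<^sup>+x. ennreal ((norm (gradient u x))\<^sup>2) \<partial>lborel)"
    by (intro lebesgue_integral_nonneg_eq) auto
  also have "(\<integral>\<^sup>+x. ennreal ((norm (gradient u x))\<^sup>2) \<partial>lborel) = (\<integral>\<^sup>+x. ennreal ((norm (gradient u x))\<^sup>2) * indicator (ball 0 1) x + ennreal ((norm (gradient u x))\<^sup>2) * indicator ext_ball x \<partial>lborel)"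
    by (intro nn_integral_cong) (auto simp: indicator_def ext_ball_def)
  also have "\<dots> = ?a + D_ext"
    unfolding D_ext_def by (intro nn_integral_add) measurable
  also have "enn2real \<dots> = a + A" using a A by (simp add: ennreal_plus[symmetric] del: ennreal_plus)
  finally have LG: "(LINT x|lborel. (norm (gradient u x))\<^sup>2) = a + A" .

  have Veq: "V f k \<epsilon> x * (u x)\<^sup>2 = (if norm x < 1 then Vrad l k (norm x) / (norm x)\<^sup>2 * (u x)\<^sup>2 else \<epsilon> * ((?I x *\<^sub>R f x) * (u x)\<^sup>2))" for x
    using V_interior[OF card, of x f k \<epsilon>] ext[of x] by (auto simp: V_def)
  \<comment> \<open>The \<open>ennreal\<close> integral turns out to be finite, so the Bochner
    integral has its true value and not the default 0.\<close>
  have "(LINT x|lborel. V f k \<epsilon> x * (u x)\<^sup>2) = enn2real (\<integral>\<^sup>+x. ennreal (V f k \<epsilon> x * (u x)\<^sup>2) \<partial>lborel)"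
  proof (intro lebesgue_integral_nonneg_eq)
    show "(\<lambda>x. V f k \<epsilon> x * (u x)\<^sup>2) \<in> borel_measurable lborel" unfolding Veq by measurable
    show "0 \<le> V f k \<epsilon> x * (u x)\<^sup>2" for x
      unfolding Veq using Vnn fnn[of x] eps by (auto simp: indicator_def)
  qed
  also have "(\<integral>\<^sup>+x. ennreal (V f k \<epsilon> x * (u x)\<^sup>2) \<partial>lborel) =
     (\<integral>\<^sup>+x. ennreal (Vrad l k (norm x) / (norm x)\<^sup>2 * (u x)\<^sup>2) * indicator (ball 0 1) x + ennreal \<epsilon> * (ennreal ((?I x *\<^sub>R f x) * (u x)\<^sup>2)) \<partial>lborel)"
    unfolding Veq using eps fnn
    by (intro nn_integral_cong) (auto simp: indicator_def ext ennreal_mult)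
  also have "\<dots> = ?v + ennreal \<epsilon> * (\<integral>\<^sup>+x. ennreal ((?I x *\<^sub>R f x) * (u x)\<^sup>2) \<partial>lborel)"
    by (subst nn_integral_add, measurable, subst nn_integral_cmult, measurable)
  also have "(\<integral>\<^sup>+x. ennreal ((?I x *\<^sub>R f x) * (u x)\<^sup>2) \<partial>lborel) = ?F"
    by (intro nn_integral_cong) (auto simp: indicator_def)
  also have "enn2real (?v + ennreal \<epsilon> * ?F) = v + \<epsilon> * F"
    using v F eps by (simp add: ennreal_mult[symmetric] ennreal_plus[symmetric] del: ennreal_plus)
  finally have LV: "(LINT x|lborel. V f k \<epsilon> x * (u x)\<^sup>2) = v + \<epsilon> * F" .

  have "?c * (d + A) \<le> d + (1 - \<epsilon> / \<epsilon>') * ((1 - bd_const l k / (real l + 1)) * A)"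
    using c d mult_right_mono[of ?c 1 d] by (simp add: distrib_left mult.assoc)
  also have "\<dots> \<le> d + (1 - \<epsilon> / \<epsilon>') * (A - bd_const l k * b)"
    using Q eps by (intro add_left_mono mult_left_mono) auto
  also have "\<dots> \<le> d + (A - bd_const l k * b - \<epsilon> * F)" using eF by simp
  also have "\<dots> \<le> (a + A) - (v + \<epsilon> * F)" using gs' by simp
  finally have main: "?c * (d + A) \<le> (LINT x|lborel. (norm (gradient u x))\<^sup>2) - (LINT x|lborel. V f k \<epsilon> x * (u x)\<^sup>2)"
    by (simp only: LG LV)

  let ?p = "sob_exp l"
  let ?S = "LINT x|lborel. \<bar>u x\<bar> powr ?p * (\<Prod>j=1..k+1. X_tilde j x) powr (1 + ?p / 2)"
  have "?S = enn2real (\<integral>\<^sup>+x. ennreal (\<bar>u x\<bar> powr ?p * W (norm x) powr (1 + ?p / 2)) \<partial>lborel)"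
    unfolding prod_X_tilde Suc_eq_plus1[symmetric] by (intro lebesgue_integral_nonneg_eq) auto
  also have "\<dots> \<le> C_S l k * (d + A) powr (?p / 2)"
  proof (rule enn2real_leI)
    show "(\<integral>\<^sup>+x. ennreal (\<bar>u x\<bar> powr ?p * W (norm x) powr (1 + ?p / 2)) \<partial>lborel) \<le> ennreal (C_S l k * (d + A) powr (?p / 2))"
      using d A by (intro weighted_Sobolev) (auto simp: D_def ennreal_plus)
  qed (use C_S_pos[of l k] in simp)
  finally have "?S powr (2 / ?p) \<le> (C_S l k * (d + A) powr (?p / 2)) powr (2 / ?p)"
    using sob_exp_gt[of l] by (intro powr_mono2) auto
  also have "\<dots> = C_S l k powr (2 / ?p) * (d + A)"
    using C_S_pos[of l k] sob_exp_gt[of l] d A by (simp add: powr_mult powr_powr)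
  finally have "?c / C_S l k powr (2 / ?p) * ?S powr (2 / ?p) \<le> ?c / C_S l k powr (2 / ?p) * (C_S l k powr (2 / ?p) * (d + A))"
    using c by (intro mult_left_mono) auto
  also have "\<dots> = ?c * (d + A)" using C_S_pos[of l k] by simp
  finally show ?thesis using main by linarith
qed

theorem theorem5p1:
  fixes f :: "real^'n \<Rightarrow> real" and k :: nat and K \<sigma> :: real
  assumes "CARD('n) \<ge> 3"
    and "k \<ge> 1" and "k < CARD('n) - 2"
    and "\<And>x. norm x \<ge> 1 \<Longrightarrow> f x \<ge> 0"
    and "continuous_on {x. norm x \<ge> 1} f"
    and "\<And>x y. norm x \<ge> 1 \<Longrightarrow> norm x = norm y \<Longrightarrow> f x = f y"
    and "\<sigma> > 0" and "K > 0"
    and "\<And>x. norm x \<ge> 1 \<Longrightarrow> f x \<le> K * norm x powr (- 2 - \<sigma>)"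
  shows "eps_k0 k f > 0 \<and>
    (\<forall>\<epsilon>>0. ereal \<epsilon> < eps_k0 k f \<longrightarrow>
      (\<exists>c>0. \<forall>u \<in> (test_functions :: (real^'n \<Rightarrow> real) set).
        (LINT x|lborel. (norm (gradient u x))\<^sup>2) - (LINT x|lborel. V f k \<epsilon> x * (u x)\<^sup>2)
        \<ge> c * (LINT x|lborel. \<bar>u x\<bar> powr (2 * real CARD('n) / (real CARD('n) - 2))
                 * (\<Prod>j=1..k+1. X_tilde j x) powr ((2 * real CARD('n) - 2) / (real CARD('n) - 2)))
              powr ((real CARD('n) - 2) / real CARD('n))))"
proof (intro conjI allI impI)
  define l where "l = CARD('n) - 3"
  have card: "CARD('n) = l + 3" using assms(1) by (simp add: l_def)
  have k: "real k < real l + 1" using assms(3) card by simp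
  have "0 < ereal (C_Q l k / K)" using C_Q_pos[OF k] assms(8) by simp
  also have "\<dots> \<le> eps_k0 k f"
    by (rule eps_k0_lower_bound[OF card k assms(4,5,7-9)])
  finally show "eps_k0 k f > 0" .
  fix \<epsilon> :: real assume \<epsilon>: "\<epsilon> > 0" "ereal \<epsilon> < eps_k0 k f"
  \<comment> \<open>Strictly between, and real also when \<open>eps_k0 k f\<close> is infinite; the
    strictness makes \<open>1 - \<epsilon> / \<epsilon>'\<close> positive.\<close>
  obtain \<epsilon>' where \<epsilon>': "ereal \<epsilon> < ereal \<epsilon>'" "ereal \<epsilon>' < eps_k0 k f"
    using ereal_dense2[OF \<epsilon>(2)] by blast
  let ?c = "(1 - \<epsilon> / \<epsilon>') * (1 - bd_const l k / (real l + 1)) / C_S l k powr (2 / sob_exp l)"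
  have exps: "2 * real CARD('n) / (real CARD('n) - 2) = sob_exp l"
    "(2 * real CARD('n) - 2) / (real CARD('n) - 2) = 1 + sob_exp l / 2"
    "(real CARD('n) - 2) / real CARD('n) = 2 / sob_exp l"
    unfolding card sob_exp_def by (simp_all add: field_simps)
  let ?L = "\<lambda>u. (LINT x|lborel. (norm (gradient u x))\<^sup>2) - (LINT x|lborel. V f k \<epsilon> x * (u x)\<^sup>2)"
  let ?R = "\<lambda>u::real^'n \<Rightarrow> real. (LINT x|lborel. \<bar>u x\<bar> powr (2 * real CARD('n) / (real CARD('n) - 2))
      * (\<Prod>j=1..k+1. X_tilde j x) powr ((2 * real CARD('n) - 2) / (real CARD('n) - 2)))
    powr ((real CARD('n) - 2) / real CARD('n))"
  have "\<forall>u\<in>test_functions. ?L u \<ge> ?c * ?R u"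
    unfolding exps using \<epsilon> \<epsilon>'
    by (intro ballI improved_Hardy_Sobolev[OF card k assms(4,5,7-9)]) auto
  moreover have "?c > 0"
    using \<epsilon> \<epsilon>' k C_S_pos[of l k] by (simp add: bd_const_def)
  ultimately show "\<exists>c>0. \<forall>u\<in>test_functions. ?L u \<ge> c * ?R u"
    by blast
qed

end
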